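(* Let $RT$ be a $k$-variable Reshetikhin--Turaev knot polynomial defined by an $R$-matrix $R\in\mathrm{Aut}(V\otimes V)$ and a ribbon element $h\in\mathrm{Aut}(V)$, and let $d=\dim V$. For any oriented knot diagram $D$ with $n\ge 2$ crossings and any contraction sequence $\mathcal S$ on $D$ with contraction-width $w$, computing $RT(D)$ by contracting the associated tensor network along $\mathcal S$ takes time $$O\bigl(d^{w}\,n^{k+2}(\log n)^3\bigr),$$ where the implied constant depends only on the fixed data defining $RT$ (and not on $D$, $n$, $\mathcal S$, $w$).
   Context: **Reshetikhin--Turaev knot polynomial.** Let $\mathcal R=\mathbb Z[t_1^{\pm1},\dots,t_k^{\pm1}]$ and let $V$ be a vector space of dimension $d$ (over a field containing $\mathcal R$) with a fixed basis $\mathcal B=\{e_1,\dots,e_d\}$. An $R$-matrix $R\in\mathrm{Aut}(V\otimes V)$ and a ribbon element $h\in\mathrm{Aut}(V)$ are fixed such that the matrix entries of $R^{\pm1}$ and $h^{\pm1}$ in this basis lie in $\mathcal R$. They are assumed to satisfy the usual Reshetikhin--Turaev conditions (Yang--Baxter equation and compatibility with $h$), so that the construction below yields an endomorphism of $V$ that does not depend on the choices made and is a scalar multiple of the identity. Given an oriented knot diagram $D$, cut one arc open and pull the two ends to infinity (outgoing end vertically up, other end vertically down) without creating self-intersections, and apply a planar isotopy so that both strands point upward near every crossing. This is an oriented long knot diagram, on which the height function has its local extrema only on the arcs. The rotation number of an arc is the number of its local minima at which it points to the right minus the number of its local maxima at which it points to the right. There is a known $O(n)$ algorithm producing such a long diagram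 with all rotation numbers in $\{0,\pm1\}$. The Reshetikhin--Turaev functor assigns $R$ to each positive crossing and $R^{-1}$ to each negative crossing (read upward as maps $V\otimes V\to V\otimes V$). It also assigns $h$ to each right-pointing local minimum (cup), $h^{-1}$ to each right-pointing local maximum (cap), and the identity pairing/copairing to left-pointing cups and caps. Hence an arc of rotation number $r$ carries $h^{r}$. The composite is an endomorphism of $V$ that is a scalar multiple of the identity, and $RT(D)\in\mathcal R$ is this scalar. **Tensor network.** A tensor network over $\mathcal R$ is a multigraph with a tensor with entries in $\mathcal R$ at each vertex, whose legs (indices) correspond bijectively to the edge-ends at that vertex, the two legs at the ends of each edge having equal dimension. The tensor network of $D$ has a degree-4 vertex for each crossing, carrying the 4-tensor of matrix entries of $R^{\pm1}$, and a degree-2 vertex on each arc of rotation number $\pm1$, carrying the 2-tensor of matrix entries of $h^{\pm1}$. It thus has at most $2n$ vertices, and all legs have dimension $d$. The two free legs from the cut arc are eliminated by setting both their indices equal to $e_1$. Then $RT(D)$ is the sum, over all assignments of basis elements to the edges, of the product of the corresponding tensor entries. **Contraction sequences and contraction-width.** A contraction step on a (multi)graph or tensor network chooses a nonempty set of $s$ edges, with $c$ vertices (tensors) incident to them. It replaces these vertices by one new vertex and deletes the chosen edges. On tensors, the new tensor is obtained by multiplying entries of the $c$ tensors and summing over the indices of the $s$ chosen edges. A contraction sequence is a sequence of such steps carried out until no edges remain (so, for a connected graph, until a single vertex remains). If a step contracts $c$ tensors having $l_1,\dots,l_c$ legs (degrees, loops counted twice) along $s$ edges, its local contraction-width is $-s+\sum_{i=1}^c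 l_i$. The contraction-width $w(\mathcal S)$ of a contraction sequence $\mathcal S$ is the maximum of the local contraction-widths of its steps. A contraction sequence on a knot diagram $D$ means one on the underlying 4-regular planar multigraph (vertices are the crossings, edges are the arcs between them). "Contracting along $\mathcal S$" means contracting the tensor network of $D$ along the sequence induced by $\mathcal S$, with the degree-2 vertices absorbed into neighbouring tensors and the cut arc omitted, until the value $RT(D)$ is obtained. **Cost model.** Time is counted in bit operations. Additions and multiplications in $\mathcal R$ and $\mathbb Z$ may be performed by fast algorithms, with two $b$-bit integers added or multiplied in time $O(b\log b)$. *)

theory Defs
  imports
    Complex_Main
    "HOL-Library.Poly_Mapping"
    "HOL-Library.Log_Nat"
    "HOL-Library.Monad_Syntax"
    "HOL-Combinatorics.Orbits"
begin

section \<open>Laurent polynomials\<close>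

text \<open>Integer Laurent polynomials in variables indexed by the naturals; those in the first
  \<open>k\<close> variables form the ring \<open>\<int>[t\<^sub>1\<^sup>\<plusminus>\<^sup>1, \<dots>, t\<^sub>k\<^sup>\<plusminus>\<^sup>1]\<close>.\<close>

type_synonym laurent = "(nat \<Rightarrow>\<^sub>0 int) \<Rightarrow>\<^sub>0 int"

definition laurent_in :: "nat \<Rightarrow> laurent \<Rightarrow> bool" where
  "laurent_in k p \<longleftrightarrow> (\<forall>m\<in>Poly_Mapping.keys p. Poly_Mapping.keys m \<subseteq> {..<k})"


section \<open>Oriented knot diagrams\<close>

text \<open>An oriented knot diagram is given by its signed Gauss code: running once along the
  knot, the \<open>i\<close>-th passage through a crossing is recorded as the pair of that crossing and a flag
  that is true on the overstrand. Edge \<open>i\<close> of the underlying 4-regular multigraph runs from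
  passage \<open>i\<close> to the cyclically next passage.\<close>

record diagram =
  code :: "(nat \<times> bool) list"
  positive :: "nat \<Rightarrow> bool"

definition crossings :: "diagram \<Rightarrow> nat" where
  "crossings D = length (code D) div 2"

definition passage :: "diagram \<Rightarrow> nat \<times> bool \<Rightarrow> nat" where
  "passage D x = length (takeWhile (\<lambda>y. y \<noteq> x) (code D))"

definition partner :: "diagram \<Rightarrow> nat \<Rightarrow> nat" where
  "partner D i = (case code D ! i of (c, ov) \<Rightarrow> passage D (c, \<not> ov))"

definition out_edge :: "diagram \<Rightarrow> nat \<Rightarrow> nat" where
  "out_edge D i = i"

definition in_edge :: "diagram \<Rightarrow> nat \<Rightarrow> nat" where
  "in_edge D i = (i + length (code D) - 1) mod length (code D)"

text \<open>A dart \<open>(e, b)\<close> is an end of the edge \<open>e\<close>: its start if \<open>b\<close> holds, its end otherwise. At a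
  positive crossing the counterclockwise order of the darts is over-out, under-out, over-in,
  under-in; at a negative one it is over-out, under-in, over-in, under-out. The next two functions
  map a dart to the next one around its crossing and along its face.\<close>

definition turn :: "diagram \<Rightarrow> nat \<times> bool \<Rightarrow> nat \<times> bool" where
  "turn D = (\<lambda>(e, b).
     let i = (if b then e else Suc e mod length (code D));
         (c, ov) = code D ! i;
         j = partner D i
     in if b = (ov = positive D c) then (out_edge D j, True) else (in_edge D j, False))"

definition face_next :: "diagram \<Rightarrow> nat \<times> bool \<Rightarrow> nat \<times> bool" where
  "face_next D = (\<lambda>(e, b). turn D (e, \<not> b))"

text \<open>The last condition is planarity (genus 0): \<open>n\<close> vertices and \<open>2 n\<close> edges leave \<open>n + 2\<close>
  faces.\<close>

definition knot_diagram :: "diagram \<Rightarrow> bool" where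
  "knot_diagram D \<longleftrightarrow>
     length (code D) = 2 * crossings D \<and>
     set (code D) = {..<crossings D} \<times> UNIV \<and>
     card (orbit (face_next D) ` ({..<2 * crossings D} \<times> UNIV)) = crossings D + 2"


section \<open>Long diagrams in Morse position\<close>

text \<open>A long diagram is cut by horizontal lines into slices, each with one crossing (both strands
  upward), one local minimum (cup) or one local maximum (cap), at horizontal position \<open>p\<close>
  (number of strands to its left). A level is the list of strands met by a horizontal line.
  Monotone pieces of the knot are numbered consecutively along the orientation; a strand carries
  the number of its piece and whether it points upward. Each passage of a crossing or of an
  extremum increases the number by one, so no closed component is possible. The fields of
  \<open>Cross p s a b\<close> are the sign and the incoming numbers on the lower left and lower right, those
  of \<open>Cup p right a\<close> and \<open>Cap p right a\<close> say whether the extremum points to the right, and the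
  number of the piece running into it.\<close>

datatype slice = Cross nat bool nat nat | Cup nat bool nat | Cap nat bool nat

type_synonym level = "(nat \<times> bool) list"

inductive morse :: "level \<Rightarrow> slice list \<Rightarrow> level \<Rightarrow> bool" where
  morse_Nil: "morse f [] f"
| morse_Cross: "morse (xs @ [(Suc b, True), (Suc a, True)] @ ys) L f \<Longrightarrow> length xs = p \<Longrightarrow>
    morse (xs @ [(a, True), (b, True)] @ ys) (Cross p s a b # L) f"
| morse_Cup_right: "morse (xs @ [(a, False), (Suc a, True)] @ ys) L f \<Longrightarrow> length xs = p \<Longrightarrow>
    morse (xs @ ys) (Cup p True a # L) f"
| morse_Cup_left: "morse (xs @ [(Suc a, True), (a, False)] @ ys) L f \<Longrightarrow> length xs = p \<Longrightarrow>
    morse (xs @ ys) (Cup p False a # L) f"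
| morse_Cap_right: "morse (xs @ ys) L f \<Longrightarrow> length xs = p \<Longrightarrow>
    morse (xs @ [(a, True), (Suc a, False)] @ ys) (Cap p True a # L) f"
| morse_Cap_left: "morse (xs @ ys) L f \<Longrightarrow> length xs = p \<Longrightarrow>
    morse (xs @ [(Suc a, False), (a, True)] @ ys) (Cap p False a # L) f"

fun crossing_times :: "slice list \<Rightarrow> nat set" where
  "crossing_times [] = {}"
| "crossing_times (Cross p s a b # L) = {a, b} \<union> crossing_times L"
| "crossing_times (_ # L) = crossing_times L"

text \<open>The number of crossing passages before time \<open>t\<close>. The arcs of a long diagram with \<open>n\<close>
  crossings are numbered \<open>0, \<dots>, 2 n\<close> along the orientation, so this is also the arc to which
  the piece with number \<open>t\<close> belongs.\<close>

definition rank :: "slice list \<Rightarrow> nat \<Rightarrow> nat" where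
  "rank L t = card {u \<in> crossing_times L. u < t}"

definition rot :: "slice list \<Rightarrow> nat \<Rightarrow> int" where
  "rot L j = (\<Sum>s\<leftarrow>L. case s of
      Cup p right a \<Rightarrow> if right \<and> rank L a = j then 1 else 0
    | Cap p right a \<Rightarrow> if right \<and> rank L a = j then - 1 else 0
    | Cross p s a b \<Rightarrow> 0)"

text \<open>\<open>L\<close> is a long form of \<open>D\<close> with the arc that leads into passage \<open>r\<close> of \<open>D\<close> cut open: both
  have the same signed Gauss code when read from there. At a positive crossing with both strands
  upward, the overstrand comes from the lower left.\<close>

definition long_form :: "diagram \<Rightarrow> nat \<Rightarrow> slice list \<Rightarrow> bool" where
  "long_form D r L \<longleftrightarrow>
     r < 2 * crossings D \<and>
     (\<exists>m. morse [(0, True)] L [(m, True)]) \<and>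
     length (filter (\<lambda>s. case s of Cross p e a b \<Rightarrow> True | _ \<Rightarrow> False) L) = crossings D \<and>
     (\<forall>p s a b. Cross p s a b \<in> set L \<longrightarrow>
        (\<exists>c<crossings D. positive D c = s \<and>
           code D ! ((r + rank L (if s then a else b)) mod (2 * crossings D)) = (c, True) \<and>
           code D ! ((r + rank L (if s then b else a)) mod (2 * crossings D)) = (c, False)))"


section \<open>Reshetikhin--Turaev data and the knot polynomial\<close>

text \<open>\<open>rmat True\<close> holds the entries of \<open>R\<close> and \<open>rmat False\<close> those of its inverse:
  \<open>R (e\<^sub>i \<otimes> e\<^sub>j)\<close> is the sum of all \<open>rmat True i j p q * (e\<^sub>p \<otimes> e\<^sub>q)\<close>. Likewise \<open>h e\<^sub>i\<close> is the
  sum of all \<open>hmat True i j * e\<^sub>j\<close>. Basis vectors are counted from 0, so that \<open>e\<^sub>1\<close> has index 0.\<close>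

record rt_data =
  nvars :: nat
  dim :: nat
  rmat :: "bool \<Rightarrow> nat \<Rightarrow> nat \<Rightarrow> nat \<Rightarrow> nat \<Rightarrow> laurent"
  hmat :: "bool \<Rightarrow> nat \<Rightarrow> nat \<Rightarrow> laurent"

definition indices :: "nat \<Rightarrow> nat \<Rightarrow> nat list set" where
  "indices d m = {xs. length xs = m \<and> set xs \<subseteq> {..<d}}"

text \<open>Matrix entries of the map assigned to a slice, from the basis tensor with indices \<open>xs\<close> at its
  bottom to the one with indices \<open>ys\<close> at its top; downward strands carry the dual space.\<close>

fun slice_entry :: "rt_data \<Rightarrow> slice \<Rightarrow> nat list \<Rightarrow> nat list \<Rightarrow> laurent" where
  "slice_entry T (Cross p s a b) xs ys =
     (if take p xs = take p ys \<and> drop (p + 2) xs = drop (p + 2) ys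
      then rmat T s (xs ! p) (xs ! (p + 1)) (ys ! p) (ys ! (p + 1)) else 0)"
| "slice_entry T (Cup p right a) xs ys =
     (if take p xs = take p ys \<and> drop p xs = drop (p + 2) ys
      then if right then hmat T True (ys ! p) (ys ! (p + 1))
           else of_bool (ys ! p = ys ! (p + 1)) else 0)"
| "slice_entry T (Cap p right a) xs ys =
     (if take p xs = take p ys \<and> drop (p + 2) xs = drop p ys
      then if right then hmat T False (xs ! p) (xs ! (p + 1))
           else of_bool (xs ! p = xs ! (p + 1)) else 0)"

fun slice_width :: "slice \<Rightarrow> nat \<Rightarrow> nat" where
  "slice_width (Cross p s a b) m = m"
| "slice_width (Cup p right a) m = m + 2"
| "slice_width (Cap p right a) m = m - 2"

fun rt_operator :: "rt_data \<Rightarrow> slice list \<Rightarrow> nat list \<Rightarrow> nat list \<Rightarrow> laurent" where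
  "rt_operator T [] xs zs = of_bool (xs = zs)"
| "rt_operator T (s # L) xs zs =
     (\<Sum>ys\<in>indices (dim T) (slice_width s (length xs)).
        slice_entry T s xs ys * rt_operator T L ys zs)"

definition is_rt_value :: "rt_data \<Rightarrow> diagram \<Rightarrow> laurent \<Rightarrow> bool" where
  "is_rt_value T D c \<longleftrightarrow>
     (\<forall>r L. long_form D r L \<longrightarrow>
        (\<forall>i<dim T. \<forall>j<dim T. rt_operator T L [i] [j] = (if i = j then c else 0)))"

definition RT :: "rt_data \<Rightarrow> diagram \<Rightarrow> laurent" where
  "RT T D = (THE c. is_rt_value T D c)"

text \<open>In order: entries in the ring, mutually inverse matrices, the Yang--Baxter equation,
  \<open>R (h \<otimes> h) = (h \<otimes> h) R\<close>, and the fact that the construction yields a multiple of the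
  identity which does not depend on the long form.\<close>

definition rt_system :: "rt_data \<Rightarrow> bool" where
  "rt_system T \<longleftrightarrow> (let d = dim T; R = rmat T; h = hmat T in
     0 < d \<and>
     (\<forall>s. \<forall>i<d. \<forall>j<d. laurent_in (nvars T) (h s i j) \<and>
        (\<forall>p<d. \<forall>q<d. laurent_in (nvars T) (R s i j p q))) \<and>
     (\<forall>s. \<forall>i<d. \<forall>j<d. \<forall>p<d. \<forall>q<d.
        (\<Sum>a<d. \<Sum>b<d. R s i j a b * R (\<not> s) a b p q) = of_bool (i = p \<and> j = q)) \<and>
     (\<forall>s. \<forall>i<d. \<forall>j<d. (\<Sum>a<d. h s i a * h (\<not> s) a j) = of_bool (i = j)) \<and>
     (\<forall>i<d. \<forall>j<d. \<forall>k<d. \<forall>p<d. \<forall>q<d. \<forall>l<d.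
        (\<Sum>a<d. \<Sum>b<d. \<Sum>c<d. R True i j a b * R True b k c l * R True a c p q) =
        (\<Sum>a<d. \<Sum>b<d. \<Sum>c<d. R True j k b c * R True i b p a * R True a c q l)) \<and>
     (\<forall>i<d. \<forall>j<d. \<forall>p<d. \<forall>q<d.
        (\<Sum>a<d. \<Sum>b<d. h True i a * h True j b * R True a b p q) =
        (\<Sum>a<d. \<Sum>b<d. R True i j a b * h True a p * h True b q)) \<and>
     (\<forall>D. knot_diagram D \<longrightarrow> (\<exists>c. is_rt_value T D c)))"


section \<open>Contraction sequences on multigraphs\<close>

text \<open>A multigraph is the list of its vertices, each given by the list of the edges at it, one
  entry per edge-end (so a loop is listed twice). Every edge occurs exactly twice in total.\<close>

type_synonym multigraph = "nat list list"

definition incident :: "nat list \<Rightarrow> nat list \<Rightarrow> bool" where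
  "incident X v \<longleftrightarrow> set v \<inter> set X \<noteq> {}"

definition contract :: "nat list \<Rightarrow> multigraph \<Rightarrow> multigraph" where
  "contract X G = filter (\<lambda>e. e \<notin> set X) (concat (filter (incident X) G))
     # filter (\<lambda>v. \<not> incident X v) G"

definition local_width :: "nat list \<Rightarrow> multigraph \<Rightarrow> nat" where
  "local_width X G = (\<Sum>v\<leftarrow>filter (incident X) G. length v) - length X"

fun contraction_sequence :: "multigraph \<Rightarrow> nat list list \<Rightarrow> bool" where
  "contraction_sequence G [] \<longleftrightarrow> set (concat G) = {}"
| "contraction_sequence G (X # S) \<longleftrightarrow>
     X \<noteq> [] \<and> distinct X \<and> set X \<subseteq> set (concat G) \<and> contraction_sequence (contract X G) S"

fun contraction_width :: "multigraph \<Rightarrow> nat list list \<Rightarrow> nat" where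
  "contraction_width G [] = 0"
| "contraction_width G (X # S) = max (local_width X G) (contraction_width (contract X G) S)"

text \<open>With both strands upward, the passages that come from the lower left and lower right; they
  leave to the upper right and upper left respectively.\<close>

definition left_passage :: "diagram \<Rightarrow> nat \<Rightarrow> nat" where
  "left_passage D c = passage D (c, positive D c)"

definition right_passage :: "diagram \<Rightarrow> nat \<Rightarrow> nat" where
  "right_passage D c = passage D (c, \<not> positive D c)"

definition diagram_graph :: "diagram \<Rightarrow> multigraph" where
  "diagram_graph D = map (\<lambda>c.
     [in_edge D (left_passage D c), in_edge D (right_passage D c),
      out_edge D (right_passage D c), out_edge D (left_passage D c)]) [0..<crossings D]"


section \<open>Computations with a bit cost\<close>

text \<open>A timed computation is a result together with the number of bit operations spent on it.\<close>

type_synonym 'a timed = "'a \<times> nat"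

definition ret :: "'a \<Rightarrow> 'a timed" where
  "ret x = (x, 0)"

definition tick :: "nat \<Rightarrow> unit timed" where
  "tick c = ((), c)"

definition bind_timed :: "'a timed \<Rightarrow> ('a \<Rightarrow> 'b timed) \<Rightarrow> 'b timed" where
  "bind_timed m f = (let (x, s) = m; (y, t) = f x in (y, s + t))"

adhoc_overloading Monad_Syntax.bind \<rightleftharpoons> bind_timed

fun mapT :: "('a \<Rightarrow> 'b timed) \<Rightarrow> 'a list \<Rightarrow> 'b list timed" where
  "mapT f [] = ret []"
| "mapT f (x # xs) = do { y \<leftarrow> f x; ys \<leftarrow> mapT f xs; ret (y # ys) }"

fun foldT :: "('b \<Rightarrow> 'a \<Rightarrow> 'b timed) \<Rightarrow> 'b \<Rightarrow> 'a list \<Rightarrow> 'b timed" where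
  "foldT f y [] = ret y"
| "foldT f y (x # xs) = do { z \<leftarrow> f y x; foldT f z xs }"

text \<open>\<open>t x y\<close> is the time for one operation on the integers \<open>x\<close> and \<open>y\<close>; two \<open>b\<close>-bit operands take
  time \<open>O(b log b)\<close>.\<close>

definition fast_int_op :: "(int \<Rightarrow> int \<Rightarrow> nat) \<Rightarrow> bool" where
  "fast_int_op t \<longleftrightarrow> (\<exists>C. \<forall>b\<ge>2. \<forall>x y. \<bar>x\<bar> < 2 ^ b \<longrightarrow> \<bar>y\<bar> < 2 ^ b \<longrightarrow>
     real (t x y) \<le> C * real b * log 2 (real b))"

definition nbits :: "int \<Rightarrow> nat" where
  "nbits x = nat (bitlen \<bar>x\<bar>)"


section \<open>Arithmetic of Laurent polynomials by Kronecker substitution\<close>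

text \<open>The machine representation \<open>(N, cs)\<close> of an element of the ring lists its coefficients at all
  exponent vectors in \<open>{-N..N}\<^sup>k\<close>. The same order is used for exponent vectors, for the
  entries of tensors and for the digits below: first coordinate fastest, so that positions are
  given by Horner sums.\<close>

type_synonym dense = "nat \<times> int list"

definition exponents :: "nat \<Rightarrow> nat \<Rightarrow> int list list" where
  "exponents k N = map (map (\<lambda>x. int x - int N)) (List.n_lists k [0..<2 * N + 1])"

definition position :: "nat \<Rightarrow> nat \<Rightarrow> int list \<Rightarrow> nat" where
  "position N M e = horner_sum (\<lambda>x. nat (x + int N)) (2 * M + 1) e"

definition decode :: "nat \<Rightarrow> dense \<Rightarrow> laurent" where
  "decode k = (\<lambda>(N, cs). \<Sum>(e, c)\<leftarrow>zip (exponents k N) cs.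
     Poly_Mapping.single (Poly_Mapping.nth e) c)"

definition encode :: "nat \<Rightarrow> laurent \<Rightarrow> dense" where
  "encode k p = (let N = LEAST N. \<forall>m\<in>Poly_Mapping.keys p. \<forall>i.
        \<bar>Poly_Mapping.lookup m i\<bar> \<le> int N
     in (N, map (\<lambda>e. Poly_Mapping.lookup p (Poly_Mapping.nth e)) (exponents k N)))"

definition coef_bits :: "dense \<Rightarrow> nat" where
  "coef_bits p = Max (insert 0 (nbits ` set (snd p)))"

definition dense_size :: "dense \<Rightarrow> nat" where
  "dense_size p = length (snd p) * (coef_bits p + 1)"

text \<open>Padding by zeros to the exponent box of size \<open>M\<close>\<close>

definition pad :: "nat \<Rightarrow> nat \<Rightarrow> dense \<Rightarrow> int list" where
  "pad k M = (\<lambda>(N, cs). map (\<lambda>e. if \<forall>x\<in>set e. \<bar>x\<bar> \<le> int N then cs ! position N N e else 0)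
     (exponents k M))"

definition addD :: "(int \<Rightarrow> int \<Rightarrow> nat) \<Rightarrow> nat \<Rightarrow> dense \<Rightarrow> dense \<Rightarrow> dense timed" where
  "addD tadd k p q = (let M = max (fst p) (fst q) in do {
     tick ((2 * M + 1) ^ k * (coef_bits p + coef_bits q + 2));
     cs \<leftarrow> mapT (\<lambda>(x, y). do { tick (tadd x y); ret (x + y) }) (zip (pad k M p) (pad k M q));
     ret (M, cs)
   })"

text \<open>Substituting powers of \<open>2 ^ B\<close> for the variables turns a polynomial into one integer with
  \<open>(2 * M + 1) ^ k\<close> signed digits of \<open>B\<close> bits. Adding \<open>2 ^ (B - 1)\<close> to every digit makes them
  nonnegative, so that they can be read off again.\<close>

definition pack :: "nat \<Rightarrow> nat \<Rightarrow> nat \<Rightarrow> dense \<Rightarrow> int" where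
  "pack k M B = (\<lambda>(N, cs). \<Sum>(e, c)\<leftarrow>zip (exponents k N) cs. c * 2 ^ (B * position N M e))"

definition unpack :: "nat \<Rightarrow> nat \<Rightarrow> nat \<Rightarrow> int \<Rightarrow> dense" where
  "unpack k M B z = (let z' = z + (\<Sum>j<(2 * M + 1) ^ k. 2 ^ (B * j + (B - 1))) in
     (M, map (\<lambda>j. z' div 2 ^ (B * j) mod 2 ^ B - 2 ^ (B - 1)) [0..<(2 * M + 1) ^ k]))"

text \<open>Apart from the integer product, packing and unpacking move digits of \<open>B\<close> bits
  (with carries) and take a constant number of passes over all bits.\<close>

definition mulD :: "(int \<Rightarrow> int \<Rightarrow> nat) \<Rightarrow> nat \<Rightarrow> dense \<Rightarrow> dense \<Rightarrow> dense timed" where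
  "mulD tmul k p q = (let
       M = fst p + fst q;
       m = (2 * M + 1) ^ k;
       B = coef_bits p + coef_bits q + nbits (int m) + 2;
       x = pack k M B p;
       y = pack k M B q
     in do {
       tick (dense_size p + dense_size q);
       tick (4 * B * m);
       tick (tmul x y);
       ret (unpack k M B (x * y))
     })"


section \<open>Tensor networks and their contraction\<close>

text \<open>A tensor consists of the list of edges at its legs and the list of its entries. All legs have
  dimension \<open>d\<close>.\<close>

type_synonym 'e tensor = "'e list \<times> dense list"

definition entry :: "nat \<Rightarrow> 'e tensor \<Rightarrow> nat list \<Rightarrow> dense" where
  "entry d t is = snd t ! horner_sum id d is"

text \<open>The indices of the legs \<open>es\<close> if the edges in the domain of \<open>\<sigma>\<close> carry the index prescribed by
  \<open>\<sigma>\<close> and the other legs carry the indices \<open>ys\<close> in order. The second function does this for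
  several tensors.\<close>

fun fill :: "('e \<Rightarrow> nat option) \<Rightarrow> 'e list \<Rightarrow> nat list \<Rightarrow> nat list" where
  "fill \<sigma> [] ys = []"
| "fill \<sigma> (e # es) ys = (case \<sigma> e of
      Some i \<Rightarrow> i # fill \<sigma> es ys
    | None \<Rightarrow> hd ys # fill \<sigma> es (tl ys))"

fun fills :: "('e \<Rightarrow> nat option) \<Rightarrow> 'e list list \<Rightarrow> nat list \<Rightarrow> nat list list" where
  "fills \<sigma> [] ys = []"
| "fills \<sigma> (es # ess) ys =
     fill \<sigma> es ys # fills \<sigma> ess (drop (length (filter (\<lambda>e. \<sigma> e = None) es)) ys)"

text \<open>One contraction: the tensors \<open>ts\<close> are replaced by one tensor, by multiplying entries and
  summing over the indices of the edges \<open>X\<close>. The first tick accounts for forming and following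
  the addresses of the entries, whose digits have \<open>nbits d\<close> bits.\<close>

definition merge ::
  "(int \<Rightarrow> int \<Rightarrow> nat) \<Rightarrow> (int \<Rightarrow> int \<Rightarrow> nat) \<Rightarrow> nat \<Rightarrow> nat \<Rightarrow> 'e list \<Rightarrow> 'e tensor list
    \<Rightarrow> 'e tensor timed" where
  "merge tadd tmul k d X ts = (let
       legs = map fst ts;
       free = filter (\<lambda>e. e \<notin> set X) (concat legs)
     in do {
       es \<leftarrow> mapT (\<lambda>ys. foldT (\<lambda>acc xs. do {
             tick ((length ts + length X + length (concat legs) + 1) * (nbits (int d) + 1));
             p \<leftarrow> foldT (\<lambda>p (t, is). mulD tmul k p (entry d t is)) (encode k 1)
                   (zip ts (fills (map_of (zip X xs)) legs ys));
             addD tadd k acc p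
           }) (encode k 0) (List.n_lists (length X) [0..<d]))
         (List.n_lists (length free) [0..<d]);
       ret (free, es)
     })"

definition write_tensor :: "nat \<Rightarrow> nat \<Rightarrow> 'e list \<Rightarrow> (nat list \<Rightarrow> dense) \<Rightarrow> 'e tensor timed" where
  "write_tensor d k legs f = do {
     es \<leftarrow> mapT (\<lambda>is. do { tick (dense_size (f is) + length legs * (nbits (int d) + 1)); ret (f is) })
       (List.n_lists (length legs) [0..<d]);
     ret (legs, es)
   }"

text \<open>Setting the index of the free legs to that of the first basis vector\<close>

definition close_legs :: "nat \<Rightarrow> nat \<Rightarrow> 'e set \<Rightarrow> 'e tensor \<Rightarrow> 'e tensor timed" where
  "close_legs d k F t = write_tensor d k (filter (\<lambda>e. e \<notin> F) (fst t))
     (\<lambda>ys. entry d t (fill (\<lambda>e. if e \<in> F then Some 0 else None) (fst t) ys))"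

text \<open>The tensor network of a diagram with cut arc before passage \<open>r\<close> and rotation numbers \<open>\<rho>\<close>.
  Passage \<open>i\<close> of the diagram is passage \<open>q = long_passage D r i\<close> of the long diagram and joins its arcs
  \<open>q\<close> and \<open>q + 1\<close>. Arc \<open>j\<close> of the long diagram is the edge \<open>(j, False)\<close> of the network;
  if a degree-2 vertex sits on it, then \<open>(j, False)\<close> and \<open>(j, True)\<close> are the edges before and after
  this vertex.\<close>

definition long_passage :: "diagram \<Rightarrow> nat \<Rightarrow> nat \<Rightarrow> nat" where
  "long_passage D r i = (i + length (code D) - r) mod length (code D)"

definition free_legs :: "diagram \<Rightarrow> (nat \<Rightarrow> int) \<Rightarrow> (nat \<times> bool) set" where
  "free_legs D \<rho> = {(0, False), (length (code D), \<rho> (length (code D)) \<noteq> 0)}"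

definition crossing_tensor ::
  "rt_data \<Rightarrow> diagram \<Rightarrow> nat \<Rightarrow> (nat \<Rightarrow> int) \<Rightarrow> nat \<Rightarrow> (nat \<times> bool) tensor timed" where
  "crossing_tensor T D r \<rho> c = (let
       k = nvars T; d = dim T;
       u = long_passage D r (left_passage D c);
       v = long_passage D r (right_passage D c)
     in do {
       t \<leftarrow> write_tensor d k
         [(u, \<rho> u \<noteq> 0), (v, \<rho> v \<noteq> 0), (v + 1, False), (u + 1, False)]
         (\<lambda>is. encode k (rmat T (positive D c) (is ! 0) (is ! 1) (is ! 2) (is ! 3)));
       close_legs d k (free_legs D \<rho>) t
     })"

definition arc_tensor ::
  "rt_data \<Rightarrow> diagram \<Rightarrow> (nat \<Rightarrow> int) \<Rightarrow> nat \<Rightarrow> (nat \<times> bool) tensor timed" where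
  "arc_tensor T D \<rho> j = do {
       t \<leftarrow> write_tensor (dim T) (nvars T) [(j, False), (j, True)]
         (\<lambda>is. encode (nvars T) (hmat T (\<rho> j = 1) (is ! 0) (is ! 1)));
       close_legs (dim T) (nvars T) (free_legs D \<rho>) t
     }"

text \<open>The degree-2 vertices are absorbed into the crossing at the end of their arc, the one on the
  last arc into the crossing at its start. Afterwards the edge \<open>(j, False)\<close> is renamed to \<open>j\<close>.\<close>

definition absorbed_arcs :: "diagram \<Rightarrow> nat \<Rightarrow> (nat \<Rightarrow> int) \<Rightarrow> nat \<Rightarrow> nat list" where
  "absorbed_arcs D r \<rho> c = (let
       u = long_passage D r (left_passage D c);
       v = long_passage D r (right_passage D c);
       l = length (code D)
     in filter (\<lambda>j. \<rho> j \<noteq> 0) ([u, v] @ (if u + 1 = l \<or> v + 1 = l then [l] else [])))"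

definition crossing_with_arcs ::
  "(int \<Rightarrow> int \<Rightarrow> nat) \<Rightarrow> (int \<Rightarrow> int \<Rightarrow> nat) \<Rightarrow> rt_data \<Rightarrow> diagram \<Rightarrow> nat \<Rightarrow> (nat \<Rightarrow> int)
    \<Rightarrow> nat \<Rightarrow> nat tensor timed" where
  "crossing_with_arcs tadd tmul T D r \<rho> c = do {
       tick (4 * nbits (int (length (code D))));
       t \<leftarrow> crossing_tensor T D r \<rho> c;
       t' \<leftarrow> foldT (\<lambda>t j. do {
           a \<leftarrow> arc_tensor T D \<rho> j;
           merge tadd tmul (nvars T) (dim T) [(j, j < length (code D))] [a, t]
         }) t (absorbed_arcs D r \<rho> c);
       ret (map fst (fst t'), snd t')
     }"

text \<open>The contraction sequence acts on pairs of a vertex of the contracted graph of the diagram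
  and the tensor at it. The tensors merged in a step are those at the merged vertices. Edges of the
  diagram are translated to arcs of the long diagram, with the cut edge as number 0; as it is not an
  edge of the network, no summation over it takes place. The tick is for finding the incident
  vertices.\<close>

definition arc_of_edge :: "diagram \<Rightarrow> nat \<Rightarrow> nat \<Rightarrow> nat" where
  "arc_of_edge D r e = (e + length (code D) + 1 - r) mod length (code D)"

definition contract_step ::
  "(int \<Rightarrow> int \<Rightarrow> nat) \<Rightarrow> (int \<Rightarrow> int \<Rightarrow> nat) \<Rightarrow> rt_data \<Rightarrow> diagram \<Rightarrow> nat
    \<Rightarrow> (nat list \<times> nat tensor) list \<Rightarrow> nat list \<Rightarrow> (nat list \<times> nat tensor) list timed" where
  "contract_step tadd tmul T D r net X = (let
       touched = filter (\<lambda>(v, t). incident X v) net;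
       rest = filter (\<lambda>(v, t). \<not> incident X v) net
     in do {
       tick ((length net + length X + (\<Sum>(v, t)\<leftarrow>net. length v) * length X)
              * nbits (int (length (code D))));
       t \<leftarrow> merge tadd tmul (nvars T) (dim T)
             (filter (\<lambda>j. j \<noteq> 0) (map (arc_of_edge D r) X)) (map snd touched);
       ret ((filter (\<lambda>e. e \<notin> set X) (concat (map fst touched)), t) # rest)
     })"

definition contract_network ::
  "(int \<Rightarrow> int \<Rightarrow> nat) \<Rightarrow> (int \<Rightarrow> int \<Rightarrow> nat) \<Rightarrow> rt_data \<Rightarrow> diagram \<Rightarrow> nat \<Rightarrow> (nat \<Rightarrow> int)
    \<Rightarrow> nat list list \<Rightarrow> dense timed" where
  "contract_network tadd tmul T D r \<rho> S = do {
       ts \<leftarrow> mapT (crossing_with_arcs tadd tmul T D r \<rho>) [0..<crossings D];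
       net \<leftarrow> foldT (contract_step tadd tmul T D r) (zip (diagram_graph D) ts) S;
       ret (entry (dim T) (snd (hd net)) [])
     }"

end

theory Submission
  imports Defs
begin

text \<open>The contraction computes the right value because both sides are sums over states. Slicing the
  long diagram by horizontal lines turns \<open>RT\<close> into a sum over all labellings of the monotone
  pieces of the knot by basis vectors, the product running over the slices (lemma
  \<open>morse_state_sum\<close>). A count of the ends of the pieces shows that the pieces form one chain
  \<open>0, \<dots>, m\<close> and that each passage from a piece to the next happens in exactly one slice
  (\<open>long_times\<close>). Summing over the pieces in the interior of an arc multiplies the matrices
  of its extrema, which gives the power of \<open>h\<close> given by the rotation number
  (\<open>collapse\<close>); what is left is the tensor network of the diagram
  (\<open>rt_operator_eq_network\<close>). Absorbing the degree-2 vertices (\<open>RT_eq_vertex_sum\<close>) and contracting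
  (\<open>contract_step\<close>) only carry out parts of this sum early, by distributivity. At the end no edge is
  left, and since the diagram is connected, a single tensor without legs remains.

  The cost estimate rests on one potential argument for sizes and one for counts. Say that a polynomial
  fits \<open>b\<close> if its exponents are at most \<open>b\<close> in absolute value and the absolute values of its
  coefficients add up to at most \<open>2 ^ b\<close>. Such bounds add up under multiplication, and a sum of
  \<open>d ^ s\<close> products costs at most \<open>d s\<close> further bits. Hence the sum over all tensors of these bounds, plus
  \<open>d\<close> for each remaining edge-end, never increases, and it starts as \<open>O(n)\<close>. So all entries that ever
  occur have \<open>O(n ^ k)\<close> coefficients of \<open>O(n)\<close> bits, and by Kronecker substitution one operation on them
  takes \<open>O(n ^ (k + 1) log n)\<close> bit operations (\<open>snd_mulD_le\<close>, \<open>snd_addD_le\<close>). A step that merges \<open>c\<close>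
  tensors with local width \<open>u\<close> performs at most \<open>(c + 1) d ^ u\<close> operations. The number of vertices
  drops by \<open>c - 1\<close> and the number of edge-ends by at least 2, so the sum of all \<open>c + 1\<close> is at most the
  initial number \<open>5 n\<close> of vertices and edge-ends (\<open>contract_all\<close>). Together this is
  \<open>O(d ^ w n ^ (k + 2) log n)\<close>, which is within the bound claimed. Addressing the entries and finding
  the incident vertices are of lower order.\<close>


section \<open>Timed computations\<close>

lemma fst_ret [simp]: "fst (ret x) = x" and snd_ret [simp]: "snd (ret x) = 0"
  by (simp_all add: ret_def)

lemma fst_tick [simp]: "fst (tick c) = ()" and snd_tick [simp]: "snd (tick c) = c"
  by (simp_all add: tick_def)

lemma fst_bind_timed [simp]: "fst (bind_timed m f) = fst (f (fst m))"
  by (simp add: bind_timed_def Let_def split: prod.splits)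

lemma snd_bind_timed [simp]: "snd (bind_timed m f) = snd m + snd (f (fst m))"
  by (simp add: bind_timed_def Let_def split: prod.splits)

lemma fst_mapT [simp]: "fst (mapT f xs) = map (\<lambda>x. fst (f x)) xs"
  by (induction xs) auto

lemma snd_mapT [simp]: "snd (mapT f xs) = (\<Sum>x\<leftarrow>xs. snd (f x))"
  by (induction xs) auto

lemma fst_foldT_Cons [simp]: "fst (foldT f y (x # xs)) = fst (foldT f (fst (f y x)) xs)"
  and snd_foldT_Cons [simp]:
    "snd (foldT f y (x # xs)) = snd (f y x) + snd (foldT f (fst (f y x)) xs)"
  by simp_all

declare foldT.simps(2) [simp del] mapT.simps [simp del]

lemma snd_mapT_le:
  assumes "\<And>x. x \<in> set xs \<Longrightarrow> snd (f x) \<le> c"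
  shows "snd (mapT f xs) \<le> length xs * c"
  using assms
proof (induction xs)
  case (Cons x xs)
  then have "snd (f x) \<le> c" and "(\<Sum>x\<leftarrow>xs. snd (f x)) \<le> length xs * c"
    by auto
  then show ?case by simp
qed simp


section \<open>Positional notation\<close>

lemma nth_concat_equal_lengths:
  assumes "\<forall>xs\<in>set xss. length xs = b" "i < length xss" "y < b"
  shows "concat xss ! (y + b * i) = xss ! i ! y"
  using assms
proof (induction xss arbitrary: i)
  case (Cons xs xss)
  show ?case
  proof (cases i)
    case 0
    then show ?thesis using Cons.prems by (simp add: nth_append)
  next
    case (Suc i')
    then have "concat (xs # xss) ! (y + b * i) = concat xss ! (y + b * i')"
      using Cons.prems by (simp add: nth_append algebra_simps)
    then show ?thesis using Cons Suc by simp
  qed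
qed simp

lemma length_n_lists_upt: "length (List.n_lists k [0..<b]) = b ^ k"
  by (simp add: length_n_lists)

lemma horner_sum_less:
  fixes f :: "'a \<Rightarrow> nat"
  assumes "\<forall>x\<in>set xs. f x < b"
  shows "horner_sum f b xs < b ^ length xs"
  using assms
proof (induction xs)
  case (Cons x xs)
  then have "f x < b" "horner_sum f b xs + 1 \<le> b ^ length xs" by auto
  then have "f x + b * horner_sum f b xs < b * (horner_sum f b xs + 1)" by simp
  also have "\<dots> \<le> b * b ^ length xs"
    using \<open>horner_sum f b xs + 1 \<le> b ^ length xs\<close> by (rule mult_le_mono2)
  finally show ?case by simp
qed simp

text \<open>The lists over an alphabet of \<open>b\<close> digits are enumerated with the first digit running
  fastest, so a list stands at the position whose base-\<open>b\<close> digits it spells.\<close>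

lemma nth_n_lists_horner:
  assumes "set ds \<subseteq> {..<b}"
  shows "List.n_lists (length ds) [0..<b] ! horner_sum id b ds = ds"
  using assms
proof (induction ds)
  case (Cons x ds)
  let ?N = "List.n_lists (length ds) [0..<b]"
  have h: "horner_sum id b ds < length ?N"
    using Cons.prems horner_sum_less[of ds id b] by (auto simp: length_n_lists_upt)
  have "List.n_lists (length (x # ds)) [0..<b] ! horner_sum id b (x # ds)
      = map (\<lambda>ys. map (\<lambda>y. y # ys) [0..<b]) ?N ! horner_sum id b ds ! x"
    using Cons.prems h
    by (simp, subst nth_concat_equal_lengths[where b = b]) auto
  then show ?case using Cons h by (simp add: id_def)
qed simp

lemma horner_nth_n_lists:
  assumes "j < b ^ k"
  shows "horner_sum id b (List.n_lists k [0..<b] ! j) = j"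
proof -
  let ?N = "List.n_lists k [0..<b]"
  have "?N ! j \<in> set ?N" using assms by (simp add: length_n_lists_upt)
  then have ds: "length (?N ! j) = k" "set (?N ! j) \<subseteq> {..<b}"
    by (auto simp: set_n_lists)
  then have "?N ! horner_sum id b (?N ! j) = ?N ! j"
    using nth_n_lists_horner[of "?N ! j" b] by simp
  moreover have "horner_sum id b (?N ! j) < b ^ k"
    using horner_sum_less[of "?N ! j" id b] ds by auto
  ultimately show ?thesis
    using assms by (simp add: nth_eq_iff_index_eq distinct_n_lists length_n_lists_upt)
qed


section \<open>Laurent polynomials as lists of coefficients\<close>

definition box :: "nat \<Rightarrow> nat \<Rightarrow> int list set" where
  "box k N = {e. length e = k \<and> (\<forall>x\<in>set e. \<bar>x\<bar> \<le> int N)}"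

definition coeff :: "dense \<Rightarrow> int list \<Rightarrow> int" where
  "coeff p e = snd p ! position (fst p) (fst p) e"

definition well_formed :: "nat \<Rightarrow> dense \<Rightarrow> bool" where
  "well_formed k p \<longleftrightarrow> length (snd p) = (2 * fst p + 1) ^ k"

text \<open>The sum of absolute values is used instead of their maximum because it is submultiplicative.\<close>

definition norm1 :: "dense \<Rightarrow> int" where
  "norm1 p = (\<Sum>c\<leftarrow>snd p. \<bar>c\<bar>)"

lemma length_exponents [simp]: "length (exponents k N) = (2 * N + 1) ^ k"
  by (simp add: exponents_def length_n_lists)

lemma shifted_in_digits:
  assumes "e \<in> box k N"
  shows "length (map (\<lambda>x. nat (x + int N)) e) = k"
    "set (map (\<lambda>x. nat (x + int N)) e) \<subseteq> {..<2 * N + 1}"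
    "map (\<lambda>x. int x - int N) (map (\<lambda>x. nat (x + int N)) e) = e"
proof -
  show "length (map (\<lambda>x. nat (x + int N)) e) = k" using assms by (simp add: box_def)
  have *: "- int N \<le> x \<and> x \<le> int N" if "x \<in> set e" for x
    using assms that unfolding box_def by force
  then show "set (map (\<lambda>x. nat (x + int N)) e) \<subseteq> {..<2 * N + 1}" by fastforce
  show "map (\<lambda>x. int x - int N) (map (\<lambda>x. nat (x + int N)) e) = e"
    using * by (force intro: map_idI)
qed

lemma position_eq_horner_id:
  "position N M e = horner_sum id (2 * M + 1) (map (\<lambda>x. nat (x + int N)) e)"
  by (simp add: position_def horner_sum_foldr foldr_map o_def)

lemma position_less:
  assumes "e \<in> box k N"
  shows "position N N e < (2 * N + 1) ^ k"
proof -
  let ?ds = "map (\<lambda>x. nat (x + int N)) e"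
  have "\<forall>x\<in>set ?ds. id x < 2 * N + 1" using shifted_in_digits(2)[OF assms] by auto
  from horner_sum_less[OF this] show ?thesis
    using shifted_in_digits(1)[OF assms] by (simp add: position_eq_horner_id id_def)
qed

lemma exponents_nth_position:
  assumes "e \<in> box k N"
  shows "exponents k N ! position N N e = e"
proof -
  let ?ds = "map (\<lambda>x. nat (x + int N)) e"
  have "List.n_lists k [0..<2 * N + 1] ! position N N e = ?ds"
    using nth_n_lists_horner[OF shifted_in_digits(2)[OF assms]]
      shifted_in_digits(1)[OF assms] by (simp add: position_eq_horner_id)
  moreover have "position N N e < length (List.n_lists k [0..<2 * N + 1])"
    using position_less[OF assms] by (simp add: length_n_lists)
  ultimately show ?thesis
    using shifted_in_digits(3)[OF assms] by (simp add: exponents_def)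
qed

lemma exponents_nth_in_box:
  assumes "j < (2 * N + 1) ^ k"
  shows "exponents k N ! j \<in> box k N" "position N N (exponents k N ! j) = j"
proof -
  let ?l = "List.n_lists k [0..<2 * N + 1] ! j"
  have j: "j < length (List.n_lists k [0..<2 * N + 1])"
    using assms by (simp add: length_n_lists)
  then have "?l \<in> set (List.n_lists k [0..<2 * N + 1])" by (rule nth_mem)
  then have l: "length ?l = k" "\<forall>x\<in>set ?l. x < 2 * N + 1" by (auto simp: set_n_lists)
  have e: "exponents k N ! j = map (\<lambda>x. int x - int N) ?l"
    using j by (simp add: exponents_def)
  show "exponents k N ! j \<in> box k N" unfolding e box_def using l by fastforce
  have "map (\<lambda>x. nat (x + int N)) (exponents k N ! j) = ?l"
    unfolding e by (simp add: o_def)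
  then show "position N N (exponents k N ! j) = j"
    using horner_nth_n_lists[OF assms] by (simp add: position_eq_horner_id)
qed

lemma bij_betw_position: "bij_betw (position N N) (box k N) {..<(2 * N + 1) ^ k}"
  by (rule bij_betwI[where g = "\<lambda>j. exponents k N ! j"])
    (auto simp only: position_less exponents_nth_position exponents_nth_in_box lessThan_iff)

lemma finite_box [simp]: "finite (box k N)"
  using bij_betw_finite[OF bij_betw_position] by simp

lemma card_box: "card (box k N) = (2 * N + 1) ^ k"
  using bij_betw_same_card[OF bij_betw_position] by simp

lemma set_exponents: "set (exponents k N) = box k N"
proof -
  have "set (exponents k N) = (\<lambda>j. exponents k N ! j) ` {..<(2 * N + 1) ^ k}"
    unfolding set_conv_nth length_exponents by blast
  also have "\<dots> = box k N"
  proof (intro equalityI subsetI)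
    fix e assume "e \<in> box k N"
    then show "e \<in> (\<lambda>j. exponents k N ! j) ` {..<(2 * N + 1) ^ k}"
      by (intro image_eqI[of _ _ "position N N e"]) (simp_all only: exponents_nth_position lessThan_iff position_less)
  qed (auto simp only: exponents_nth_in_box(1) lessThan_iff)
  finally show ?thesis .
qed

text \<open>The list of coefficients is turned into a function on the box of exponent vectors; decoding,
  packing and the norm all become sums over this box.\<close>

lemma sum_coefficients_eq:
  assumes "well_formed k p"
  shows "(\<Sum>(e, c)\<leftarrow>zip (exponents k (fst p)) (snd p). f e c) = (\<Sum>e\<in>box k (fst p). f e (coeff p e))"
proof -
  let ?m = "(2 * fst p + 1) ^ k"
  have "(\<Sum>(e, c)\<leftarrow>zip (exponents k (fst p)) (snd p). f e c)
      = (\<Sum>j<?m. f (exponents k (fst p) ! j) (snd p ! j))"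
    using assms by (simp add: sum_list_sum_nth well_formed_def atLeast0LessThan)
  also have "\<dots> = (\<Sum>e\<in>box k (fst p). f e (coeff p e))"
    using sum.reindex_bij_betw[OF bij_betw_position,
        of "\<lambda>j. f (exponents k (fst p) ! j) (snd p ! j)" "fst p" k]
    by (simp add: exponents_nth_position coeff_def)
  finally show ?thesis .
qed

lemma decode_eq_sum:
  assumes "well_formed k p"
  shows "decode k p = (\<Sum>e\<in>box k (fst p). Poly_Mapping.single (Poly_Mapping.nth e) (coeff p e))"
  using sum_coefficients_eq[OF assms, of "\<lambda>e c. Poly_Mapping.single (Poly_Mapping.nth e) c"]
  by (cases p) (simp add: decode_def)

lemma pack_eq_sum:
  assumes "well_formed k p"
  shows "pack k M B p = (\<Sum>e\<in>box k (fst p). coeff p e * 2 ^ (B * position (fst p) M e))"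
  using sum_coefficients_eq[OF assms, of "\<lambda>e c. c * 2 ^ (B * position (fst p) M e)"]
  by (cases p) (simp add: pack_def)

lemma norm1_eq_sum:
  assumes "well_formed k p"
  shows "norm1 p = (\<Sum>e\<in>box k (fst p). \<bar>coeff p e\<bar>)"
proof -
  have "norm1 p = (\<Sum>j<(2 * fst p + 1) ^ k. \<bar>snd p ! j\<bar>)"
    using assms by (simp add: norm1_def sum_list_sum_nth well_formed_def atLeast0LessThan)
  also have "\<dots> = (\<Sum>e\<in>box k (fst p). \<bar>coeff p e\<bar>)"
    using sum.reindex_bij_betw[OF bij_betw_position, of "\<lambda>j. \<bar>snd p ! j\<bar>" "fst p" k]
    by (simp add: coeff_def)
  finally show ?thesis .
qed

lemma coeff_map_exponents:
  assumes "e \<in> box k N"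
  shows "coeff (N, map f (exponents k N)) e = f e"
  using nth_map[of "position N N e" "exponents k N" f] position_less[OF assms] assms
  by (simp add: coeff_def exponents_nth_position)

lemma norm1_nonneg: "0 \<le> norm1 p"
  unfolding norm1_def by (rule sum_list_nonneg) auto

lemma inj_on_nth_box: "inj_on Poly_Mapping.nth (box k N)"
proof (rule inj_onI)
  fix e e' assume e: "e \<in> box k N" "e' \<in> box k N"
    and eq: "Poly_Mapping.nth e = Poly_Mapping.nth e'"
  have "nth_default 0 e = nth_default 0 e'"
    using arg_cong[OF eq, of Poly_Mapping.lookup] by simp
  then have nth: "nth_default 0 e i = nth_default 0 e' i" for i
    by simp
  have "e ! i = e' ! i" if "i < k" for i
    using nth[of i] that e by (simp add: nth_default_def box_def)
  then show "e = e'" using e unfolding box_def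
    by (intro nth_equalityI) auto
qed

text \<open>There are no carries: every digit is shifted by the size of its own box, so the shifted digits
  add up to the digits of the sum with respect to the larger box.\<close>

lemma position_add:
  assumes "length e = length e'" "\<forall>x\<in>set e. \<bar>x\<bar> \<le> int N" "\<forall>x\<in>set e'. \<bar>x\<bar> \<le> int N'"
  shows "position (N + N') M (map2 (+) e e') = position N M e + position N' M e'"
  using assms
proof (induction e e' rule: list_induct2)
  case (Cons x e y e')
  have "nat (x + y + int (N + N')) = nat (x + int N) + nat (y + int N')"
    using Cons.prems by (auto simp: abs_le_iff nat_add_distrib[symmetric] algebra_simps)
  then show ?case using Cons by (simp add: position_def algebra_simps)
qed (simp add: position_def)

lemma map2_add_in_box:
  assumes "e \<in> box k N" "e' \<in> box k N'"
  shows "map2 (+) e e' \<in> box k (N + N')"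
proof -
  have "\<bar>x + y\<bar> \<le> int (N + N')" if "(x, y) \<in> set (zip e e')" for x y
  proof -
    have "\<bar>x\<bar> \<le> int N" "\<bar>y\<bar> \<le> int N'"
      using assms that by (auto simp: box_def dest: set_zip_leftD set_zip_rightD)
    then show ?thesis by linarith
  qed
  then show ?thesis using assms unfolding box_def by auto
qed

lemma nth_map2_add:
  assumes "length e = length e'"
  shows "Poly_Mapping.nth (map2 (+) e e') = Poly_Mapping.nth e + (Poly_Mapping.nth e' :: nat \<Rightarrow>\<^sub>0 int)"
  using assms by (intro poly_mapping_eqI) (auto simp: lookup_add nth_default_def)

definition convolution :: "nat \<Rightarrow> dense \<Rightarrow> dense \<Rightarrow> int list \<Rightarrow> int" where
  "convolution k p q e = (\<Sum>(x, y)\<in>{z \<in> box k (fst p) \<times> box k (fst q). map2 (+) (fst z) (snd z) = e}.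
     coeff p x * coeff q y)"

text \<open>Pairs of monomials are grouped by the sum of their exponents. With \<open>f\<close> an evaluation of monomials
  this says that the convolution evaluates to the product; it is used both for the packed integers and
  for decoding.\<close>

lemma sum_convolution:
  fixes f :: "int list \<Rightarrow> int \<Rightarrow> 'a::comm_monoid_add"
  assumes zero: "\<And>e. f e 0 = 0" and add: "\<And>e a b. f e (a + b) = f e a + f e b"
  shows "(\<Sum>e\<in>box k (fst p + fst q). f e (convolution k p q e))
    = (\<Sum>x\<in>box k (fst p). \<Sum>y\<in>box k (fst q). f (map2 (+) x y) (coeff p x * coeff q y))"
proof -
  let ?S = "box k (fst p) \<times> box k (fst q)"
  let ?h = "\<lambda>z. map2 (+) (fst z) (snd z) :: int list"
  have hom: "f e (sum g A) = (\<Sum>a\<in>A. f e (g a))" if "finite A" for e A and g :: "int list \<times> int list \<Rightarrow> int"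
    using that by (induction A) (auto simp: zero add)
  have "(\<Sum>e\<in>box k (fst p + fst q). f e (convolution k p q e))
      = (\<Sum>e\<in>box k (fst p + fst q). \<Sum>z\<in>{z \<in> ?S. ?h z = e}. f (?h z) (coeff p (fst z) * coeff q (snd z)))"
    unfolding convolution_def
    by (intro sum.cong refl) (auto simp: case_prod_unfold hom intro!: sum.cong)
  also have "\<dots> = (\<Sum>z\<in>?S. f (?h z) (coeff p (fst z) * coeff q (snd z)))"
    by (rule sum.group) (auto intro!: map2_add_in_box)
  finally show ?thesis by (simp add: sum.cartesian_product case_prod_unfold)
qed

lemma abs_less_nbits: "\<bar>x\<bar> < 2 ^ nbits x"
  using bitlen_bounds[of "\<bar>x\<bar>"] by (cases "x = 0") (auto simp: nbits_def)

lemma nbits_le: "\<bar>x\<bar> < 2 ^ b \<Longrightarrow> nbits x \<le> b"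
  by (simp add: nbits_def bitlen_le_iff_power nat_le_iff)

lemma abs_coeff_less:
  assumes "c \<in> set (snd p)"
  shows "\<bar>c\<bar> < 2 ^ coef_bits p"
proof -
  have "nbits c \<le> coef_bits p" using assms by (simp add: coef_bits_def)
  then have "(2::int) ^ nbits c \<le> 2 ^ coef_bits p" by simp
  then show ?thesis using abs_less_nbits[of c] by linarith
qed

lemma coeff_in_set:
  assumes "well_formed k p" "e \<in> box k (fst p)"
  shows "coeff p e \<in> set (snd p)"
  using assms position_less[OF assms(2)] by (simp add: coeff_def well_formed_def)

text \<open>A monomial of the first factor determines its partner in the second, so at most
  \<open>(2 N + 1) ^ k\<close> products contribute to one coefficient. This is why the digit width chosen in the
  multiplication suffices.\<close>

lemma abs_convolution_le:
  assumes "well_formed k p" "well_formed k q"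
  shows "\<bar>convolution k p q e\<bar> \<le> int ((2 * fst p + 1) ^ k) * 2 ^ (coef_bits p + coef_bits q)"
proof -
  let ?Z = "{z \<in> box k (fst p) \<times> box k (fst q). map2 (+) (fst z) (snd z) = e}"
  have inj: "inj_on fst ?Z"
  proof (rule inj_onI)
    fix z w assume "z \<in> ?Z" "w \<in> ?Z" and f: "fst z = fst w"
    then have l: "length (snd z) = k" "length (snd w) = k" "length (fst w) = k"
      and eq: "map2 (+) (fst w) (snd z) = map2 (+) (fst w) (snd w)"
      by (simp_all only: mem_Collect_eq mem_Times_iff box_def)
    have "snd z ! i = snd w ! i" if "i < k" for i
      using arg_cong[OF eq, of "\<lambda>l. l ! i"] that l by simp
    then have "snd z = snd w" using l by (intro nth_equalityI) auto
    then show "z = w" using f by (rule prod_eqI[rotated])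
  qed
  have "card ?Z \<le> card (box k (fst p))"
    by (rule card_inj_on_le[OF inj]) (auto simp only: finite_box mem_Collect_eq mem_Times_iff)
  then have card: "card ?Z \<le> (2 * fst p + 1) ^ k" by (simp add: card_box)
  have "\<bar>convolution k p q e\<bar> \<le> (\<Sum>(x, y)\<in>?Z. \<bar>coeff p x\<bar> * \<bar>coeff q y\<bar>)"
    unfolding convolution_def case_prod_unfold abs_mult[symmetric] by (rule sum_abs)
  also have "\<dots> \<le> (\<Sum>(x, y)\<in>?Z. 2 ^ coef_bits p * 2 ^ coef_bits q)"
  proof (rule sum_mono, clarify)
    fix x y assume "x \<in> box k (fst p)" "y \<in> box k (fst q)"
    then have "\<bar>coeff p x\<bar> < 2 ^ coef_bits p" "\<bar>coeff q y\<bar> < 2 ^ coef_bits q"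
      using assms by (auto intro: abs_coeff_less coeff_in_set)
    then show "\<bar>coeff p x\<bar> * \<bar>coeff q y\<bar> \<le> 2 ^ coef_bits p * 2 ^ coef_bits q"
      by (intro mult_mono) auto
  qed
  also have "\<dots> = int (card ?Z) * 2 ^ (coef_bits p + coef_bits q)"
    by (simp add: power_add)
  also have "\<dots> \<le> int ((2 * fst p + 1) ^ k) * 2 ^ (coef_bits p + coef_bits q)"
    using card by (intro mult_right_mono) (simp_all only: of_nat_le_iff zero_le_power zero_le_numeral)
  finally show ?thesis .
qed

text \<open>Nonnegative digits below the base produce no carries, so dividing by the base removes exactly the
  lowest one.\<close>

lemma digit_of_sum:
  fixes b :: int
  assumes "\<forall>i<m. 0 \<le> c i \<and> c i < b" "j < m" "0 < b"
  shows "(\<Sum>i<m. c i * b ^ i) div b ^ j mod b = c j"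
  using assms
proof (induction j arbitrary: c m)
  case 0
  then obtain m' where m: "m = Suc m'" by (cases m) auto
  have "(\<Sum>i<m. c i * b ^ i) = c 0 + b * (\<Sum>i<m'. c (Suc i) * b ^ i)"
    by (simp add: m sum.lessThan_Suc_shift sum_distrib_left mult_ac del: sum.lessThan_Suc)
  then show ?case using 0 by simp
next
  case (Suc j)
  then obtain m' where m: "m = Suc m'" by (cases m) auto
  have "(\<Sum>i<m. c i * b ^ i) = c 0 + b * (\<Sum>i<m'. c (Suc i) * b ^ i)"
    by (simp add: m sum.lessThan_Suc_shift sum_distrib_left mult_ac del: sum.lessThan_Suc)
  then have "(\<Sum>i<m. c i * b ^ i) div b = (\<Sum>i<m'. c (Suc i) * b ^ i)"
    using Suc.prems by simp
  moreover have "(\<Sum>i<m. c i * b ^ i) div b ^ Suc j = (\<Sum>i<m. c i * b ^ i) div b div b ^ j"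
    using Suc.prems by (simp add: zdiv_zmult2_eq)
  ultimately show ?case using Suc.IH[of m' "\<lambda>i. c (Suc i)"] Suc.prems m by simp
qed

lemma unpack_digits:
  assumes "\<And>j. j < (2 * M + 1) ^ k \<Longrightarrow> \<bar>c j\<bar> < 2 ^ (B - 1)" "0 < B"
  shows "unpack k M B (\<Sum>j<(2 * M + 1) ^ k. c j * 2 ^ (B * j)) = (M, map c [0..<(2 * M + 1) ^ k])"
proof -
  let ?m = "(2 * M + 1) ^ k"
  let ?d = "\<lambda>j. c j + 2 ^ (B - 1)"
  have two: "(2::int) ^ B = 2 ^ (B - 1) + 2 ^ (B - 1)"
    using assms(2) by (cases B) auto
  have d: "\<forall>j<?m. 0 \<le> ?d j \<and> ?d j < 2 ^ B"
  proof (intro allI impI)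
    fix j assume "j < ?m"
    from assms(1)[OF this] show "0 \<le> ?d j \<and> ?d j < 2 ^ B" unfolding two by linarith
  qed
  have z: "(\<Sum>j<?m. c j * 2 ^ (B * j)) + (\<Sum>j<?m. 2 ^ (B * j + (B - 1))) = (\<Sum>j<?m. ?d j * (2 ^ B) ^ j)"
    by (subst sum.distrib[symmetric], rule sum.cong) (simp_all add: power_add power_mult distrib_right mult.commute[of "2 ^ (B - 1)"])
  have "(\<Sum>j<?m. ?d j * (2 ^ B) ^ j) div 2 ^ (B * j) mod 2 ^ B - 2 ^ (B - 1) = c j" if "j < ?m" for j
    using digit_of_sum[OF d that] by (simp only: power_mult zero_less_power zero_less_numeral)
  then show ?thesis unfolding unpack_def Let_def z
    by (simp only: prod.inject) (auto simp only: map_eq_conv set_upt atLeastLessThan_iff)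
qed

lemma position_less_general:
  assumes "e \<in> box k N" "N \<le> M"
  shows "position N M e < (2 * M + 1) ^ k"
proof -
  have "nat (x + int N) < 2 * M + 1" if "x \<in> set e" for x
    using assms that unfolding box_def by force
  then have "\<forall>x\<in>set e. nat (x + int N) < 2 * M + 1" by blast
  from horner_sum_less[OF this] show ?thesis using assms by (simp add: position_def box_def)
qed

lemma pack_mult:
  assumes "well_formed k p" "well_formed k q"
  shows "pack k (fst p + fst q) B p * pack k (fst p + fst q) B q
    = (\<Sum>j<(2 * (fst p + fst q) + 1) ^ k.
         convolution k p q (exponents k (fst p + fst q) ! j) * 2 ^ (B * j))"
proof -
  let ?M = "fst p + fst q"
  have pos: "position (fst p) ?M x + position (fst q) ?M y = position ?M ?M (map2 (+) x y)"
    if "x \<in> box k (fst p)" "y \<in> box k (fst q)" for x y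
    using that position_add[of x y "fst p" "fst q" ?M] by (simp add: box_def)
  have "pack k ?M B p * pack k ?M B q
      = (\<Sum>x\<in>box k (fst p). \<Sum>y\<in>box k (fst q).
          coeff p x * coeff q y * 2 ^ (B * position ?M ?M (map2 (+) x y)))"
    using assms
    by (simp add: pack_eq_sum sum_product pos[symmetric] distrib_left power_add mult_ac cong: sum.cong)
  also have "\<dots> = (\<Sum>e\<in>box k ?M. convolution k p q e * 2 ^ (B * position ?M ?M e))"
    using sum_convolution[of "\<lambda>e c. c * 2 ^ (B * position ?M ?M e)" k p q]
    by (simp add: distrib_right)
  also have "\<dots> = (\<Sum>j<(2 * ?M + 1) ^ k. convolution k p q (exponents k ?M ! j) * 2 ^ (B * j))"
    using sum.reindex_bij_betw[OF bij_betw_position,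
        of "\<lambda>j. convolution k p q (exponents k ?M ! j) * 2 ^ (B * j)" ?M k]
    by (simp add: exponents_nth_position cong: sum.cong)
  finally show ?thesis .
qed

text \<open>Kronecker substitution is exact: evaluation at a power of two is multiplicative, and every
  coefficient of the product is small enough to be read off from its digit.\<close>

lemma fst_mulD:
  assumes "well_formed k p" "well_formed k q"
  shows "fst (mulD tmul k p q) = (fst p + fst q, map (convolution k p q) (exponents k (fst p + fst q)))"
proof -
  let ?M = "fst p + fst q"
  let ?m = "(2 * ?M + 1) ^ k"
  let ?B = "coef_bits p + coef_bits q + nbits (int ?m) + 2"
  have "\<bar>convolution k p q e\<bar> < 2 ^ (?B - 1)" for e
  proof -
    have "(2 * fst p + 1) ^ k \<le> ?m" by (intro power_mono) auto
    then have "int ((2 * fst p + 1) ^ k) \<le> int ?m" by (simp only: of_nat_le_iff)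
    also have "\<dots> < 2 ^ nbits (int ?m)" using abs_less_nbits[of "int ?m"] by simp
    finally have "int ((2 * fst p + 1) ^ k) * 2 ^ (coef_bits p + coef_bits q)
        < 2 ^ nbits (int ?m) * 2 ^ (coef_bits p + coef_bits q)" by simp
    also have "\<dots> = (2::int) ^ (coef_bits p + coef_bits q + nbits (int ?m))"
      by (simp only: power_add[symmetric] add.commute)
    also have "\<dots> \<le> 2 ^ (?B - 1)" by (rule power_increasing) auto
    finally show ?thesis using abs_convolution_le[OF assms, of e] by linarith
  qed
  then have "unpack k ?M ?B (pack k ?M ?B p * pack k ?M ?B q)
     = (?M, map (\<lambda>j. convolution k p q (exponents k ?M ! j)) [0..<?m])"
    unfolding pack_mult[OF assms] by (intro unpack_digits) auto
  also have "map (\<lambda>j. convolution k p q (exponents k ?M ! j)) [0..<?m]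
      = map (convolution k p q) (exponents k ?M)"
    by (rule nth_equalityI) auto
  finally show ?thesis unfolding mulD_def Let_def by simp
qed

lemma fst_fst_mulD: "fst (fst (mulD tmul k p q)) = fst p + fst q"
  by (simp add: mulD_def Let_def unpack_def)

lemma well_formed_mulD: "well_formed k (fst (mulD tmul k p q))"
  by (simp add: mulD_def Let_def unpack_def well_formed_def)

lemma decode_mulD:
  assumes "well_formed k p" "well_formed k q"
  shows "decode k (fst (mulD tmul k p q)) = decode k p * decode k q"
proof -
  let ?M = "fst p + fst q"
  have "decode k (fst (mulD tmul k p q))
      = (\<Sum>e\<in>box k ?M. Poly_Mapping.single (Poly_Mapping.nth e) (convolution k p q e))"
    using decode_eq_sum[OF well_formed_mulD[of k tmul p q]] unfolding fst_mulD[OF assms]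
    by (simp add: coeff_map_exponents cong: sum.cong)
  also have "\<dots> = (\<Sum>x\<in>box k (fst p). \<Sum>y\<in>box k (fst q).
      Poly_Mapping.single (Poly_Mapping.nth (map2 (+) x y)) (coeff p x * coeff q y))"
    by (rule sum_convolution) (auto simp: single_add)
  also have "\<dots> = (\<Sum>x\<in>box k (fst p). \<Sum>y\<in>box k (fst q).
      Poly_Mapping.single (Poly_Mapping.nth x) (coeff p x) * Poly_Mapping.single (Poly_Mapping.nth y) (coeff q y))"
    by (intro sum.cong refl) (auto simp: nth_map2_add mult_single box_def)
  also have "\<dots> = decode k p * decode k q"
    using assms by (simp add: decode_eq_sum sum_product)
  finally show ?thesis .
qed

lemma norm1_mulD:
  assumes "well_formed k p" "well_formed k q"
  shows "norm1 (fst (mulD tmul k p q)) \<le> norm1 p * norm1 q"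
proof -
  let ?M = "fst p + fst q"
  let ?Z = "\<lambda>e. {z \<in> box k (fst p) \<times> box k (fst q). map2 (+) (fst z) (snd z) = e}"
  have "norm1 (fst (mulD tmul k p q)) = (\<Sum>e\<in>box k ?M. \<bar>convolution k p q e\<bar>)"
    using norm1_eq_sum[OF well_formed_mulD[of k tmul p q]] unfolding fst_mulD[OF assms]
    by (simp add: coeff_map_exponents cong: sum.cong)
  also have "\<dots> \<le> (\<Sum>e\<in>box k ?M. \<Sum>z\<in>?Z e. \<bar>coeff p (fst z)\<bar> * \<bar>coeff q (snd z)\<bar>)"
    unfolding convolution_def case_prod_unfold abs_mult[symmetric] by (intro sum_mono sum_abs)
  also have "\<dots> = (\<Sum>z\<in>box k (fst p) \<times> box k (fst q). \<bar>coeff p (fst z)\<bar> * \<bar>coeff q (snd z)\<bar>)"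
    by (rule sum.group) (auto intro!: map2_add_in_box)
  also have "\<dots> = norm1 p * norm1 q"
    using assms by (simp add: norm1_eq_sum sum_product sum.cartesian_product case_prod_unfold)
  finally show ?thesis .
qed

lemma pad_eq: "pad k M p = map (\<lambda>e. if e \<in> box k (fst p) then coeff p e else 0) (exponents k M)"
proof -
  have "length e = k" if "e \<in> set (exponents k M)" for e
    using that by (simp add: set_exponents box_def)
  then show ?thesis by (cases p) (auto simp: pad_def coeff_def box_def)
qed

lemma box_mono: "N \<le> M \<Longrightarrow> box k N \<subseteq> box k M"
  unfolding box_def by fastforce

lemma sum_padded:
  assumes "N \<le> M" "\<And>e. f e 0 = 0"
  shows "(\<Sum>e\<in>box k M. f e (if e \<in> box k N then g e else 0)) = (\<Sum>e\<in>box k N. f e (g e))"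
proof -
  have "(\<Sum>e\<in>box k M. f e (if e \<in> box k N then g e else 0)) = (\<Sum>e\<in>box k M. if e \<in> box k N then f e (g e) else 0)"
    by (intro sum.cong) (auto simp: assms)
  also have "\<dots> = (\<Sum>e\<in>box k M \<inter> box k N. f e (g e))" by (simp add: sum.inter_restrict)
  also have "box k M \<inter> box k N = box k N" using box_mono[OF assms(1)] by blast
  finally show ?thesis .
qed

lemma fst_addD: "fst (addD tadd k p q) = (max (fst p) (fst q),
    map (\<lambda>e. (if e \<in> box k (fst p) then coeff p e else 0) + (if e \<in> box k (fst q) then coeff q e else 0))
      (exponents k (max (fst p) (fst q))))"
  by (simp add: addD_def Let_def pad_eq case_prod_unfold zip_map_map zip_same_conv_map o_def)

lemma well_formed_addD: "well_formed k (fst (addD tadd k p q))"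
  by (simp add: fst_addD well_formed_def)

lemma fst_fst_addD: "fst (fst (addD tadd k p q)) = max (fst p) (fst q)"
  by (simp add: fst_addD)

lemma decode_addD:
  assumes "well_formed k p" "well_formed k q"
  shows "decode k (fst (addD tadd k p q)) = decode k p + decode k q"
  using decode_eq_sum[OF well_formed_addD[of k tadd p q]] assms
    sum_padded[of "fst p" "max (fst p) (fst q)"
      "\<lambda>e c. Poly_Mapping.single (Poly_Mapping.nth e) c" k "coeff p"]
    sum_padded[of "fst q" "max (fst p) (fst q)"
      "\<lambda>e c. Poly_Mapping.single (Poly_Mapping.nth e) c" k "coeff q"]
  unfolding fst_addD
  by (simp add: coeff_map_exponents single_add sum.distrib decode_eq_sum cong: sum.cong)

lemma norm1_addD:
  assumes "well_formed k p" "well_formed k q"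
  shows "norm1 (fst (addD tadd k p q)) \<le> norm1 p + norm1 q"
proof -
  let ?M = "max (fst p) (fst q)"
  let ?f = "\<lambda>p e. if e \<in> box k (fst p) then coeff p e else 0"
  have "norm1 (fst (addD tadd k p q)) = (\<Sum>e\<in>box k ?M. \<bar>?f p e + ?f q e\<bar>)"
    using norm1_eq_sum[OF well_formed_addD[of k tadd p q]] unfolding fst_addD
    by (simp add: coeff_map_exponents cong: sum.cong)
  also have "\<dots> \<le> (\<Sum>e\<in>box k ?M. \<bar>?f p e\<bar> + \<bar>?f q e\<bar>)"
    by (intro sum_mono abs_triangle_ineq)
  also have "\<dots> = norm1 p + norm1 q"
    using sum_padded[of "fst p" ?M "\<lambda>_ c. \<bar>c\<bar>" k "coeff p"]
      sum_padded[of "fst q" ?M "\<lambda>_ c. \<bar>c\<bar>" k "coeff q"] assms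
    by (simp add: sum.distrib norm1_eq_sum)
  finally show ?thesis .
qed

text \<open>The box used by the encoding is defined as a least one; it exists because only finitely many
  exponents occur.\<close>

lemma encode_fst_bound:
  assumes "m \<in> Poly_Mapping.keys p"
  shows "\<bar>Poly_Mapping.lookup m i\<bar> \<le> int (fst (encode k p))"
proof -
  let ?P = "\<lambda>N. \<forall>m\<in>Poly_Mapping.keys p. \<forall>i. \<bar>Poly_Mapping.lookup m i\<bar> \<le> int N"
  let ?V = "\<Union>m\<in>Poly_Mapping.keys p. insert 0 (Poly_Mapping.lookup m ` Poly_Mapping.keys m)"
  have fin: "finite ?V" by simp
  have "?P (nat (Max (insert 0 (abs ` ?V))))"
  proof (intro ballI allI)
    fix m i assume m: "m \<in> Poly_Mapping.keys p"
    then have "Poly_Mapping.lookup m i \<in> ?V"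
      by (cases "i \<in> Poly_Mapping.keys m") (force simp: in_keys_iff simp del: lookup_not_eq_zero_eq_in_keys)+
    then have "\<bar>Poly_Mapping.lookup m i\<bar> \<le> Max (insert 0 (abs ` ?V))"
      using fin by (intro Max_ge) auto
    then show "\<bar>Poly_Mapping.lookup m i\<bar> \<le> int (nat (Max (insert 0 (abs ` ?V))))" by linarith
  qed
  then have "?P (LEAST N. ?P N)" by (rule LeastI)
  then show ?thesis using assms by (simp add: encode_def Let_def)
qed

lemma encode_eq: "encode k p = (fst (encode k p),
    map (\<lambda>e. Poly_Mapping.lookup p (Poly_Mapping.nth e)) (exponents k (fst (encode k p))))"
  by (simp add: encode_def Let_def)

lemma well_formed_encode: "well_formed k (encode k p)"
  by (simp add: encode_def Let_def well_formed_def)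

lemma coeff_encode: "e \<in> box k (fst (encode k p)) \<Longrightarrow>
    coeff (encode k p) e = Poly_Mapping.lookup p (Poly_Mapping.nth e)"
  using coeff_map_exponents by (subst encode_eq) fastforce

lemma poly_mapping_sum_single:
  "(\<Sum>m\<in>Poly_Mapping.keys p. Poly_Mapping.single m (Poly_Mapping.lookup p m)) = p"
  by (intro poly_mapping_eqI) (auto simp: lookup_sum lookup_single when_def in_keys_iff)

lemma decode_encode:
  assumes "laurent_in k p"
  shows "decode k (encode k p) = p"
proof -
  let ?N = "fst (encode k p)"
  have keys: "Poly_Mapping.keys p \<subseteq> Poly_Mapping.nth ` box k ?N"
  proof
    fix m assume m: "m \<in> Poly_Mapping.keys p"
    let ?e = "map (Poly_Mapping.lookup m) [0..<k]"
    have "Poly_Mapping.nth ?e = m"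
    proof (intro poly_mapping_eqI)
      fix i
      have "Poly_Mapping.keys m \<subseteq> {..<k}" using assms m by (simp add: laurent_in_def)
      then show "Poly_Mapping.lookup (Poly_Mapping.nth ?e) i = Poly_Mapping.lookup m i"
        by (cases "i < k") (auto simp: nth_default_def in_keys_iff)
    qed
    moreover have "?e \<in> box k ?N" using encode_fst_bound[OF m] by (auto simp: box_def)
    ultimately show "m \<in> Poly_Mapping.nth ` box k ?N" by (metis image_eqI)
  qed
  have "decode k (encode k p)
      = (\<Sum>e\<in>box k ?N. Poly_Mapping.single (Poly_Mapping.nth e) (Poly_Mapping.lookup p (Poly_Mapping.nth e)))"
    by (simp add: decode_eq_sum[OF well_formed_encode] coeff_encode cong: sum.cong)
  also have "\<dots> = (\<Sum>m\<in>Poly_Mapping.nth ` box k ?N. Poly_Mapping.single m (Poly_Mapping.lookup p m))"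
    by (simp add: sum.reindex[OF inj_on_nth_box])
  also have "\<dots> = (\<Sum>m\<in>Poly_Mapping.keys p. Poly_Mapping.single m (Poly_Mapping.lookup p m))"
    using keys by (intro sum.mono_neutral_right) (auto simp: in_keys_iff)
  finally show ?thesis by (simp add: poly_mapping_sum_single)
qed


section \<open>The cost of arithmetic\<close>

text \<open>One number bounds both the exponents and the bit length of the coefficients. Both bounds add up
  under multiplication, so the size of a product needs no further bookkeeping.\<close>

definition fits :: "nat \<Rightarrow> nat \<Rightarrow> dense \<Rightarrow> bool" where
  "fits k b p \<longleftrightarrow> well_formed k p \<and> fst p \<le> b \<and> norm1 p \<le> 2 ^ b"

lemma fits_well_formed: "fits k b p \<Longrightarrow> well_formed k p"
  by (simp add: fits_def)

lemma fits_mono: "fits k b p \<Longrightarrow> b \<le> b' \<Longrightarrow> fits k b' p"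
  unfolding fits_def by (meson order_trans power_increasing one_le_numeral)

lemma fits_mulD: "fits k b p \<Longrightarrow> fits k b' q \<Longrightarrow> fits k (b + b') (fst (mulD tmul k p q))"
  using norm1_mulD[of k p q tmul] mult_mono[of "norm1 p" "2 ^ b" "norm1 q" "2 ^ b'"]
  by (auto simp: fits_def well_formed_mulD fst_fst_mulD norm1_nonneg power_add)

lemma abs_le_norm1: "c \<in> set (snd p) \<Longrightarrow> \<bar>c\<bar> \<le> norm1 p"
  unfolding norm1_def by (rule member_le_sum_list) auto

lemma fits_coef_bits:
  assumes "fits k b p"
  shows "coef_bits p \<le> b + 1"
proof -
  have "nbits c \<le> b + 1" if "c \<in> set (snd p)" for c
  proof (rule nbits_le)
    have "\<bar>c\<bar> \<le> 2 ^ b" using abs_le_norm1[OF that] assms by (simp add: fits_def)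
    also have "(2::int) ^ b < 2 ^ (b + 1)" by simp
    finally show "\<bar>c\<bar> < 2 ^ (b + 1)" .
  qed
  then show ?thesis by (auto simp: coef_bits_def)
qed

text \<open>At most \<open>(2 b + 1) ^ k\<close> digits of at most \<open>(k + 5) (b + 1)\<close> bits, with \<open>b + 1\<close> enlarged to
  \<open>2 b + 1\<close> to have a single power.\<close>

definition packed_bits :: "nat \<Rightarrow> nat \<Rightarrow> nat" where
  "packed_bits k b = (k + 5) * (2 * b + 1) ^ (k + 1)"

lemma packed_bits_mono: "b \<le> b' \<Longrightarrow> packed_bits k b \<le> packed_bits k b'"
  unfolding packed_bits_def by (intro mult_le_mono2 power_mono) auto

lemma packed_bits_ge: "(k + 5) * (b + 1) * (2 * b + 1) ^ k \<le> packed_bits k b"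
  unfolding packed_bits_def by (simp add: mult_mono algebra_simps)

lemma packed_bits_ge': "c \<le> (k + 5) * (b + 1) \<Longrightarrow> m \<le> (2 * b + 1) ^ k \<Longrightarrow> c * m \<le> packed_bits k b"
  by (rule order_trans[OF mult_le_mono packed_bits_ge])

lemma packed_bits_ge_5: "5 \<le> packed_bits k b"
  using packed_bits_ge'[of 5 k b 1] by simp

text \<open>Five passes over the packed bits (one over the operands and four for packing and unpacking) and one
  integer operation. The time of an addition has the same bound.\<close>

definition op_cost :: "nat \<Rightarrow> real \<Rightarrow> nat \<Rightarrow> nat" where
  "op_cost k C b = nat \<lceil>real (packed_bits k b) * (5 + C * log 2 (real (packed_bits k b)))\<rceil>"

lemma log_packed_bits_mono:
  "b \<le> b' \<Longrightarrow> log 2 (real (packed_bits k b)) \<le> log 2 (real (packed_bits k b'))"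
  using packed_bits_mono[of b b' k] packed_bits_ge_5[of k b] by simp

lemma log_packed_bits_nonneg: "0 \<le> log 2 (real (packed_bits k b))"
  using packed_bits_ge_5[of k b] by simp

lemma op_cost_mono:
  assumes "0 \<le> C" "b \<le> b'"
  shows "op_cost k C b \<le> op_cost k C b'"
  unfolding op_cost_def
  using assms packed_bits_mono[of b b' k] log_packed_bits_mono[of b b' k] log_packed_bits_nonneg[of k b]
  by (intro nat_mono ceiling_mono mult_mono add_mono) auto

definition op_bound :: "real \<Rightarrow> (int \<Rightarrow> int \<Rightarrow> nat) \<Rightarrow> bool" where
  "op_bound C t \<longleftrightarrow> 0 \<le> C \<and> (\<forall>b\<ge>2. \<forall>x y. \<bar>x\<bar> < 2 ^ b \<longrightarrow> \<bar>y\<bar> < 2 ^ b \<longrightarrow>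
     real (t x y) \<le> C * real b * log 2 (real b))"

lemma fast_int_ops_bound:
  assumes "fast_int_op t" "fast_int_op t'"
  obtains C where "op_bound C t" "op_bound C t'"
proof -
  obtain A B where
    A: "\<And>b x y. 2 \<le> b \<Longrightarrow> \<bar>x\<bar> < 2 ^ b \<Longrightarrow> \<bar>y\<bar> < 2 ^ b \<Longrightarrow> real (t x y) \<le> A * (real b * log 2 (real b))" and
    B: "\<And>b x y. 2 \<le> b \<Longrightarrow> \<bar>x\<bar> < 2 ^ b \<Longrightarrow> \<bar>y\<bar> < 2 ^ b \<Longrightarrow> real (t' x y) \<le> B * (real b * log 2 (real b))"
    using assms unfolding fast_int_op_def mult.assoc by blast
  \<comment> \<open>the given constants may be negative\<close>
  let ?C = "max 0 (max A B)"
  have pos: "0 \<le> real b * log 2 (real b)" if "2 \<le> b" for b :: nat using that by simp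
  have "op_bound ?C t" "op_bound ?C t'"
    unfolding op_bound_def mult.assoc
    by (auto intro: order_trans[OF A] order_trans[OF B] intro!: mult_right_mono pos)
  then show ?thesis by (rule that)
qed

text \<open>The absolute value is at most the sum of the absolute values of the coefficients times the weight of the
  highest digit, and the exponents of two add up to less than the number of packed bits.\<close>

lemma abs_pack_less:
  assumes "fits k b p" "fst p \<le> M" "M \<le> b'" "b \<le> b'" "B \<le> (k + 5) * (b' + 1)"
  shows "\<bar>pack k M B p\<bar> < 2 ^ packed_bits k b'"
proof -
  let ?m = "(2 * M + 1) ^ k"
  let ?W = "(k + 5) * (b' + 1)"
  have wf: "well_formed k p" using assms(1) by (rule fits_well_formed)
  have term_le: "\<bar>coeff p e * 2 ^ (B * position (fst p) M e)\<bar> \<le> \<bar>coeff p e\<bar> * 2 ^ (B * (?m - 1))"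
    if "e \<in> box k (fst p)" for e
  proof -
    have "position (fst p) M e \<le> ?m - 1"
      using position_less_general[OF that assms(2)] by linarith
    then show ?thesis unfolding abs_mult by (intro mult_left_mono) (auto intro: power_increasing)
  qed
  have "\<bar>pack k M B p\<bar> \<le> (\<Sum>e\<in>box k (fst p). \<bar>coeff p e * 2 ^ (B * position (fst p) M e)\<bar>)"
    unfolding pack_eq_sum[OF wf] by (rule sum_abs)
  also have "\<dots> \<le> (\<Sum>e\<in>box k (fst p). \<bar>coeff p e\<bar> * 2 ^ (B * (?m - 1)))"
    by (rule sum_mono) (rule term_le)
  also have "\<dots> = norm1 p * 2 ^ (B * (?m - 1))"
    by (simp only: norm1_eq_sum[OF wf] sum_distrib_right)
  also have "\<dots> \<le> 2 ^ b * 2 ^ (B * (?m - 1))"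
    using assms(1) by (intro mult_right_mono) (auto simp: fits_def)
  also have "\<dots> = 2 ^ (b + B * (?m - 1))" by (simp only: power_add)
  also have "\<dots> < 2 ^ packed_bits k b'"
  proof (rule power_strict_increasing)
    have "b < ?W" using assms(4) by (simp add: add_mult_distrib)
    moreover have "B * (?m - 1) \<le> ?W * (?m - 1)" using assms(5) by (rule mult_le_mono1)
    moreover have "?W + ?W * (?m - 1) = ?W * ?m" by (cases "?m") auto
    moreover have "?W * ?m \<le> packed_bits k b'"
      using assms(3) by (intro packed_bits_ge' power_mono) auto
    ultimately show "b + B * (?m - 1) < packed_bits k b'" by linarith
  qed simp
  finally show ?thesis .
qed

lemma le_op_costI:
  assumes "real t \<le> real (packed_bits k b) * (5 + C * log 2 (real (packed_bits k b)))"
  shows "t \<le> op_cost k C b"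
  using assms unfolding op_cost_def by linarith

lemma box_card_le_power_two: "(2 * b + 1) ^ k < (2::nat) ^ ((b + 1) * k + 1)"
proof -
  have "2 * b + 1 \<le> 2 ^ (b + 1)"
    using less_exp[of b] unfolding power_add power_one_right by linarith
  then have "(2 * b + 1) ^ k \<le> (2 ^ (b + 1)) ^ k" by (rule power_mono) simp
  also have "\<dots> = 2 ^ ((b + 1) * k)" by (simp only: power_mult)
  also have "\<dots> < 2 ^ ((b + 1) * k + 1)" by (rule power_strict_increasing) auto
  finally show ?thesis .
qed

lemma dense_size_le:
  assumes "fits k b p" "b \<le> b'"
  shows "dense_size p \<le> (b + 2) * (2 * b' + 1) ^ k"
proof -
  have "length (snd p) \<le> (2 * b' + 1) ^ k"
    using assms unfolding fits_def well_formed_def by (auto intro!: power_mono)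
  moreover have "coef_bits p + 1 \<le> b + 2" using fits_coef_bits[OF assms(1)] by simp
  ultimately have "length (snd p) * (coef_bits p + 1) \<le> (2 * b' + 1) ^ k * (b + 2)"
    by (rule mult_le_mono)
  then show ?thesis unfolding dense_size_def by (simp only: mult.commute)
qed

lemma snd_mulD_le:
  assumes "op_bound C tmul" "fits k b p" "fits k b' q"
  shows "snd (mulD tmul k p q) \<le> op_cost k C (b + b')"
proof -
  let ?M = "fst p + fst q"
  let ?m = "(2 * ?M + 1) ^ k"
  let ?B = "coef_bits p + coef_bits q + nbits (int ?m) + 2"
  let ?b = "b + b'"
  let ?Y = "packed_bits k ?b"
  have M: "?M \<le> ?b" using assms by (simp add: fits_def)
  then have m: "?m \<le> (2 * ?b + 1) ^ k" by (intro power_mono) auto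
  then have "?m < 2 ^ ((?b + 1) * k + 1)" using box_card_le_power_two[of ?b k] by linarith
  then have "int ?m < int (2 ^ ((?b + 1) * k + 1))" by (simp only: of_nat_less_iff)
  then have nm: "nbits (int ?m) \<le> (?b + 1) * k + 1" by (intro nbits_le) simp
  have B: "?B \<le> (k + 5) * (?b + 1)"
    using nm fits_coef_bits[OF assms(2)] fits_coef_bits[OF assms(3)]
    by (simp add: algebra_simps)
  have "\<bar>pack k ?M ?B p\<bar> < 2 ^ ?Y" "\<bar>pack k ?M ?B q\<bar> < 2 ^ ?Y"
    using assms M B by (auto intro!: abs_pack_less)
  then have mul: "real (tmul (pack k ?M ?B p) (pack k ?M ?B q)) \<le> C * real ?Y * log 2 (real ?Y)"
    using assms(1) packed_bits_ge_5[of k ?b] unfolding op_bound_def by auto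
  have "dense_size p + dense_size q \<le> (b + 2 + (b' + 2)) * (2 * ?b + 1) ^ k"
    using dense_size_le[OF assms(2), of ?b] dense_size_le[OF assms(3), of ?b]
    by (simp add: add_mult_distrib)
  also have "\<dots> \<le> ?Y" by (intro packed_bits_ge') (auto simp: algebra_simps)
  finally have sizes: "dense_size p + dense_size q \<le> ?Y" .
  have "?B * ?m \<le> ?Y" using B m by (rule packed_bits_ge')
  moreover have "snd (mulD tmul k p q)
      = (dense_size p + dense_size q) + 4 * (?B * ?m) + tmul (pack k ?M ?B p) (pack k ?M ?B q)"
    by (simp only: mulD_def Let_def snd_bind_timed snd_tick snd_ret mult.assoc)
  ultimately have "snd (mulD tmul k p q) \<le> 5 * ?Y + tmul (pack k ?M ?B p) (pack k ?M ?B q)"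
    using sizes by linarith
  then have "real (snd (mulD tmul k p q)) \<le> 5 * real ?Y + C * real ?Y * log 2 (real ?Y)"
    using mul by linarith
  then show ?thesis by (intro le_op_costI) (simp add: algebra_simps)
qed

lemma real_sum_list_le:
  assumes "\<And>x. x \<in> set xs \<Longrightarrow> real (f x) \<le> c"
  shows "real (\<Sum>x\<leftarrow>xs. f x) \<le> real (length xs) * c"
  using assms
proof (induction xs)
  case (Cons x xs)
  then have "real (f x) \<le> c" "real (\<Sum>x\<leftarrow>xs. f x) \<le> real (length xs) * c" by auto
  then show ?case by (simp add: algebra_simps)
qed simp

lemma snd_addD_le:
  assumes "op_bound C tadd" "fits k b p" "fits k b q"
  shows "snd (addD tadd k p q) \<le> op_cost k C b"
proof -
  let ?M = "max (fst p) (fst q)"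
  let ?m = "(2 * ?M + 1) ^ k"
  let ?Y = "packed_bits k b"
  let ?zs = "zip (pad k ?M p) (pad k ?M q)"
  have M: "?M \<le> b" using assms by (simp add: fits_def)
  then have m: "?m \<le> (2 * b + 1) ^ k" by (intro power_mono) auto
  have b2: "b + 2 \<le> (k + 5) * (b + 1)" by (simp add: algebra_simps)
  have Y: "b + 2 \<le> ?Y" using packed_bits_ge'[of "b + 2" k b 1] by (simp add: algebra_simps)
  have small: "\<bar>x\<bar> < 2 ^ (b + 2)" if "x \<in> set (pad k ?M r)" "fits k b r" for x r
  proof -
    have "x = 0 \<or> x \<in> set (snd r)"
      using that coeff_in_set[of k r] by (auto simp: pad_eq fits_def split: if_splits)
    then have "\<bar>x\<bar> \<le> norm1 r" using abs_le_norm1[of x r] norm1_nonneg[of r] by auto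
    also have "\<dots> \<le> 2 ^ b" using that by (simp add: fits_def)
    also have "\<dots> < 2 ^ (b + 2)" by (intro power_strict_increasing) auto
    finally show ?thesis .
  qed
  let ?c = "C * real (b + 2) * log 2 (real (b + 2))"
  have add: "real (tadd x y) \<le> ?c" if "(x, y) \<in> set ?zs" for x y
  proof -
    have "\<bar>x\<bar> < 2 ^ (b + 2)" "\<bar>y\<bar> < 2 ^ (b + 2)"
      using that assms small by (meson set_zip_leftD set_zip_rightD)+
    moreover have "2 \<le> b + 2" by simp
    ultimately show ?thesis using assms(1) unfolding op_bound_def by blast
  qed
  have "real (\<Sum>(x, y)\<leftarrow>?zs. tadd x y) \<le> real (length ?zs) * ?c"
    using add by (intro real_sum_list_le) auto
  also have "\<dots> = real ?m * ?c" by (simp add: pad_eq)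
  also have "\<dots> = C * (real ((b + 2) * ?m) * log 2 (real (b + 2)))"
    by (simp only: of_nat_mult mult_ac)
  also have "\<dots> \<le> C * (real ?Y * log 2 (real ?Y))"
  proof (intro mult_left_mono mult_mono)
    have "(b + 2) * ?m \<le> ?Y" using b2 m by (rule packed_bits_ge')
    then show "real ((b + 2) * ?m) \<le> real ?Y" by (simp only: of_nat_le_iff)
    show "log 2 (real (b + 2)) \<le> log 2 (real ?Y)" using Y by simp
    show "0 \<le> C" using assms(1) by (simp add: op_bound_def)
  qed auto
  finally have adds: "real (\<Sum>(x, y)\<leftarrow>?zs. tadd x y) \<le> C * (real ?Y * log 2 (real ?Y))" .
  have "coef_bits p + coef_bits q + 2 \<le> 2 * (b + 2)"
    using fits_coef_bits[OF assms(2)] fits_coef_bits[OF assms(3)] by simp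
  then have "?m * (coef_bits p + coef_bits q + 2) \<le> ?m * (2 * (b + 2))" by (rule mult_le_mono2)
  also have "\<dots> = 2 * ((b + 2) * ?m)" by (simp only: mult_ac)
  also have "(b + 2) * ?m \<le> ?Y" using b2 m by (rule packed_bits_ge')
  finally have "snd (addD tadd k p q) \<le> 2 * ?Y + (\<Sum>(x, y)\<leftarrow>?zs. tadd x y)"
    by (simp add: addD_def Let_def case_prod_unfold)
  then have "real (snd (addD tadd k p q)) \<le> 2 * real ?Y + C * (real ?Y * log 2 (real ?Y))"
    using adds by linarith
  then show ?thesis by (intro le_op_costI) (simp add: algebra_simps)
qed


section \<open>Sums over the indices of edges\<close>

text \<open>Assignments of indices are total functions that are updated one edge at a time. In this way sums over
  different sets of edges have the same type, and exchanging or restricting sums reduces to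
  properties of single updates.\<close>

fun sum_over :: "nat \<Rightarrow> 'x list \<Rightarrow> (('x \<Rightarrow> nat) \<Rightarrow> 'r) \<Rightarrow> ('x \<Rightarrow> nat) \<Rightarrow> 'r::comm_semiring_1" where
  "sum_over d [] f \<sigma> = f \<sigma>"
| "sum_over d (x # xs) f \<sigma> = (\<Sum>i<d. sum_over d xs f (\<sigma>(x := i)))"

definition ignores :: "(('x \<Rightarrow> nat) \<Rightarrow> 'r) \<Rightarrow> 'x \<Rightarrow> bool" where
  "ignores f x \<longleftrightarrow> (\<forall>\<sigma> i. f (\<sigma>(x := i)) = f \<sigma>)"

lemma ignoresD: "ignores f x \<Longrightarrow> f (\<sigma>(x := i)) = f \<sigma>"
  by (simp add: ignores_def)

lemma sum_over_append: "sum_over d (xs @ ys) f \<sigma> = sum_over d xs (sum_over d ys f) \<sigma>"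
  by (induction xs arbitrary: \<sigma>) auto

lemma sum_over_cong:
  assumes "\<And>\<tau>. (\<And>x. x \<notin> set xs \<Longrightarrow> \<tau> x = \<sigma> x) \<Longrightarrow> (\<And>x. x \<in> set xs \<Longrightarrow> \<tau> x < d) \<Longrightarrow> f \<tau> = g \<tau>"
  shows "sum_over d xs f \<sigma> = sum_over d xs g \<sigma>"
  using assms
proof (induction xs arbitrary: \<sigma>)
  case (Cons x xs)
  have "sum_over d xs f (\<sigma>(x := i)) = sum_over d xs g (\<sigma>(x := i))" if "i < d" for i
  proof (rule Cons.IH)
    fix \<tau> assume a: "\<And>y. y \<notin> set xs \<Longrightarrow> \<tau> y = (\<sigma>(x := i)) y" "\<And>y. y \<in> set xs \<Longrightarrow> \<tau> y < d"
    show "f \<tau> = g \<tau>"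
    proof (rule Cons.prems)
      show "\<tau> y = \<sigma> y" if "y \<notin> set (x # xs)" for y using a(1)[of y] that by simp
      show "\<tau> y < d" if "y \<in> set (x # xs)" for y
        using a[of y] that \<open>i < d\<close> by (cases "y \<in> set xs") auto
    qed
  qed
  then show ?case by simp
qed simp

text \<open>This distributivity is all that contraction uses: a factor that does not involve the chosen edges
  is left outside the sum over their indices.\<close>

lemma sum_over_mult_left:
  assumes "\<And>x. x \<in> set xs \<Longrightarrow> ignores g x"
  shows "sum_over d xs (\<lambda>\<sigma>. g \<sigma> * f \<sigma>) \<sigma> = g \<sigma> * sum_over d xs f \<sigma>"
  using assms
proof (induction xs arbitrary: \<sigma>)
  case (Cons x xs)
  then show ?case by (simp add: sum_distrib_left ignoresD)
qed simp

lemma ignores_sum_over: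
  assumes "x \<in> set xs \<or> ignores f x"
  shows "ignores (sum_over d xs f) x"
  using assms
proof (induction xs)
  case Nil
  then show ?case by (simp add: ignores_def)
next
  case (Cons y xs)
  show ?case
  proof (cases "x = y")
    case True
    then show ?thesis by (simp add: ignores_def)
  next
    case False
    then have "ignores (sum_over d xs f) x" using Cons by auto
    then show ?thesis using False by (simp add: ignores_def fun_upd_twist[OF False])
  qed
qed

lemma ignores_prod_list: "(\<And>g. g \<in> set fs \<Longrightarrow> ignores (F g) x) \<Longrightarrow> ignores (\<lambda>\<sigma>. \<Prod>g\<leftarrow>fs. F g \<sigma>) x"
  by (induction fs) (auto simp: ignores_def)

lemma sum_over_move:
  assumes "x \<notin> set xs"
  shows "sum_over d (xs @ x # ys) f \<sigma> = sum_over d (x # xs @ ys) f \<sigma>"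
  using assms
proof (induction xs arbitrary: \<sigma>)
  case (Cons y xs)
  then have "sum_over d ((y # xs) @ x # ys) f \<sigma>
      = (\<Sum>i<d. \<Sum>j<d. sum_over d (xs @ ys) f (\<sigma>(y := i, x := j)))" by simp
  also have "\<dots> = (\<Sum>j<d. \<Sum>i<d. sum_over d (xs @ ys) f (\<sigma>(y := i, x := j)))" by (rule sum.swap)
  also have "\<dots> = (\<Sum>j<d. \<Sum>i<d. sum_over d (xs @ ys) f (\<sigma>(x := j, y := i)))"
    using Cons.prems by (intro sum.cong refl arg_cong[where f = "sum_over d (xs @ ys) f"] fun_upd_twist) auto
  finally show ?case by simp
qed simp

lemma sum_over_permute:
  assumes "distinct xs" "distinct ys" "set xs = set ys"
  shows "sum_over d xs f \<sigma> = sum_over d ys f \<sigma>"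
  using assms
proof (induction xs arbitrary: ys \<sigma>)
  case (Cons x xs)
  then obtain us vs where ys: "ys = us @ x # vs" by (metis list.set_intros(1) split_list)
  then have "sum_over d ys f \<sigma> = sum_over d (x # us @ vs) f \<sigma>"
    using Cons.prems by (auto simp del: sum_over.simps intro!: sum_over_move)
  moreover have "sum_over d xs f \<tau> = sum_over d (us @ vs) f \<tau>" for \<tau>
    using Cons.prems ys by (intro Cons.IH) auto
  ultimately show ?case by simp
qed simp

lemma sum_over_map:
  assumes "inj g"
  shows "sum_over d (map g xs) (\<lambda>\<tau>. F (\<tau> \<circ> g)) \<tau> = sum_over d xs F (\<tau> \<circ> g)"
proof (induction xs arbitrary: \<tau>)
  case (Cons x xs)
  have "(\<tau>(g x := i)) \<circ> g = (\<tau> \<circ> g)(x := i)" for i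
    using assms by (auto simp: fun_eq_iff dest: injD)
  with Cons show ?case by (simp only: list.map sum_over.simps)
qed simp

definition assign :: "('x \<Rightarrow> nat option) \<Rightarrow> ('x \<Rightarrow> nat) \<Rightarrow> 'x \<Rightarrow> nat" where
  "assign s \<sigma> = (\<lambda>e. case s e of Some i \<Rightarrow> i | None \<Rightarrow> \<sigma> e)"

text \<open>The loops of the algorithm run over lists of indices; on a duplicate-free list of edges they
  compute the nested sum.\<close>

lemma sum_n_lists_eq_sum_over:
  fixes f :: "('x \<Rightarrow> nat) \<Rightarrow> 'r::comm_semiring_1"
  assumes "distinct xs"
  shows "(\<Sum>is\<leftarrow>List.n_lists (length xs) [0..<d]. f (assign (map_of (zip xs is)) \<sigma>)) = sum_over d xs f \<sigma>"
  using assms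
proof (induction xs arbitrary: \<sigma>)
  case Nil
  then show ?case by (simp add: assign_def)
next
  case (Cons x xs)
  let ?N = "List.n_lists (length xs) [0..<d]"
  have concat: "(\<Sum>z\<leftarrow>concat (map (\<lambda>ys. map (\<lambda>y. y # ys) [0..<d]) N). F z)
      = (\<Sum>ys\<leftarrow>N. \<Sum>y<d. F (y # ys))" for N and F :: "nat list \<Rightarrow> 'r"
    by (induction N) (auto simp: interv_sum_list_conv_sum_set_nat o_def atLeast0LessThan)
  have swap: "(\<Sum>ys\<leftarrow>N. \<Sum>y<d. F y ys) = (\<Sum>y<d. \<Sum>ys\<leftarrow>N. F y ys)"
    for N and F :: "nat \<Rightarrow> nat list \<Rightarrow> 'r"
    by (induction N) (auto simp: sum.distrib)
  have "assign (map_of (zip (x # xs) (y # ys))) \<sigma> = assign (map_of (zip xs ys)) (\<sigma>(x := y))"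
    if "ys \<in> set ?N" for y ys
  proof -
    have "length ys = length xs" using that by (simp add: set_n_lists)
    then have "map_of (zip xs ys) x = None" using Cons.prems by (simp add: map_of_zip_is_None)
    then show ?thesis by (auto simp: assign_def fun_eq_iff split: option.split)
  qed
  then have step: "f (assign (map_of (zip (x # xs) (y # ys))) \<sigma>) = f (assign (map_of (zip xs ys)) (\<sigma>(x := y)))"
    if "ys \<in> set ?N" for y ys
    using that by simp
  have "(\<Sum>is\<leftarrow>List.n_lists (length (x # xs)) [0..<d]. f (assign (map_of (zip (x # xs) is)) \<sigma>))
      = (\<Sum>ys\<leftarrow>?N. \<Sum>y<d. f (assign (map_of (zip xs ys)) (\<sigma>(x := y))))"
    unfolding List.n_lists.simps list.size concat add_0_right add_Suc_right
    by (intro arg_cong[where f = sum_list] map_cong refl sum.cong step)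
  also have "\<dots> = (\<Sum>y<d. \<Sum>ys\<leftarrow>?N. f (assign (map_of (zip xs ys)) (\<sigma>(x := y))))" by (rule swap)
  also have "\<dots> = (\<Sum>y<d. sum_over d xs f (\<sigma>(x := y)))"
    using Cons by (intro sum.cong refl Cons.IH) auto
  finally show ?case by (simp only: sum_over.simps)
qed


section \<open>Contraction of tensors\<close>

definition tensor_ok :: "nat \<Rightarrow> nat \<Rightarrow> nat \<Rightarrow> 'e tensor \<Rightarrow> bool" where
  "tensor_ok d k b t \<longleftrightarrow> length (snd t) = d ^ length (fst t) \<and> (\<forall>p\<in>set (snd t). fits k b p)"

text \<open>A leg may be repeated, namely when the edge is a loop at a merged vertex. Reading the entry at an
  assignment then picks the diagonal, as it should be before the loop is contracted.\<close>

definition tensor_value :: "nat \<Rightarrow> nat \<Rightarrow> 'e tensor \<Rightarrow> ('e \<Rightarrow> nat) \<Rightarrow> laurent" where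
  "tensor_value d k t \<sigma> = decode k (entry d t (map \<sigma> (fst t)))"

lemma ignores_tensor_value: "x \<notin> set (fst t) \<Longrightarrow> ignores (tensor_value d k t) x"
  unfolding ignores_def tensor_value_def
  by (metis (mono_tags, lifting) fun_upd_other map_cong)

lemma entry_fits:
  assumes "tensor_ok d k b t" "length is = length (fst t)" "set is \<subseteq> {..<d}"
  shows "fits k b (entry d t is)"
proof -
  have "horner_sum id d is < d ^ length (fst t)"
    using horner_sum_less[of "is" id d] assms by auto
  then show ?thesis using assms(1) by (simp add: tensor_ok_def entry_def)
qed

lemma entry_of_map:
  assumes "length is = m" "set is \<subseteq> {..<d}"
  shows "entry d (legs, map f (List.n_lists m [0..<d])) is = f is"
proof -
  have "horner_sum id d is < d ^ m" using horner_sum_less[of "is" id d] assms by auto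
  then have "entry d (legs, map f (List.n_lists m [0..<d])) is
      = f (List.n_lists m [0..<d] ! horner_sum id d is)"
    by (simp add: entry_def length_n_lists)
  then show ?thesis using nth_n_lists_horner[of "is" d] assms by (simp add: id_def)
qed

lemma fill_append:
  "fill s es (map \<tau> (filter (\<lambda>e. s e = None) es) @ zs) = map (assign s \<tau>) es"
  by (induction es) (auto simp: assign_def split: option.splits)

text \<open>The lists of indices that the algorithm forms for the merged tensors are the values of one
  assignment on their legs: the prescribed indices on the contracted edges, the free ones elsewhere.\<close>

lemma fills_eq:
  "fills s ess (map \<tau> (filter (\<lambda>e. s e = None) (concat ess))) = map (map (assign s \<tau>)) ess"
  by (induction ess) (auto simp: fill_append)

lemma fill_valid:
  assumes "length (filter (\<lambda>e. s e = None) es) \<le> length ys" "set ys \<subseteq> {..<d}"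
    "\<And>e i. s e = Some i \<Longrightarrow> i < d"
  shows "length (fill s es ys) = length es \<and> set (fill s es ys) \<subseteq> {..<d}"
  using assms(1,2)
proof (induction es arbitrary: ys)
  case (Cons e es)
  show ?case
  proof (cases "s e")
    case None
    then obtain y zs where ys: "ys = y # zs" using Cons.prems by (cases ys) auto
    then show ?thesis using Cons.IH[of zs] Cons.prems None by simp
  next
    case (Some i)
    then show ?thesis using Cons.IH[of ys] Cons.prems assms(3)[OF Some] by simp
  qed
qed simp

lemma fills_valid:
  assumes "length (filter (\<lambda>e. s e = None) (concat ess)) \<le> length ys" "set ys \<subseteq> {..<d}"
    "\<And>e i. s e = Some i \<Longrightarrow> i < d"
  shows "list_all2 (\<lambda>es is. length is = length es \<and> set is \<subseteq> {..<d}) ess (fills s ess ys)"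
  using assms(1,2)
proof (induction ess arbitrary: ys)
  case (Cons es ess)
  then have "length (fill s es ys) = length es \<and> set (fill s es ys) \<subseteq> {..<d}"
    by (intro fill_valid assms) auto
  moreover have "set (drop n ys) \<subseteq> {..<d}" for n
    using Cons.prems set_drop_subset by fastforce
  ultimately show ?case using Cons by auto
qed simp

lemma foldT_mulD:
  assumes "op_bound C tmul" "fits k b p"
    "list_all2 (\<lambda>b z. fits k b (g z)) bs zs"
  shows "fits k (b + sum_list bs) (fst (foldT (\<lambda>p z. mulD tmul k p (g z)) p zs))"
    and "decode k (fst (foldT (\<lambda>p z. mulD tmul k p (g z)) p zs)) = decode k p * (\<Prod>z\<leftarrow>zs. decode k (g z))"
    and "snd (foldT (\<lambda>p z. mulD tmul k p (g z)) p zs) \<le> length zs * op_cost k C (b + sum_list bs)"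
proof -
  have "fits k (b + sum_list bs) (fst (foldT (\<lambda>p z. mulD tmul k p (g z)) p zs)) \<and>
    decode k (fst (foldT (\<lambda>p z. mulD tmul k p (g z)) p zs)) = decode k p * (\<Prod>z\<leftarrow>zs. decode k (g z)) \<and>
    snd (foldT (\<lambda>p z. mulD tmul k p (g z)) p zs) \<le> length zs * op_cost k C (b + sum_list bs)"
    using assms(3,2)
  proof (induction bs zs arbitrary: b p)
    case (Cons b' bs z zs)
    have "snd (mulD tmul k p (g z)) \<le> op_cost k C (b + b')"
      using assms(1) Cons by (intro snd_mulD_le) auto
    also have "\<dots> \<le> op_cost k C (b + b' + sum_list bs)"
      using assms(1) by (intro op_cost_mono) (auto simp: op_bound_def)
    finally have "snd (mulD tmul k p (g z)) \<le> op_cost k C (b + b' + sum_list bs)" .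
    moreover have "fits k (b + b') (fst (mulD tmul k p (g z)))"
      using Cons by (intro fits_mulD) auto
    moreover have "decode k (fst (mulD tmul k p (g z))) = decode k p * decode k (g z)"
      using Cons by (intro decode_mulD) (auto intro: fits_well_formed)
    ultimately show ?case
      using Cons.IH[of "b + b'" "fst (mulD tmul k p (g z))"] by (simp add: algebra_simps)
  qed simp
  then show "fits k (b + sum_list bs) (fst (foldT (\<lambda>p z. mulD tmul k p (g z)) p zs))"
    and "decode k (fst (foldT (\<lambda>p z. mulD tmul k p (g z)) p zs)) = decode k p * (\<Prod>z\<leftarrow>zs. decode k (g z))"
    and "snd (foldT (\<lambda>p z. mulD tmul k p (g z)) p zs) \<le> length zs * op_cost k C (b + sum_list bs)"
    by auto
qed

text \<open>The accumulator grows by one summand at a time, so its norm is at most the number of summands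
  times \<open>2 ^ b\<close> all along; \<open>b'\<close> bounds its bit length throughout the loop.\<close>

lemma foldT_addD:
  fixes P :: "'a \<Rightarrow> dense timed" and c k :: nat and tadd
  defines "F \<equiv> \<lambda>acc x. do { tick c; p \<leftarrow> P x; addD tadd k acc p }"
  assumes "op_bound C tadd"
    and P: "\<And>x. x \<in> set xs \<Longrightarrow> fits k b (fst (P x)) \<and> snd (P x) \<le> cP"
    and acc: "well_formed k acc" "fst acc \<le> b" and b: "b \<le> b'"
    and norm: "norm1 acc + int (length xs) * 2 ^ b \<le> 2 ^ b'"
  shows "fits k b' (fst (foldT F acc xs)) \<and>
    decode k (fst (foldT F acc xs)) = decode k acc + (\<Sum>x\<leftarrow>xs. decode k (fst (P x))) \<and>
    snd (foldT F acc xs) \<le> length xs * (c + cP + op_cost k C b')"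
  using P acc norm
proof (induction xs arbitrary: acc)
  case Nil
  then show ?case using b by (auto simp: fits_def)
next
  case (Cons x xs)
  let ?p = "fst (P x)"
  let ?a = "fst (addD tadd k acc ?p)"
  have p: "fits k b ?p" "snd (P x) \<le> cP" using Cons.prems(1)[of x] by auto
  have wf: "well_formed k ?p" using p(1) by (rule fits_well_formed)
  have acc': "fits k b' acc"
  proof -
    have "0 \<le> int (length (x # xs)) * (2::int) ^ b" by simp
    then have "norm1 acc \<le> 2 ^ b'" using Cons.prems(4) by linarith
    then show ?thesis using Cons.prems b by (simp add: fits_def)
  qed
  have na: "norm1 ?a \<le> norm1 acc + 2 ^ b"
    using norm1_addD[OF Cons.prems(2) wf, of tadd] p(1) by (simp add: fits_def)
  have IH: "fits k b' (fst (foldT F ?a xs)) \<and>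
    decode k (fst (foldT F ?a xs)) = decode k ?a + (\<Sum>x\<leftarrow>xs. decode k (fst (P x))) \<and>
    snd (foldT F ?a xs) \<le> length xs * (c + cP + op_cost k C b')"
  proof (rule Cons.IH)
    show "norm1 ?a + int (length xs) * 2 ^ b \<le> 2 ^ b'"
      using na Cons.prems(4) by (simp add: algebra_simps)
    show "fst ?a \<le> b" using p(1) Cons.prems(3) by (simp add: fst_fst_addD fits_def)
  qed (use Cons.prems in \<open>auto simp: well_formed_addD\<close>)
  have "snd (addD tadd k acc ?p) \<le> op_cost k C b'"
    using assms(2) acc' fits_mono[OF p(1) b] by (rule snd_addD_le)
  then have "snd (F acc x) \<le> c + cP + op_cost k C b'" using p(2) by (simp add: F_def)
  moreover have "fst (F acc x) = ?a" by (simp add: F_def)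
  ultimately show ?case
    using IH decode_addD[OF Cons.prems(2) wf, of tadd] by (simp add: algebra_simps)
qed

lemma in_n_lists_upt: "is \<in> set (List.n_lists m [0..<d]) \<longleftrightarrow> length is = m \<and> set is \<subseteq> {..<d}"
  by (auto simp: set_n_lists)

lemma norm1_encode_0: "norm1 (encode k 0) = 0" "fst (encode k 0) = 0" "decode k (encode k 0) = 0"
proof -
  show fst0: "fst (encode k 0) = 0" by (simp add: encode_def Let_def)
  show "norm1 (encode k 0) = 0" by (simp add: encode_def Let_def norm1_def o_def sum_list_triv)
  show "decode k (encode k 0) = 0" by (rule decode_encode) (simp add: laurent_in_def)
qed

lemma fits_encode_1: "fits k 0 (encode k 1)" "decode k (encode k 1) = 1"
proof -
  have one: "(1 :: laurent) = Poly_Mapping.single 0 1" by simp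
  have fst1: "fst (encode k 1) = 0"
    unfolding one by (simp add: encode_def Let_def del: single_one)
  have "length (snd (encode k 1)) = 1" using well_formed_encode[of k 1] fst1 by (simp add: well_formed_def)
  then have "\<bar>snd (encode k 1) ! 0\<bar> \<le> 1 \<and> snd (encode k 1) = [snd (encode k 1) ! 0]"
    by (subst encode_eq) (auto simp: fst1 one lookup_single when_def length_Suc_conv simp del: single_one)
  then have "norm1 (encode k 1) \<le> 1" unfolding norm1_def by (metis (no_types) list.map(2) sum_list_simps(2) list.map(1) sum_list.Nil add.right_neutral)
  then show "fits k 0 (encode k 1)" by (simp add: fits_def fst1 well_formed_encode)
  show "decode k (encode k 1) = 1" by (rule decode_encode) (simp add: laurent_in_def)
qed

lemma fst_fst_merge: "fst (fst (merge tadd tmul k d X ts)) = filter (\<lambda>e. e \<notin> set X) (concat (map fst ts))"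
  by (simp add: merge_def Let_def)

text \<open>One contraction of tensors whose entries fit the numbers \<open>bs\<close>. The new entries are sums of
  \<open>d ^ length X\<close> products that fit the sum of \<open>bs\<close>; since \<open>d < 2 ^ d\<close>, the summation costs at most \<open>d\<close> bits for
  each contracted edge, which is \<open>size_bound\<close>.\<close>

locale merging =
  fixes tadd tmul :: "int \<Rightarrow> int \<Rightarrow> nat" and k d :: nat and C :: real
    and X :: "'e list" and ts :: "'e tensor list" and bs :: "nat list"
  assumes bounds: "op_bound C tadd" "op_bound C tmul"
    and distinct: "distinct X"
    and ok: "list_all2 (tensor_ok d k) bs ts"
begin

definition "legs = map fst ts"
definition "free = filter (\<lambda>e. e \<notin> set X) (concat legs)"
definition "size_bound = sum_list bs + d * length X"
definition "address_cost = (length ts + length X + length (concat legs) + 1) * (nbits (int d) + 1)"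

definition product :: "nat list \<Rightarrow> nat list \<Rightarrow> dense timed" where
  "product ys xs = foldT (\<lambda>p (t, is). mulD tmul k p (entry d t is)) (encode k 1)
     (zip ts (fills (map_of (zip X xs)) legs ys))"

definition new_entry :: "nat list \<Rightarrow> dense timed" where
  "new_entry ys = foldT (\<lambda>acc xs. do {
       tick address_cost; p \<leftarrow> product ys xs; addD tadd k acc p
     }) (encode k 0) (List.n_lists (length X) [0..<d])"

lemma merge_eq: "merge tadd tmul k d X ts =
  do { es \<leftarrow> mapT new_entry (List.n_lists (length free) [0..<d]); ret (free, es) }"
  unfolding merge_def Let_def new_entry_def product_def address_cost_def legs_def free_def by simp

lemma product:
  assumes xs: "length xs = length X" "set xs \<subseteq> {..<d}"
    and ys: "length ys = length free" "set ys \<subseteq> {..<d}"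
  shows "fits k (sum_list bs) (fst (product ys xs))"
    and "decode k (fst (product ys xs))
      = (\<Prod>(t, is)\<leftarrow>zip ts (fills (map_of (zip X xs)) legs ys). decode k (entry d t is))"
    and "snd (product ys xs) \<le> length ts * op_cost k C (sum_list bs)"
proof -
  let ?s = "map_of (zip X xs)"
  let ?zs = "zip ts (fills ?s legs ys)"
  have none: "?s e = None \<longleftrightarrow> e \<notin> set X" for e using xs by (simp add: map_of_zip_is_None)
  have "list_all2 (\<lambda>es is. length is = length es \<and> set is \<subseteq> {..<d}) legs (fills ?s legs ys)"
  proof (rule fills_valid)
    show "length (filter (\<lambda>e. ?s e = None) (concat legs)) \<le> length ys"
      by (simp add: none ys free_def)
    show "i < d" if "?s e = Some i" for e i
      using that xs by (auto dest!: map_of_SomeD set_zip_rightD)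
  qed (rule ys)
  then have legs: "list_all2 (\<lambda>t is. length is = length (fst t) \<and> set is \<subseteq> {..<d}) ts (fills ?s legs ys)"
    by (simp add: legs_def list_all2_map1)
  then have len: "length (fills ?s legs ys) = length ts" by (auto dest: list_all2_lengthD)
  have zs: "list_all2 (\<lambda>b z. fits k b (case z of (t, is) \<Rightarrow> entry d t is)) bs ?zs"
    unfolding list_all2_conv_all_nth
  proof (intro conjI allI impI)
    show l: "length bs = length ?zs" using ok len by (simp add: list_all2_lengthD)
    fix i assume i: "i < length bs"
    then have "tensor_ok d k (bs ! i) (ts ! i)" using ok by (auto simp: list_all2_conv_all_nth)
    then show "fits k (bs ! i) (case ?zs ! i of (t, is) \<Rightarrow> entry d t is)"
      using legs i l len by (auto simp: list_all2_conv_all_nth intro!: entry_fits)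
  qed
  have p: "product ys xs = foldT (\<lambda>p z. mulD tmul k p (case z of (t, is) \<Rightarrow> entry d t is)) (encode k 1) ?zs"
    unfolding product_def by (rule arg_cong[where f = "\<lambda>f. foldT f _ _"]) (auto simp: fun_eq_iff)
  note fold = foldT_mulD[OF bounds(2) fits_encode_1(1) zs]
  show "fits k (sum_list bs) (fst (product ys xs))" using fold(1) by (simp add: p)
  show "decode k (fst (product ys xs)) = (\<Prod>(t, is)\<leftarrow>?zs. decode k (entry d t is))"
    using fold(2) by (simp add: p fits_encode_1 case_prod_unfold)
  show "snd (product ys xs) \<le> length ts * op_cost k C (sum_list bs)"
    using fold(3) len by (simp add: p)
qed

lemma new_entry:
  assumes ys: "length ys = length free" "set ys \<subseteq> {..<d}"
  shows "fits k size_bound (fst (new_entry ys))"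
    and "decode k (fst (new_entry ys)) = (\<Sum>xs\<leftarrow>List.n_lists (length X) [0..<d]. decode k (fst (product ys xs)))"
    and "snd (new_entry ys) \<le> d ^ length X * (address_cost + (length ts + 1) * op_cost k C size_bound)"
proof -
  let ?b = "sum_list bs"
  let ?N = "List.n_lists (length X) [0..<d]"
  have le: "?b \<le> size_bound" by (simp add: size_bound_def)
  have "d ^ length X \<le> (2 ^ d) ^ length X" by (intro power_mono) (auto intro: less_imp_le)
  then have "int (d ^ length X) \<le> int (2 ^ (d * length X))" by (simp only: power_mult of_nat_le_iff)
  then have count: "int (length ?N) \<le> 2 ^ (d * length X)" by (simp add: length_n_lists)
  have norm: "norm1 (encode k 0) + int (length ?N) * 2 ^ ?b \<le> 2 ^ size_bound"
    using mult_right_mono[OF count, of "2 ^ ?b"]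
    by (simp add: norm1_encode_0 size_bound_def power_add mult.commute)
  have "fits k ?b (fst (product ys xs)) \<and> snd (product ys xs) \<le> length ts * op_cost k C size_bound"
    if "xs \<in> set ?N" for xs
  proof -
    have "length xs = length X" "set xs \<subseteq> {..<d}" using that by (auto simp: set_n_lists)
    note product[OF this ys]
    moreover have "length ts * op_cost k C ?b \<le> length ts * op_cost k C size_bound"
      using le bounds by (intro mult_le_mono2 op_cost_mono) (auto simp: op_bound_def)
    ultimately show ?thesis by linarith
  qed
  then have "fits k size_bound (fst (new_entry ys)) \<and>
    decode k (fst (new_entry ys)) = decode k (encode k 0) + (\<Sum>xs\<leftarrow>?N. decode k (fst (product ys xs))) \<and>
    snd (new_entry ys) \<le> length ?N * (address_cost + length ts * op_cost k C size_bound + op_cost k C size_bound)"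
    unfolding new_entry_def
    by (intro foldT_addD[OF bounds(1) _ well_formed_encode _ le norm]) (auto simp: norm1_encode_0)
  then show "fits k size_bound (fst (new_entry ys))"
    and "decode k (fst (new_entry ys)) = (\<Sum>xs\<leftarrow>?N. decode k (fst (product ys xs)))"
    and "snd (new_entry ys) \<le> d ^ length X * (address_cost + (length ts + 1) * op_cost k C size_bound)"
    by (auto simp: norm1_encode_0 length_n_lists algebra_simps)
qed

lemma tensor_ok_merge: "tensor_ok d k size_bound (fst (merge tadd tmul k d X ts))"
  unfolding tensor_ok_def merge_eq
  by (auto simp: length_n_lists in_n_lists_upt intro!: new_entry)

lemma time_merge: "snd (merge tadd tmul k d X ts)
  \<le> d ^ (length free + length X) * (address_cost + (length ts + 1) * op_cost k C size_bound)"
proof -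
  have "snd (mapT new_entry (List.n_lists (length free) [0..<d]))
      \<le> length (List.n_lists (length free) [0..<d])
        * (d ^ length X * (address_cost + (length ts + 1) * op_cost k C size_bound))"
    by (rule snd_mapT_le, rule new_entry(3)) (simp_all add: in_n_lists_upt)
  then show ?thesis by (simp add: merge_eq length_n_lists power_add mult.assoc)
qed

lemma value_merge:
  assumes "\<And>e. \<sigma> e < d"
  shows "tensor_value d k (fst (merge tadd tmul k d X ts)) \<sigma>
    = sum_over d X (\<lambda>\<sigma>. \<Prod>t\<leftarrow>ts. tensor_value d k t \<sigma>) \<sigma>"
proof -
  let ?ys = "map \<sigma> free"
  let ?N = "List.n_lists (length X) [0..<d]"
  have ys: "length ?ys = length free" "set ?ys \<subseteq> {..<d}" using assms by auto
  have "tensor_value d k (fst (merge tadd tmul k d X ts)) \<sigma> = decode k (fst (new_entry ?ys))"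
    using entry_of_map[OF ys, of free "\<lambda>ys. fst (new_entry ys)"]
    by (simp add: tensor_value_def merge_eq)
  also have "\<dots> = (\<Sum>xs\<leftarrow>?N. decode k (fst (product ?ys xs)))" by (rule new_entry[OF ys])
  also have "\<dots> = (\<Sum>xs\<leftarrow>?N. \<Prod>t\<leftarrow>ts. tensor_value d k t (assign (map_of (zip X xs)) \<sigma>))"
  proof (intro arg_cong[where f = sum_list] map_cong refl)
    fix xs assume "xs \<in> set ?N"
    then have xs: "length xs = length X" "set xs \<subseteq> {..<d}" by (auto simp: set_n_lists)
    have none: "map_of (zip X xs) e = None \<longleftrightarrow> e \<notin> set X" for e
      using xs by (simp add: map_of_zip_is_None)
    have "fills (map_of (zip X xs)) legs ?ys = map (map (assign (map_of (zip X xs)) \<sigma>)) legs"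
      using fills_eq[where s = "map_of (zip X xs)" and \<tau> = \<sigma> and ess = legs] by (simp add: none free_def)
    then show "decode k (fst (product ?ys xs))
        = (\<Prod>t\<leftarrow>ts. tensor_value d k t (assign (map_of (zip X xs)) \<sigma>))"
      unfolding product(2)[OF xs ys]
      by (simp add: legs_def zip_map2 zip_same_conv_map o_def tensor_value_def)
  qed
  also have "\<dots> = sum_over d X (\<lambda>\<sigma>. \<Prod>t\<leftarrow>ts. tensor_value d k t \<sigma>) \<sigma>"
    by (rule sum_n_lists_eq_sum_over[OF distinct])
  finally show ?thesis .
qed

end

lemma fst_write_tensor: "fst (write_tensor d k legs f) = (legs, map f (List.n_lists (length legs) [0..<d]))"
  by (simp add: write_tensor_def)

lemma tensor_ok_write:
  assumes "\<And>is. length is = length legs \<Longrightarrow> set is \<subseteq> {..<d} \<Longrightarrow> fits k b (f is)"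
  shows "tensor_ok d k b (fst (write_tensor d k legs f))"
  using assms by (auto simp: tensor_ok_def fst_write_tensor length_n_lists in_n_lists_upt)

lemma value_write:
  assumes "\<And>e. \<sigma> e < d"
  shows "tensor_value d k (fst (write_tensor d k legs f)) \<sigma> = decode k (f (map \<sigma> legs))"
  using assms unfolding tensor_value_def fst_write_tensor
  by (subst entry_of_map) auto

lemma time_write:
  assumes "\<And>is. length is = length legs \<Longrightarrow> set is \<subseteq> {..<d} \<Longrightarrow> fits k b (f is)"
  shows "snd (write_tensor d k legs f)
    \<le> d ^ length legs * ((b + 2) * (2 * b + 1) ^ k + length legs * (nbits (int d) + 1))"
proof -
  have "dense_size (f is) \<le> (b + 2) * (2 * b + 1) ^ k"
    if "is \<in> set (List.n_lists (length legs) [0..<d])" for "is"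
    using that by (intro dense_size_le assms) (auto simp: set_n_lists)
  then have "snd (mapT (\<lambda>is. do { tick (dense_size (f is) + length legs * (nbits (int d) + 1)); ret (f is) })
       (List.n_lists (length legs) [0..<d]))
    \<le> length (List.n_lists (length legs) [0..<d])
      * ((b + 2) * (2 * b + 1) ^ k + length legs * (nbits (int d) + 1))"
    by (intro snd_mapT_le) simp
  then show ?thesis by (simp add: write_tensor_def length_n_lists)
qed

definition zero_on :: "'e set \<Rightarrow> ('e \<Rightarrow> nat) \<Rightarrow> 'e \<Rightarrow> nat" where
  "zero_on F \<sigma> = (\<lambda>e. if e \<in> F then 0 else \<sigma> e)"

lemma legs_close: "fst (fst (close_legs d k F t)) = filter (\<lambda>e. e \<notin> F) (fst t)"
  by (simp add: close_legs_def fst_write_tensor)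

lemma close_entry_fits:
  assumes "tensor_ok d k b t" "0 < d" "length ys = length (filter (\<lambda>e. e \<notin> F) (fst t))" "set ys \<subseteq> {..<d}"
  shows "fits k b (entry d t (fill (\<lambda>e. if e \<in> F then Some 0 else None) (fst t) ys))"
proof -
  let ?s = "\<lambda>e. if e \<in> F then Some (0::nat) else None"
  have "filter (\<lambda>e. ?s e = None) (fst t) = filter (\<lambda>e. e \<notin> F) (fst t)" by (rule filter_cong) auto
  then have "length (filter (\<lambda>e. ?s e = None) (fst t)) \<le> length ys" using assms(3) by simp
  moreover have "i < d" if "?s e = Some i" for e i using that assms(2) by (auto split: if_splits)
  ultimately have "length (fill ?s (fst t) ys) = length (fst t) \<and> set (fill ?s (fst t) ys) \<subseteq> {..<d}"
    using assms(4) by (intro fill_valid)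
  then show ?thesis using assms(1) by (intro entry_fits) auto
qed

lemma tensor_ok_close:
  assumes "tensor_ok d k b t" "0 < d"
  shows "tensor_ok d k b (fst (close_legs d k F t))"
  unfolding close_legs_def using assms by (intro tensor_ok_write close_entry_fits)

lemma value_close:
  assumes "\<And>e. \<sigma> e < d"
  shows "tensor_value d k (fst (close_legs d k F t)) \<sigma> = tensor_value d k t (zero_on F \<sigma>)"
proof -
  let ?s = "\<lambda>e. if e \<in> F then Some (0::nat) else None"
  have "filter (\<lambda>e. e \<notin> F) (fst t) = filter (\<lambda>e. ?s e = None) (fst t)" by (rule filter_cong) auto
  moreover have "assign ?s \<sigma> = zero_on F \<sigma>" by (auto simp: assign_def zero_on_def)
  ultimately have "fill ?s (fst t) (map \<sigma> (filter (\<lambda>e. e \<notin> F) (fst t))) = map (zero_on F \<sigma>) (fst t)"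
    using fill_append[of ?s "fst t" \<sigma> "[]"] by simp
  then show ?thesis unfolding close_legs_def using assms
    by (subst value_write) (auto simp: tensor_value_def)
qed

lemma time_close:
  assumes "tensor_ok d k b t" "0 < d"
  shows "snd (close_legs d k F t)
    \<le> d ^ length (fst t) * ((b + 2) * (2 * b + 1) ^ k + length (fst t) * (nbits (int d) + 1))"
proof -
  let ?l = "length (filter (\<lambda>e. e \<notin> F) (fst t))"
  have "snd (close_legs d k F t) \<le> d ^ ?l * ((b + 2) * (2 * b + 1) ^ k + ?l * (nbits (int d) + 1))"
    unfolding close_legs_def using assms by (intro time_write close_entry_fits)
  also have "\<dots> \<le> d ^ length (fst t) * ((b + 2) * (2 * b + 1) ^ k + length (fst t) * (nbits (int d) + 1))"
    using assms(2) by (intro mult_le_mono power_increasing add_le_mono) auto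
  finally show ?thesis .
qed


section \<open>Integer powers of the ribbon element\<close>

fun h_iter :: "rt_data \<Rightarrow> bool \<Rightarrow> nat \<Rightarrow> nat \<Rightarrow> nat \<Rightarrow> laurent" where
  "h_iter T s 0 i j = of_bool (i = j)"
| "h_iter T s (Suc n) i j = (\<Sum>a<dim T. hmat T s i a * h_iter T s n a j)"

text \<open>The matrix of the \<open>z\<close>-th power, in the convention in which rows index the source. Beyond the
  dimension its entries at \<open>1\<close> and \<open>- 1\<close> need not be those of the given matrices, whence the
  side conditions below.\<close>

definition hpow :: "rt_data \<Rightarrow> int \<Rightarrow> nat \<Rightarrow> nat \<Rightarrow> laurent" where
  "hpow T z = (if 0 \<le> z then h_iter T True (nat z) else h_iter T False (nat (- z)))"

lemma sum_of_bool_left: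
  fixes f :: "nat \<Rightarrow> 'r::comm_semiring_1"
  assumes "i < d"
  shows "(\<Sum>a<d. of_bool (i = a) * f a) = f i"
proof -
  have "(\<Sum>a<d. of_bool (i = a) * f a) = (\<Sum>a<d. if a = i then f a else 0)"
    by (rule sum.cong) auto
  then show ?thesis using assms by simp
qed

lemma sum_of_bool_right:
  fixes f :: "nat \<Rightarrow> 'r::comm_semiring_1"
  assumes "j < d"
  shows "(\<Sum>a<d. f a * of_bool (a = j)) = f j"
proof -
  have "(\<Sum>a<d. f a * of_bool (a = j)) = (\<Sum>a<d. if a = j then f a else 0)"
    by (rule sum.cong) auto
  then show ?thesis using assms by simp
qed

lemma hpow_0: "hpow T 0 i j = of_bool (i = j)"
  by (simp add: hpow_def)

lemma hpow_1: "j < dim T \<Longrightarrow> hpow T 1 i j = hmat T True i j"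
  by (simp add: hpow_def sum_of_bool_right)

lemma hpow_minus_1: "j < dim T \<Longrightarrow> hpow T (- 1) i j = hmat T False i j"
  by (simp add: hpow_def sum_of_bool_right)

lemma rt_system_inverse:
  assumes "rt_system T" "i < dim T" "j < dim T"
  shows "(\<Sum>a<dim T. hmat T s i a * hmat T (\<not> s) a j) = of_bool (i = j)"
proof -
  have "\<forall>s. \<forall>i<dim T. \<forall>j<dim T. (\<Sum>a<dim T. hmat T s i a * hmat T (\<not> s) a j) = of_bool (i = j)"
    using assms(1) unfolding rt_system_def Let_def by (elim conjE)
  then show ?thesis using assms(2,3) by simp
qed

lemma rt_system_dim_pos: "rt_system T \<Longrightarrow> 0 < dim T"
  by (simp add: rt_system_def Let_def)

lemma h_iter_cancel:
  assumes "rt_system T" "i < dim T"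
  shows "(\<Sum>a<dim T. hmat T s i a * h_iter T (\<not> s) (Suc n) a j) = h_iter T (\<not> s) n i j"
proof -
  have "(\<Sum>a<dim T. hmat T s i a * h_iter T (\<not> s) (Suc n) a j)
      = (\<Sum>a<dim T. \<Sum>b<dim T. hmat T s i a * hmat T (\<not> s) a b * h_iter T (\<not> s) n b j)"
    by (simp add: sum_distrib_left mult.assoc)
  also have "\<dots> = (\<Sum>b<dim T. (\<Sum>a<dim T. hmat T s i a * hmat T (\<not> s) a b) * h_iter T (\<not> s) n b j)"
    by (subst sum.swap) (simp add: sum_distrib_right)
  also have "\<dots> = (\<Sum>b<dim T. of_bool (i = b) * h_iter T (\<not> s) n b j)"
    using assms by (intro sum.cong refl) (simp add: rt_system_inverse)
  finally show ?thesis using assms by (simp add: sum_of_bool_left)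
qed

text \<open>Only a single extremum has to be added to a power; it turns by at most one.\<close>

lemma hpow_add:
  assumes "rt_system T" "r \<in> {- 1, 0, 1}" "i < dim T"
  shows "(\<Sum>a<dim T. hpow T r i a * hpow T z a j) = hpow T (r + z) i j"
proof -
  consider "r = 0" | "r = 1" "0 \<le> z" | "r = 1" "z < 0" | "r = - 1" "z \<le> 0" | "r = - 1" "0 < z"
    using assms(2) by force
  then show ?thesis
  proof cases
    case 1
    then show ?thesis using assms(3) by (simp add: hpow_0 sum_of_bool_left)
  next
    case 2
    then have "nat (1 + z) = Suc (nat z)" by simp
    then show ?thesis using 2 by (simp add: hpow_1 hpow_def[of T z] hpow_def[of T "1 + z"])
  next
    case 3
    then obtain n where "nat (- z) = Suc n" by (cases "nat (- z)") auto
    then have n: "nat (- z) = Suc n" "nat (- (1 + z)) = n" using 3 by auto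
    have "hpow T z = h_iter T False (Suc n)" using 3 n by (simp add: hpow_def)
    moreover have "hpow T (1 + z) i j = h_iter T False n i j"
      using 3 n by (cases "z = - 1") (auto simp: hpow_def)
    ultimately show ?thesis
      using h_iter_cancel[OF assms(1,3), of True n j] 3 by (simp add: hpow_1 del: h_iter.simps)
  next
    case 4
    then have "nat (- (- 1 + z)) = Suc (nat (- z))" by simp
    moreover have "hpow T z = h_iter T False (nat (- z))" using 4 by (cases "z = 0") (auto simp: hpow_def fun_eq_iff)
    ultimately show ?thesis using 4 by (simp add: hpow_minus_1 hpow_def[of T "z - 1"])
  next
    case 5
    then obtain n where "nat z = Suc n" by (cases "nat z") auto
    then have n: "nat z = Suc n" "nat (- 1 + z) = n" using 5 by auto
    then show ?thesis
      using h_iter_cancel[OF assms(1,3), of False n j] 5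
      by (simp add: hpow_minus_1 hpow_def[of T z] hpow_def[of T "z - 1"] del: h_iter.simps)
  qed
qed


section \<open>State sum of a long diagram\<close>

text \<open>The pieces that start at a slice when the diagram is read upward. At a cup both pieces start,
  although one of them is traversed downward.\<close>

fun births :: "slice list \<Rightarrow> nat list" where
  "births [] = []"
| "births (Cross p s a b # L) = Suc b # Suc a # births L"
| "births (Cup p right a # L) = (if right then [a, Suc a] else [Suc a, a]) @ births L"
| "births (Cap p right a # L) = births L"

definition turning :: "slice \<Rightarrow> int" where
  "turning s = (case s of Cup p right a \<Rightarrow> of_bool right | Cap p right a \<Rightarrow> - of_bool right | Cross p s a b \<Rightarrow> 0)"

text \<open>A left-pointing extremum carries the identity, which is the power \<open>0\<close>.\<close>

fun weight :: "rt_data \<Rightarrow> slice \<Rightarrow> (nat \<Rightarrow> nat) \<Rightarrow> laurent" where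
  "weight T (Cross p s a b) \<sigma> = rmat T s (\<sigma> a) (\<sigma> b) (\<sigma> (Suc b)) (\<sigma> (Suc a))"
| "weight T (Cup p right a) \<sigma> = hpow T (turning (Cup p right a)) (\<sigma> a) (\<sigma> (Suc a))"
| "weight T (Cap p right a) \<sigma> = hpow T (turning (Cap p right a)) (\<sigma> a) (\<sigma> (Suc a))"

lemma finite_indices: "finite (indices d m)"
  unfolding indices_def by (rule finite_subset[OF _ finite_lists_length_eq[of "{..<d}" m]]) auto

text \<open>A cup and a crossing determine all indices above them except those of two adjacent strands.\<close>

lemma sum_indices_insert_two:
  assumes "length xs = p" "set xs \<subseteq> {..<d}" "set ys \<subseteq> {..<d}"
  shows "(\<Sum>zs\<in>indices d (p + length ys + 2).
      (if take p zs = xs \<and> drop (p + 2) zs = ys then f zs else 0))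
    = (\<Sum>i<d. \<Sum>j<d. f (xs @ [i, j] @ ys))"
proof -
  let ?I = "indices d (p + length ys + 2)"
  have fin: "finite ?I" by (rule finite_indices)
  have "(\<Sum>zs\<in>?I. (if take p zs = xs \<and> drop (p + 2) zs = ys then f zs else 0))
      = (\<Sum>zs\<in>{zs \<in> ?I. take p zs = xs \<and> drop (p + 2) zs = ys}. f zs)"
    by (rule sum.inter_filter[OF fin, symmetric])
  also have "{zs \<in> ?I. take p zs = xs \<and> drop (p + 2) zs = ys}
      = (\<lambda>(i, j). xs @ [i, j] @ ys) ` ({..<d} \<times> {..<d})"
  proof (intro equalityI subsetI)
    fix zs assume "zs \<in> {zs \<in> ?I. take p zs = xs \<and> drop (p + 2) zs = ys}"
    then have z: "zs \<in> ?I" "take p zs = xs" "drop (Suc (Suc p)) zs = ys" by auto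
    then have l: "Suc p < length zs" using assms(1) by (auto simp: indices_def)
    then have "drop p zs = zs ! p # zs ! Suc p # drop (Suc (Suc p)) zs"
      by (simp add: Cons_nth_drop_Suc)
    then have "zs = xs @ [zs ! p, zs ! Suc p] @ ys"
      using append_take_drop_id[of p zs] z by simp
    moreover have "zs ! p \<in> set zs" "zs ! Suc p \<in> set zs" using l by simp_all
    moreover have "set zs \<subseteq> {..<d}" using z(1) by (simp add: indices_def)
    moreover from calculation have "zs ! p < d" "zs ! Suc p < d" by blast+
    ultimately show "zs \<in> (\<lambda>(i, j). xs @ [i, j] @ ys) ` ({..<d} \<times> {..<d})"
      by (intro image_eqI[of _ _ "(zs ! p, zs ! Suc p)"]) auto
  qed (use assms in \<open>auto simp: indices_def\<close>)
  also have "sum f \<dots> = (\<Sum>(i, j)\<in>{..<d} \<times> {..<d}. f (xs @ [i, j] @ ys))"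
    by (subst sum.reindex) (auto simp: inj_on_def case_prod_unfold intro!: sum.cong)
  finally show ?thesis by (simp add: sum.cartesian_product)
qed

lemma sum_indices_fixed:
  assumes "length xs = p" "set xs \<subseteq> {..<d}" "set ys \<subseteq> {..<d}"
  shows "(\<Sum>zs\<in>indices d (p + length ys). (if take p zs = xs \<and> drop p zs = ys then f zs else 0))
    = f (xs @ ys)"
proof -
  let ?I = "indices d (p + length ys)"
  have fin: "finite ?I" by (rule finite_indices)
  have eq: "take p zs = xs \<and> drop p zs = ys \<longleftrightarrow> zs = xs @ ys" if "zs \<in> ?I" for zs
    using assms(1) by (metis append_eq_conv_conj append_take_drop_id)
  have "(\<Sum>zs\<in>?I. (if take p zs = xs \<and> drop p zs = ys then f zs else 0))
      = (\<Sum>zs\<in>?I. if zs = xs @ ys then f zs else 0)"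
    by (intro sum.cong refl if_cong eq)
  then show ?thesis using assms fin by (simp add: indices_def)
qed

lemma rt_operator_Cross:
  assumes "length xs = p" "set xs \<subseteq> {..<dim T}" "set ys \<subseteq> {..<dim T}"
  shows "rt_operator T (Cross p s a b # L) (xs @ [i, j] @ ys) zs
    = (\<Sum>k<dim T. \<Sum>l<dim T. rmat T s i j k l * rt_operator T L (xs @ [k, l] @ ys) zs)"
proof -
  let ?f = "\<lambda>us. rmat T s i j (us ! p) (us ! Suc p) * rt_operator T L us zs"
  have "rt_operator T (Cross p s a b # L) (xs @ [i, j] @ ys) zs
     = (\<Sum>us\<in>indices (dim T) (p + length ys + 2).
          (if take p us = xs \<and> drop (p + 2) us = ys then ?f us else 0))"
    using assms(1) by (auto simp: nth_append intro!: sum.cong)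
  then show ?thesis
    using sum_indices_insert_two[OF assms, of ?f] assms(1) by (simp add: nth_append)
qed

lemma rt_operator_Cup:
  assumes "length xs = p" "set xs \<subseteq> {..<dim T}" "set ys \<subseteq> {..<dim T}"
  shows "rt_operator T (Cup p right a # L) (xs @ ys) zs
    = (\<Sum>k<dim T. \<Sum>l<dim T. hpow T (of_bool right) k l * rt_operator T L (xs @ [k, l] @ ys) zs)"
proof -
  let ?f = "\<lambda>us. (if right then hmat T True (us ! p) (us ! Suc p) else of_bool (us ! p = us ! Suc p))
    * rt_operator T L us zs"
  have "rt_operator T (Cup p right a # L) (xs @ ys) zs
     = (\<Sum>us\<in>indices (dim T) (p + length ys + 2).
          (if take p us = xs \<and> drop (p + 2) us = ys then ?f us else 0))"
    using assms(1) by (auto intro!: sum.cong)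
  then show ?thesis
    using sum_indices_insert_two[OF assms, of ?f] assms(1)
    by (cases right) (simp_all add: nth_append hpow_0 hpow_1)
qed

lemma rt_operator_Cap:
  assumes "length xs = p" "set xs \<subseteq> {..<dim T}" "set ys \<subseteq> {..<dim T}" "j < dim T"
  shows "rt_operator T (Cap p right a # L) (xs @ [i, j] @ ys) zs
    = hpow T (- of_bool right) i j * rt_operator T L (xs @ ys) zs"
proof -
  have h: "hpow T (- of_bool right) i j = (if right then hmat T False i j else of_bool (i = j))"
    using assms(4) by (simp add: hpow_0 hpow_minus_1)
  let ?f = "\<lambda>us. hpow T (- of_bool right) i j * rt_operator T L us zs"
  have "rt_operator T (Cap p right a # L) (xs @ [i, j] @ ys) zs
     = (\<Sum>us\<in>indices (dim T) (p + length ys).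
          (if take p us = xs \<and> drop p us = ys then ?f us else 0))"
  proof -
    let ?us = "xs @ [i, j] @ ys"
    have "take p ?us = xs" "drop (p + 2) ?us = ys" "?us ! p = i" "?us ! (p + 1) = j"
      "slice_width (Cap p right a) (length ?us) = p + length ys"
      using assms(1) by (simp_all add: nth_append)
    then show ?thesis
      unfolding rt_operator.simps slice_entry.simps h
      by (intro sum.cong) (auto simp only: if_distrib if_True if_False mult_zero_left split: if_split)
  qed
  then show ?thesis using sum_indices_fixed[OF assms(1-3), of ?f] by simp
qed

lemma hpow_0_commute: "hpow T 0 i j = hpow T 0 j i"
  by (auto simp: hpow_0)

text \<open>The step of the induction at a slice where the pieces \<open>x\<close> and \<open>y\<close> start: the indices of the
  two new strands become the values of the assignment at \<open>x\<close> and \<open>y\<close>. The weight of the slice may be moved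
  into the sum over the later pieces, as it does not involve them.\<close>

lemma state_sum_births:
  fixes W R :: "(nat \<Rightarrow> nat) \<Rightarrow> laurent"
  assumes IH: "\<And>i j. i < dim T \<Longrightarrow> j < dim T \<Longrightarrow>
      rt_operator T L (map (\<sigma>(x := i, y := j) \<circ> fst) (xs @ [(x, u), (y, v)] @ ys)) zs
      = sum_over (dim T) (births L) R (\<sigma>(x := i, y := j))"
    and new: "x \<noteq> y" "{x, y} \<inter> fst ` (set xs \<union> set ys) = {}"
    and W: "\<And>z. z \<in> set (births L) \<Longrightarrow> ignores W z"
      "\<And>i j. j < dim T \<Longrightarrow> W (\<sigma>(x := i, y := j)) = F i j"
  shows "(\<Sum>i<dim T. \<Sum>j<dim T. F i j * rt_operator T L (map (\<sigma> \<circ> fst) xs @ [i, j] @ map (\<sigma> \<circ> fst) ys) zs)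
    = sum_over (dim T) (x # y # births L) (\<lambda>\<sigma>. W \<sigma> * R \<sigma>) \<sigma>"
  unfolding sum_over.simps
proof (intro sum.cong refl)
  fix i j assume ij: "i \<in> {..<dim T}" "j \<in> {..<dim T}"
  have level: "map (\<sigma>(x := i, y := j) \<circ> fst) (xs @ [(x, u), (y, v)] @ ys)
      = map (\<sigma> \<circ> fst) xs @ [i, j] @ map (\<sigma> \<circ> fst) ys"
    using new by (auto simp: image_iff)
  show "F i j * rt_operator T L (map (\<sigma> \<circ> fst) xs @ [i, j] @ map (\<sigma> \<circ> fst) ys) zs
      = sum_over (dim T) (births L) (\<lambda>\<sigma>. W \<sigma> * R \<sigma>) (\<sigma>(x := i, y := j))"
    using IH[of i j] W(2)[of j i] ij unfolding level by (simp add: sum_over_mult_left[OF W(1)])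
qed

text \<open>Every level carries the values of one assignment of indices to pieces. Distinctness says that no
  piece starts twice; it guarantees that the values chosen for a piece are never overwritten.\<close>

lemma morse_state_sum:
  assumes "morse f L g" "distinct (map fst f @ births L)" "\<And>x. \<sigma> x < dim T"
  shows "rt_operator T L (map (\<sigma> \<circ> fst) f) zs = sum_over (dim T) (births L)
    (\<lambda>\<sigma>. (\<Prod>s\<leftarrow>L. weight T s \<sigma>) * of_bool (map (\<sigma> \<circ> fst) g = zs)) \<sigma>"
  using assms
proof (induction arbitrary: \<sigma> rule: morse.induct)
  case (morse_Nil f)
  then show ?case by simp
next
  case (morse_Cross xs b a ys L f p s)
  let ?R = "\<lambda>\<sigma>. (\<Prod>s\<leftarrow>L. weight T s \<sigma>) * of_bool (map (\<sigma> \<circ> fst) f = zs)"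
  have "rt_operator T (Cross p s a b # L) (map (\<sigma> \<circ> fst) (xs @ [(a, True), (b, True)] @ ys)) zs
      = (\<Sum>i<dim T. \<Sum>j<dim T. rmat T s (\<sigma> a) (\<sigma> b) i j
          * rt_operator T L (map (\<sigma> \<circ> fst) xs @ [i, j] @ map (\<sigma> \<circ> fst) ys) zs)"
    using rt_operator_Cross[of "map (\<sigma> \<circ> fst) xs" p T "map (\<sigma> \<circ> fst) ys" s a b L "\<sigma> a" "\<sigma> b" zs]
      morse_Cross by (auto simp: image_subset_iff)
  also have "\<dots> = sum_over (dim T) (Suc b # Suc a # births L)
      (\<lambda>\<sigma>. weight T (Cross p s a b) \<sigma> * ?R \<sigma>) \<sigma>"
    by (rule state_sum_births, rule morse_Cross.IH)
      (use morse_Cross.prems in \<open>auto simp: ignores_def\<close>)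
  finally show ?case by (simp only: births.simps prod_list.Cons list.map mult.assoc)
next
  case (morse_Cup_right xs a ys L f p)
  let ?R = "\<lambda>\<sigma>. (\<Prod>s\<leftarrow>L. weight T s \<sigma>) * of_bool (map (\<sigma> \<circ> fst) f = zs)"
  have "rt_operator T (Cup p True a # L) (map (\<sigma> \<circ> fst) (xs @ ys)) zs
      = (\<Sum>i<dim T. \<Sum>j<dim T. hpow T 1 i j
          * rt_operator T L (map (\<sigma> \<circ> fst) xs @ [i, j] @ map (\<sigma> \<circ> fst) ys) zs)"
    using rt_operator_Cup[of "map (\<sigma> \<circ> fst) xs" p T "map (\<sigma> \<circ> fst) ys" True a L zs]
      morse_Cup_right by (auto simp: image_subset_iff)
  also have "\<dots> = sum_over (dim T) (a # Suc a # births L)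
      (\<lambda>\<sigma>. weight T (Cup p True a) \<sigma> * ?R \<sigma>) \<sigma>"
    by (rule state_sum_births, rule morse_Cup_right.IH)
      (use morse_Cup_right.prems in \<open>auto simp: turning_def ignores_def\<close>)
  finally show ?case
    by (simp only: births.simps if_True if_False append_Cons append_Nil prod_list.Cons list.map mult.assoc)
next
  case (morse_Cup_left xs a ys L f p)
  let ?R = "\<lambda>\<sigma>. (\<Prod>s\<leftarrow>L. weight T s \<sigma>) * of_bool (map (\<sigma> \<circ> fst) f = zs)"
  have "rt_operator T (Cup p False a # L) (map (\<sigma> \<circ> fst) (xs @ ys)) zs
      = (\<Sum>i<dim T. \<Sum>j<dim T. hpow T 0 i j
          * rt_operator T L (map (\<sigma> \<circ> fst) xs @ [i, j] @ map (\<sigma> \<circ> fst) ys) zs)"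
    using rt_operator_Cup[of "map (\<sigma> \<circ> fst) xs" p T "map (\<sigma> \<circ> fst) ys" False a L zs]
      morse_Cup_left by (auto simp: image_subset_iff)
  also have "\<dots> = sum_over (dim T) (Suc a # a # births L)
      (\<lambda>\<sigma>. weight T (Cup p False a) \<sigma> * ?R \<sigma>) \<sigma>"
    by (rule state_sum_births, rule morse_Cup_left.IH)
      (use morse_Cup_left.prems in \<open>auto simp: turning_def hpow_0_commute ignores_def\<close>)
  finally show ?case
    by (simp only: births.simps if_True if_False append_Cons append_Nil prod_list.Cons list.map mult.assoc)
next
  case (morse_Cap_right xs ys L f p a)
  let ?R = "\<lambda>\<sigma>. (\<Prod>s\<leftarrow>L. weight T s \<sigma>) * of_bool (map (\<sigma> \<circ> fst) f = zs)"
  have later: "\<And>x. x \<in> set (births L) \<Longrightarrow> x \<notin> {a, Suc a}"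
    using morse_Cap_right.prems(1) by auto
  have "rt_operator T (Cap p True a # L) (map (\<sigma> \<circ> fst) (xs @ [(a, True), (Suc a, False)] @ ys)) zs
      = weight T (Cap p True a) \<sigma> * rt_operator T L (map (\<sigma> \<circ> fst) (xs @ ys)) zs"
    using rt_operator_Cap[of "map (\<sigma> \<circ> fst) xs" p T "map (\<sigma> \<circ> fst) ys" "\<sigma> (Suc a)" True a L "\<sigma> a" zs]
      morse_Cap_right by (auto simp: image_subset_iff turning_def)
  also have "\<dots> = weight T (Cap p True a) \<sigma> * sum_over (dim T) (births L) ?R \<sigma>"
    by (subst morse_Cap_right.IH) (use morse_Cap_right.prems in auto)
  also have "\<dots> = sum_over (dim T) (births (Cap p True a # L)) (\<lambda>\<sigma>. weight T (Cap p True a) \<sigma> * ?R \<sigma>) \<sigma>"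
    unfolding births.simps
    by (rule sum_over_mult_left[symmetric]) (use later in \<open>auto simp: ignores_def\<close>)
  finally show ?case by (simp only: prod_list.Cons list.map mult.assoc)
next
  case (morse_Cap_left xs ys L f p a)
  let ?R = "\<lambda>\<sigma>. (\<Prod>s\<leftarrow>L. weight T s \<sigma>) * of_bool (map (\<sigma> \<circ> fst) f = zs)"
  have later: "\<And>x. x \<in> set (births L) \<Longrightarrow> x \<notin> {a, Suc a}"
    using morse_Cap_left.prems(1) by auto
  have "rt_operator T (Cap p False a # L) (map (\<sigma> \<circ> fst) (xs @ [(Suc a, False), (a, True)] @ ys)) zs
      = weight T (Cap p False a) \<sigma> * rt_operator T L (map (\<sigma> \<circ> fst) (xs @ ys)) zs"
    using rt_operator_Cap[of "map (\<sigma> \<circ> fst) xs" p T "map (\<sigma> \<circ> fst) ys" "\<sigma> a" False a L "\<sigma> (Suc a)" zs]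
      morse_Cap_left by (auto simp: image_subset_iff turning_def hpow_0_commute[of T "\<sigma> a"])
  also have "\<dots> = weight T (Cap p False a) \<sigma> * sum_over (dim T) (births L) ?R \<sigma>"
    by (subst morse_Cap_left.IH) (use morse_Cap_left.prems in auto)
  also have "\<dots> = sum_over (dim T) (births (Cap p False a # L)) (\<lambda>\<sigma>. weight T (Cap p False a) \<sigma> * ?R \<sigma>) \<sigma>"
    unfolding births.simps
    by (rule sum_over_mult_left[symmetric]) (use later in \<open>auto simp: ignores_def\<close>)
  finally show ?case by (simp only: prod_list.Cons list.map mult.assoc)
qed


section \<open>Numbering of the pieces\<close>

fun cross_times :: "slice list \<Rightarrow> nat multiset" where
  "cross_times [] = {#}"
| "cross_times (Cross p s a b # L) = {#a, b#} + cross_times L"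
| "cross_times (_ # L) = cross_times L"

fun cup_times :: "slice list \<Rightarrow> nat multiset" where
  "cup_times [] = {#}"
| "cup_times (Cup p right a # L) = {#a#} + cup_times L"
| "cup_times (_ # L) = cup_times L"

fun cap_times :: "slice list \<Rightarrow> nat multiset" where
  "cap_times [] = {#}"
| "cap_times (Cap p right a # L) = {#a#} + cap_times L"
| "cap_times (_ # L) = cap_times L"

definition rising :: "level \<Rightarrow> nat multiset" where
  "rising f = mset (map fst (filter snd f))"

definition falling :: "level \<Rightarrow> nat multiset" where
  "falling f = mset (map fst (filter (\<lambda>x. \<not> snd x) f))"

text \<open>A strand that is present or starts must end or remain present. Rising and falling pieces are
  counted separately: the rising piece \<open>Suc a\<close> starts where the passage from \<open>a\<close> is at a crossing or a
  cup, whereas the falling piece \<open>a\<close> starts where this passage is at a cup.\<close>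

lemma morse_balance:
  assumes "morse f L g"
  shows "rising f + image_mset Suc (cross_times L + cup_times L) = cross_times L + cap_times L + rising g"
    and "falling f + cup_times L = image_mset Suc (cap_times L) + falling g"
  using assms
  by (induction rule: morse.induct) (auto simp: rising_def falling_def ac_simps)

lemma count_image_mset_Suc: "count (image_mset Suc M) (Suc x) = count M x"
  by (induction M) auto

text \<open>Comparing multiplicities of \<open>0, 1, 2, \<dots>\<close> in turn, each number below \<open>m\<close> occurs as often as its
  predecessor, hence once, and the numbers from \<open>m\<close> on do not occur.\<close>

lemma successor_chain:
  assumes "{#0#} + image_mset Suc M = M + {#m#}"
  shows "M = mset [0..<m]"
proof (rule multiset_eqI)
  have "count (image_mset Suc M) 0 = 0" by (auto simp: count_eq_zero_iff)
  then have zero: "count M 0 + (if m = 0 then 1 else 0) = 1"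
    using arg_cong[OF assms, of "\<lambda>M. count M 0"] by (auto split: if_splits)
  have step: "count M (Suc x) + (if m = Suc x then 1 else 0) = count M x" for x
    using arg_cong[OF assms, of "\<lambda>M. count M (Suc x)"] by (auto simp: count_image_mset_Suc)
  fix x
  have "count M x = (if x < m then 1 else 0)"
  proof (induction x)
    case 0
    then show ?case using zero by (auto split: if_splits)
  next
    case (Suc x)
    then show ?case using step[of x] by (auto split: if_splits)
  qed
  also have "\<dots> = count (mset [0..<m]) x"
    by (simp add: count_mset_set')
  finally show "count M x = count (mset [0..<m]) x" .
qed

lemma mset_births: "mset (births L) = image_mset Suc (cross_times L + cup_times L) + cup_times L"
  by (induction L rule: births.induct) auto

text \<open>Adding the two balances gives the equation of a chain from \<open>0\<close> to \<open>m\<close>. This excludes closed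
  components and shows that every piece starts once.\<close>

lemma long_times:
  assumes "morse [(0, True)] L [(m, True)]"
  shows "cross_times L + cup_times L + cap_times L = mset [0..<m]"
    and "{#0#} + mset (births L) = mset [0..<Suc m]"
proof -
  have up: "{#0#} + image_mset Suc (cross_times L + cup_times L) = cross_times L + cap_times L + {#m#}"
    and down: "cup_times L = image_mset Suc (cap_times L)"
    using morse_balance[OF assms] by (simp_all add: rising_def falling_def)
  let ?M = "cross_times L + cup_times L + cap_times L"
  have "{#0#} + image_mset Suc ?M = {#0#} + image_mset Suc (cross_times L + cup_times L) + cup_times L"
    by (simp add: down)
  also have "\<dots> = ?M + {#m#}" unfolding up by simp
  finally show M: "?M = mset [0..<m]" by (rule successor_chain)
  have "{#0#} + mset (births L) = ?M + {#m#}" unfolding mset_births using up by simp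
  then show "{#0#} + mset (births L) = mset [0..<Suc m]" unfolding M by simp
qed

lemma set_cross_times: "set_mset (cross_times L) = crossing_times L"
  by (induction L rule: crossing_times.induct) auto

lemma size_cross_times:
  "size (cross_times L) = 2 * length (filter (\<lambda>s. case s of Cross p e a b \<Rightarrow> True | _ \<Rightarrow> False) L)"
  by (induction L rule: crossing_times.induct) auto

lemma crossing_times_long:
  assumes "morse [(0, True)] L [(m, True)]"
  shows "cross_times L = mset_set (crossing_times L)"
    and "card (crossing_times L) = 2 * length (filter (\<lambda>s. case s of Cross p e a b \<Rightarrow> True | _ \<Rightarrow> False) L)"
    and "crossing_times L \<subseteq> {..<m}"
proof -
  have "mset [0..<m] = mset_set {0..<m}" by simp
  then have c: "count (mset [0..<m]) x \<le> 1" for x by (simp add: count_mset_set')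
  have fin: "finite (crossing_times L)" by (simp flip: set_cross_times)
  have "count (cross_times L) x = count (mset_set (crossing_times L)) x" for x
  proof -
    have "count (cross_times L) x \<le> 1"
      using c[of x] unfolding long_times(1)[OF assms, symmetric] by simp
    moreover have "x \<in> crossing_times L \<longleftrightarrow> 0 < count (cross_times L) x"
      by (simp flip: set_cross_times)
    ultimately have "count (cross_times L) x = (if x \<in> crossing_times L then 1 else 0)"
      by (simp del: count_greater_zero_iff)
    then show ?thesis using fin by (simp add: count_mset_set')
  qed
  then show eq: "cross_times L = mset_set (crossing_times L)" by (rule multiset_eqI)
  show "card (crossing_times L) = 2 * length (filter (\<lambda>s. case s of Cross p e a b \<Rightarrow> True | _ \<Rightarrow> False) L)"
    unfolding size_cross_times[symmetric] eq by simp
  have "set_mset (cross_times L) \<subseteq> set_mset (mset [0..<m])"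
    unfolding long_times(1)[OF assms, symmetric] by auto
  then show "crossing_times L \<subseteq> {..<m}" by (auto simp: set_cross_times)
qed


section \<open>Collapsing the extrema along an arc\<close>

text \<open>The knot as a sequence of pieces \<open>0, \<dots>, m\<close>: the passage from piece \<open>t\<close> to the next one is a crossing if
  \<open>t \<in> CT\<close> and an extremum with matrix \<open>h\<close> to the power \<open>r t\<close> otherwise. Arcs are the maximal runs of pieces
  between crossings.\<close>

locale timeline =
  fixes T :: rt_data and m :: nat and CT :: "nat set" and r :: "nat \<Rightarrow> int"
  assumes rt: "rt_system T" and CT: "CT \<subseteq> {..<m}" and r: "\<And>t. t \<notin> CT \<Longrightarrow> t < m \<Longrightarrow> r t \<in> {- 1, 0, 1}"
begin

abbreviation "d \<equiv> dim T"

definition "l = card CT"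
definition arc :: "nat \<Rightarrow> nat" where "arc t = card {u \<in> CT. u < t}"

text \<open>The last piece of an arc. Beyond the last arc the values continue past \<open>m\<close>, so that no two arcs
  end at the same piece.\<close>

definition "arc_end j = (if j < l then inv_into CT arc j else m + (j - l))"
definition "arc_start j = (case j of 0 \<Rightarrow> 0 | Suc i \<Rightarrow> Suc (arc_end i))"
definition "rotation j = (\<Sum>t\<in>{t \<in> {..<m} - CT. arc t = j}. r t)"

text \<open>The turning of the current arc that is still to come at time \<open>t\<close>.\<close>

definition "rest t = (\<Sum>u\<in>{u \<in> {t..<m} - CT. arc u = arc t}. r u)"
definition at_arcs :: "(nat \<Rightarrow> nat) \<Rightarrow> nat \<times> bool \<Rightarrow> nat" where
  "at_arcs \<sigma> = (\<lambda>(j, b). \<sigma> (if b then arc_end j else arc_start j))"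
definition "later j = concat (map (\<lambda>i. [(i, False), (i, True)]) [Suc j..<Suc l])"

lemma finite_CT: "finite CT" using CT finite_subset by blast

lemma arc_mono: "t \<le> u \<Longrightarrow> arc t \<le> arc u"
  unfolding arc_def using finite_CT by (intro card_mono) auto

lemma arc_Suc: "arc (Suc t) = arc t + (if t \<in> CT then 1 else 0)"
proof -
  have "{u \<in> CT. u < Suc t} = {u \<in> CT. u < t} \<union> (if t \<in> CT then {t} else {})"
    by (auto simp: less_Suc_eq)
  then show ?thesis using finite_CT by (auto simp: arc_def)
qed

lemma arc_0: "arc 0 = 0" by (simp add: arc_def)

lemma arc_m: "arc m = l"
proof -
  have "{u \<in> CT. u < m} = CT" using CT by auto
  then show ?thesis by (simp add: arc_def l_def)
qed

lemma arc_less: "t \<in> CT \<Longrightarrow> u > t \<Longrightarrow> arc t < arc u"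
  using arc_Suc[of t] arc_mono[of "Suc t" u] by simp

lemma bij_arc: "bij_betw arc CT {..<l}"
proof -
  have inj: "inj_on arc CT"
    by (rule inj_onI) (metis arc_less linorder_neqE_nat less_irrefl)
  moreover have "arc ` CT \<subseteq> {..<l}"
    using CT arc_less[of _ m] by (auto simp: arc_m)
  ultimately have "arc ` CT = {..<l}"
    by (intro card_subset_eq) (auto simp: card_image l_def)
  with inj show ?thesis by (simp add: bij_betw_def)
qed

lemma arc_end_arc: "t \<in> CT \<Longrightarrow> arc_end (arc t) = t"
  using bij_arc by (auto simp: arc_end_def bij_betw_def inv_into_f_f)

lemma arc_end_l: "arc_end l = m" by (simp add: arc_end_def)

lemma arc_end_in: "j < l \<Longrightarrow> arc_end j \<in> CT \<and> arc (arc_end j) = j"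
  using bij_arc by (auto simp: arc_end_def bij_betw_def inv_into_into f_inv_into_f)

lemma arc_end_eqD: "arc_end j = t \<Longrightarrow> t \<le> m \<Longrightarrow> j = arc t"
  using arc_end_in[of j] arc_m by (cases j l rule: linorder_cases) (auto simp: arc_end_def)

lemma arc_start_SucD:
  assumes "arc_start j = Suc t" "t < m"
  shows "t \<in> CT \<and> j = Suc (arc t)"
proof (cases j)
  case (Suc i)
  then have "arc_end i = t" using assms by (simp add: arc_start_def)
  then have "i < l" using assms(2) by (auto simp: arc_end_def split: if_splits)
  then show ?thesis using arc_end_in[of i] \<open>arc_end i = t\<close> Suc by auto
qed (use assms in \<open>simp add: arc_start_def\<close>)

lemma arc_Suc_crossing: "t \<in> CT \<Longrightarrow> arc (Suc t) = Suc (arc t)"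
  and arc_Suc_extremum: "t \<notin> CT \<Longrightarrow> arc (Suc t) = arc t"
  by (simp_all add: arc_Suc)

text \<open>A piece after an extremum starts no arc and can only end the current one.\<close>

lemma at_arcs_upd_extremum:
  assumes "t < m" "t \<notin> CT"
  shows "(at_arcs (\<sigma>(Suc t := i)))((arc t, True) := b) = (at_arcs \<sigma>)((arc t, True) := b)"
proof
  fix x :: "nat \<times> bool"
  obtain j c where x: "x = (j, c)" by (cases x)
  have "arc_end j = Suc t \<Longrightarrow> j = arc t" "arc_start j \<noteq> Suc t"
    using assms arc_end_eqD[of j "Suc t"] arc_start_SucD[of j t] by (auto simp: arc_Suc_extremum)
  then show "((at_arcs (\<sigma>(Suc t := i)))((arc t, True) := b)) x = ((at_arcs \<sigma>)((arc t, True) := b)) x"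
    unfolding x by (cases c) (auto simp: at_arcs_def)
qed

text \<open>The piece after a crossing starts the next arc and can only end that one.\<close>

lemma at_arcs_upd_crossing:
  assumes "t \<in> CT"
  shows "(at_arcs (\<sigma>(Suc t := i)))((Suc (arc t), True) := b)
    = (at_arcs \<sigma>)((Suc (arc t), False) := i, (Suc (arc t), True) := b)"
proof
  fix x :: "nat \<times> bool"
  obtain j c where x: "x = (j, c)" by (cases x)
  have "t < m" using assms CT by auto
  then have "arc_end j = Suc t \<Longrightarrow> j = Suc (arc t)" "arc_start j = Suc t \<longleftrightarrow> j = Suc (arc t)"
    using assms arc_end_eqD[of j "Suc t"] arc_start_SucD[of j t] arc_end_arc[OF assms]
    by (auto simp: arc_Suc_crossing arc_start_def)
  then show "((at_arcs (\<sigma>(Suc t := i)))((Suc (arc t), True) := b)) x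
      = ((at_arcs \<sigma>)((Suc (arc t), False) := i, (Suc (arc t), True) := b)) x"
    unfolding x by (cases c) (auto simp: at_arcs_def)
qed

lemma later_Suc: "j < l \<Longrightarrow> later j = (Suc j, False) # (Suc j, True) # later (Suc j)"
  by (simp add: later_def upt_conv_Cons del: upt_Suc)

lemma rest_crossing: "t \<in> CT \<Longrightarrow> rest t = 0"
proof -
  assume "t \<in> CT"
  then have "arc u \<noteq> arc t" if "u \<in> {t..<m} - CT" for u
    using that arc_less[of t u] by (cases "u = t") auto
  then have "{u \<in> {t..<m} - CT. arc u = arc t} = {}" by blast
  then show "rest t = 0" unfolding rest_def by (simp only: sum.empty)
qed

lemma rest_after_crossing: "t \<in> CT \<Longrightarrow> rest (Suc t) = rotation (Suc (arc t))"
  unfolding rest_def rotation_def using arc_mono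
  by (intro sum.cong) (auto simp: arc_Suc not_less_eq_eq[symmetric] dest: arc_mono)

lemma rest_0: "rest 0 = rotation 0"
  unfolding rest_def rotation_def by (intro sum.cong) (auto simp: arc_0)

lemma rest_extremum:
  assumes "t < m" "t \<notin> CT"
  shows "rest t = r t + rest (Suc t)"
proof -
  have "{u \<in> {t..<m} - CT. arc u = arc t} = insert t {u \<in> {Suc t..<m} - CT. arc u = arc (Suc t)}"
    using assms by (auto simp: arc_Suc Suc_le_eq order_le_less)
  then show ?thesis by (simp add: rest_def)
qed

definition "arcs_after j G = (\<lambda>\<tau>. (\<Prod>i\<in>{j<..l}. hpow T (rotation i) (\<tau> (i, False)) (\<tau> (i, True))) * G \<tau>)"

lemma ignores_later:
  assumes "x \<in> set (later (Suc j))"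
  shows "ignores (\<lambda>\<tau>. hpow T z (\<tau> (Suc j, False)) (\<tau> (Suc j, True))) x"
  using assms by (auto simp: later_def ignores_def)

lemma arcs_after_step:
  assumes "j < l"
  shows "sum_over d (later j) (arcs_after j G) \<tau>
    = (\<Sum>i<d. \<Sum>b<d. hpow T (rotation (Suc j)) i b *
        sum_over d (later (Suc j)) (arcs_after (Suc j) G) (\<tau>((Suc j, False) := i, (Suc j, True) := b)))"
proof -
  let ?h = "\<lambda>\<tau>. hpow T (rotation (Suc j)) (\<tau> (Suc j, False)) (\<tau> (Suc j, True))"
  have "{j<..l} = insert (Suc j) {Suc j<..l}" using assms by auto
  then have "arcs_after j G = (\<lambda>\<tau>. ?h \<tau> * arcs_after (Suc j) G \<tau>)"
    by (simp add: arcs_after_def mult.assoc)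
  moreover have "sum_over d (later (Suc j)) (\<lambda>\<tau>. ?h \<tau> * arcs_after (Suc j) G \<tau>) \<tau>'
      = ?h \<tau>' * sum_over d (later (Suc j)) (arcs_after (Suc j) G) \<tau>'" for \<tau>'
    by (rule sum_over_mult_left) (rule ignores_later)
  ultimately show ?thesis by (simp add: later_Suc[OF assms])
qed

text \<open>Induction from the last piece downward. At an extremum, the sum over the index of the next
  piece is a product of two powers of \<open>h\<close>. At a crossing the current arc is complete, so its remaining power
  is the identity, and the sum over the next piece is the sum over the start of the next arc.\<close>

lemma collapse_from:
  assumes "t \<le> m" "\<And>x. \<sigma> x < d"
  shows "sum_over d [Suc t..<Suc m] (\<lambda>\<sigma>. (\<Prod>u\<in>{t..<m} - CT. hpow T (r u) (\<sigma> u) (\<sigma> (Suc u))) * G (at_arcs \<sigma>)) \<sigma>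
    = (\<Sum>b<d. hpow T (rest t) (\<sigma> t) b *
        sum_over d (later (arc t)) (arcs_after (arc t) G) ((at_arcs \<sigma>)((arc t, True) := b)))"
  using assms
proof (induction "m - t" arbitrary: t \<sigma>)
  case 0
  then have "t = m" by simp
  moreover have "rest m = 0" by (simp add: rest_def)
  moreover have "(at_arcs \<sigma>)((l, True) := \<sigma> m) = at_arcs \<sigma>"
    by (auto simp: fun_eq_iff at_arcs_def arc_end_l)
  ultimately show ?case
    by (simp only: hpow_0 sum_of_bool_left[OF 0(3)]) (simp add: arc_m later_def arcs_after_def)
next
  case (Suc n)
  then have t: "t < m" by simp
  let ?P = "\<lambda>t \<sigma>. \<Prod>u\<in>{t..<m} - CT. hpow T (r u) (\<sigma> u) (\<sigma> (Suc u))"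
  let ?K = "\<lambda>j. sum_over d (later j) (arcs_after j G)"
  have IH: "sum_over d [Suc (Suc t)..<Suc m] (\<lambda>\<sigma>. ?P (Suc t) \<sigma> * G (at_arcs \<sigma>)) (\<sigma>(Suc t := i))
    = (\<Sum>b<d. hpow T (rest (Suc t)) i b *
        ?K (arc (Suc t)) ((at_arcs (\<sigma>(Suc t := i)))((arc (Suc t), True) := b)))" if "i < d" for i
    using Suc.hyps(1)[of "Suc t" "\<sigma>(Suc t := i)"] Suc.hyps(2) Suc.prems t that by simp
  have upt: "[Suc t..<Suc m] = Suc t # [Suc (Suc t)..<Suc m]" using t by (simp add: upt_conv_Cons)
  show ?case
  proof (cases "t \<in> CT")
    case True
    have "{t..<m} - CT = {Suc t..<m} - CT" using True by (auto simp: Suc_le_eq order_le_less)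
    then have "sum_over d [Suc t..<Suc m] (\<lambda>\<sigma>. ?P t \<sigma> * G (at_arcs \<sigma>)) \<sigma>
      = (\<Sum>i<d. \<Sum>b<d. hpow T (rotation (Suc (arc t))) i b *
          ?K (Suc (arc t)) ((at_arcs \<sigma>)((Suc (arc t), False) := i, (Suc (arc t), True) := b)))"
      unfolding upt sum_over.simps
      by (intro sum.cong refl) (simp only: IH lessThan_iff at_arcs_upd_crossing[OF True]
          rest_after_crossing[OF True] arc_Suc_crossing[OF True])
    also have "\<dots> = ?K (arc t) (at_arcs \<sigma>)"
      using arc_less[OF True t] by (simp only: arcs_after_step arc_m)
    also have "\<dots> = ?K (arc t) ((at_arcs \<sigma>)((arc t, True) := \<sigma> t))"
      by (rule arg_cong[where f = "?K (arc t)"]) (auto simp: fun_eq_iff at_arcs_def arc_end_arc[OF True])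
    finally show ?thesis
      by (simp only: rest_crossing[OF True] hpow_0 sum_of_bool_left[OF Suc.prems(2)])
  next
    case False
    have split: "{t..<m} - CT = insert t ({Suc t..<m} - CT)" using t False by auto
    have P: "?P t \<sigma> * G (at_arcs \<sigma>) = hpow T (r t) (\<sigma> t) (\<sigma> (Suc t)) * (?P (Suc t) \<sigma> * G (at_arcs \<sigma>))" for \<sigma>
      unfolding split by (simp add: mult.assoc)
    have "sum_over d [Suc t..<Suc m] (\<lambda>\<sigma>. ?P t \<sigma> * G (at_arcs \<sigma>)) \<sigma>
      = (\<Sum>i<d. hpow T (r t) (\<sigma> t) i *
          sum_over d [Suc (Suc t)..<Suc m] (\<lambda>\<sigma>. ?P (Suc t) \<sigma> * G (at_arcs \<sigma>)) (\<sigma>(Suc t := i)))"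
      unfolding upt sum_over.simps P
      by (intro sum.cong refl) (subst sum_over_mult_left, auto simp: ignores_def)
    also have "\<dots> = (\<Sum>i<d. \<Sum>b<d. hpow T (r t) (\<sigma> t) i * hpow T (rest (Suc t)) i b *
          ?K (arc t) ((at_arcs \<sigma>)((arc t, True) := b)))"
      by (intro sum.cong refl) (simp only: IH lessThan_iff at_arcs_upd_extremum[OF t False]
          arc_Suc_extremum[OF False] sum_distrib_left mult.assoc)
    also have "\<dots> = (\<Sum>b<d. (\<Sum>i<d. hpow T (r t) (\<sigma> t) i * hpow T (rest (Suc t)) i b) *
          ?K (arc t) ((at_arcs \<sigma>)((arc t, True) := b)))"
      by (subst sum.swap) (simp add: sum_distrib_right)
    also have "\<dots> = (\<Sum>b<d. hpow T (rest t) (\<sigma> t) b * ?K (arc t) ((at_arcs \<sigma>)((arc t, True) := b)))"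
      using hpow_add[OF rt r[OF False t] Suc.prems(2)[of t]] by (simp add: rest_extremum[OF t False])
    finally show ?thesis .
  qed
qed

lemma collapse:
  assumes "\<And>x. \<sigma> x < d"
  shows "sum_over d [1..<Suc m] (\<lambda>\<sigma>. (\<Prod>u\<in>{..<m} - CT. hpow T (r u) (\<sigma> u) (\<sigma> (Suc u))) * G (at_arcs \<sigma>)) \<sigma>
    = sum_over d ((0, True) # later 0)
        (\<lambda>\<tau>. (\<Prod>i\<le>l. hpow T (rotation i) (\<tau> (i, False)) (\<tau> (i, True))) * G \<tau>) (at_arcs \<sigma>)"
proof -
  let ?h = "\<lambda>\<tau>. hpow T (rotation 0) (\<tau> (0, False)) (\<tau> (0, True))"
  have "{..l} = insert 0 {0<..l}" by auto
  then have P: "(\<Prod>i\<le>l. hpow T (rotation i) (\<tau> (i, False)) (\<tau> (i, True))) * G \<tau> = ?h \<tau> * arcs_after 0 G \<tau>" for \<tau>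
    by (simp add: arcs_after_def mult.assoc)
  have "ignores ?h x" if "x \<in> set (later 0)" for x
    using that by (auto simp: later_def ignores_def)
  then have "sum_over d (later 0) (\<lambda>\<tau>. ?h \<tau> * arcs_after 0 G \<tau>) \<tau>
      = ?h \<tau> * sum_over d (later 0) (arcs_after 0 G) \<tau>" for \<tau>
    by (rule sum_over_mult_left)
  moreover have "at_arcs \<sigma> (0, False) = \<sigma> 0" by (simp add: at_arcs_def arc_start_def)
  ultimately show ?thesis
    using collapse_from[of 0 \<sigma> G] assms unfolding P
    by (simp add: arc_0 rest_0 atLeast0LessThan del: upt_Suc)
qed

end


section \<open>Gauss codes\<close>

lemma passage_eqI:
  assumes "distinct (code D)" "i < length (code D)" "code D ! i = x"
  shows "passage D x = i"
proof -
  have "takeWhile (\<lambda>y. y \<noteq> x) (code D) = take i (code D)"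
    using assms by (intro takeWhile_eq_take_P_nth) (auto simp: nth_eq_iff_index_eq)
  then show ?thesis using assms(2) by (simp add: passage_def)
qed

lemma knot_diagram_length: "knot_diagram D \<Longrightarrow> length (code D) = 2 * crossings D"
  by (simp add: knot_diagram_def)

lemma knot_diagram_set: "knot_diagram D \<Longrightarrow> set (code D) = {..<crossings D} \<times> UNIV"
  by (simp add: knot_diagram_def)

lemma knot_diagram_distinct:
  assumes "knot_diagram D"
  shows "distinct (code D)"
  using assms by (intro card_distinct)
    (simp add: knot_diagram_set knot_diagram_length card_cartesian_product UNIV_bool)

lemma code_passage:
  assumes "knot_diagram D" "c < crossings D"
  shows "passage D (c, b) < 2 * crossings D" "code D ! passage D (c, b) = (c, b)"
proof -
  have "(c, b) \<in> set (code D)" using assms by (simp add: knot_diagram_set)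
  then obtain i where i: "i < length (code D)" "code D ! i = (c, b)" by (auto simp: in_set_conv_nth)
  then have "passage D (c, b) = i" using assms by (intro passage_eqI knot_diagram_distinct)
  then show "passage D (c, b) < 2 * crossings D" "code D ! passage D (c, b) = (c, b)"
    using i assms by (simp_all add: knot_diagram_length)
qed


section \<open>The value of a long diagram as a network sum\<close>

definition is_crossing :: "slice \<Rightarrow> bool" where
  "is_crossing s = (case s of Cross p e a b \<Rightarrow> True | _ \<Rightarrow> False)"

definition slice_time :: "slice \<Rightarrow> nat" where
  "slice_time s = (case s of Cross p e a b \<Rightarrow> a | Cup p right a \<Rightarrow> a | Cap p right a \<Rightarrow> a)"

lemma mset_extremum_times:
  "mset (map slice_time (filter (\<lambda>s. \<not> is_crossing s) L)) = cup_times L + cap_times L"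
  by (induction L rule: births.induct) (auto simp: is_crossing_def slice_time_def)

lemma mset_left_times:
  "mset (map slice_time (filter is_crossing L)) \<subseteq># cross_times L"
  by (induction L rule: births.induct) (auto simp: is_crossing_def slice_time_def intro: subset_mset.order_trans)

lemma distinct_of_subset_mset:
  assumes "mset xs \<subseteq># mset ys" "distinct ys"
  shows "distinct xs"
proof -
  obtain zs where "mset ys = mset (xs @ zs)"
    using assms(1) by (metis ex_mset mset_append subset_mset.add_diff_inverse)
  then have "distinct (xs @ zs)" using assms(2) mset_eq_imp_distinct_iff by blast
  then show ?thesis by simp
qed

lemma prod_list_reindex:
  fixes F :: "'a \<Rightarrow> 'r::comm_monoid_mult"
  assumes "distinct (map g xs)" "\<And>x. x \<in> set xs \<Longrightarrow> F x = F' (g x)"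
  shows "(\<Prod>x\<leftarrow>xs. F x) = (\<Prod>y\<in>g ` set xs. F' y)"
proof -
  have "(\<Prod>x\<leftarrow>xs. F x) = (\<Prod>y\<leftarrow>map g xs. F' y)"
    using assms(2) by (simp add: o_def cong: map_cong)
  also have "\<dots> = (\<Prod>y\<in>set (map g xs). F' y)" by (rule prod.distinct_set_conv_list[OF assms(1), symmetric])
  finally show ?thesis by simp
qed

lemma sum_list_reindex:
  fixes F :: "'a \<Rightarrow> 'r::comm_monoid_add"
  assumes "distinct (map g xs)" "\<And>x. x \<in> set xs \<Longrightarrow> F x = F' (g x)"
  shows "(\<Sum>x\<leftarrow>xs. F x) = (\<Sum>y\<in>g ` set xs. F' y)"
proof -
  have "(\<Sum>x\<leftarrow>xs. F x) = (\<Sum>y\<leftarrow>map g xs. F' y)"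
    using assms(2) by (simp add: o_def cong: map_cong)
  also have "\<dots> = (\<Sum>y\<in>set (map g xs). F' y)" by (rule sum.distinct_set_conv_list[OF assms(1), symmetric])
  finally show ?thesis by simp
qed

lemma prod_list_filter_split:
  fixes F :: "'a \<Rightarrow> 'r::comm_monoid_mult"
  shows "(\<Prod>x\<leftarrow>xs. F x) = (\<Prod>x\<leftarrow>filter (\<lambda>x. \<not> P x) xs. F x) * (\<Prod>x\<leftarrow>filter P xs. F x)"
  by (induction xs) (auto simp: ac_simps)

lemma sum_list_filter_not:
  fixes F :: "'a \<Rightarrow> 'r::comm_monoid_add"
  shows "(\<Sum>x\<leftarrow>xs. if P x then 0 else F x) = (\<Sum>x\<leftarrow>filter (\<lambda>x. \<not> P x) xs. F x)"
  by (induction xs) auto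

locale long_knot =
  fixes T :: rt_data and D :: diagram and r :: nat and L :: "slice list"
  assumes rt: "rt_system T" and knot: "knot_diagram D" and long: "long_form D r L"
begin

abbreviation "d \<equiv> dim T"
abbreviation "n \<equiv> crossings D"
definition "l = length (code D)"
definition "left_arc c = long_passage D r (left_passage D c)"
definition "right_arc c = long_passage D r (right_passage D c)"

lemma l_eq: "l = 2 * n" using knot by (simp add: l_def knot_diagram_length)

lemma r_less: "r < l" using long by (simp add: long_form_def l_eq)

lemma passages_less:
  assumes "c < n"
  shows "left_passage D c < l" "right_passage D c < l"
  using code_passage(1)[OF knot assms] by (simp_all add: left_passage_def right_passage_def l_eq)

lemma passage_owner:
  assumes "i < l" "code D ! i = (c, b)"
  shows "c < n" "passage D (c, b) = i" "i = left_passage D c \<or> i = right_passage D c"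
proof -
  show "c < n" using nth_mem[of i "code D"] assms by (simp add: l_def knot_diagram_set[OF knot])
  show p: "passage D (c, b) = i"
    using assms by (intro passage_eqI knot_diagram_distinct[OF knot]) (simp_all add: l_def)
  show "i = left_passage D c \<or> i = right_passage D c"
    using p by (cases "b = positive D c") (auto simp: left_passage_def right_passage_def)
qed

definition "m = (SOME m. morse [(0, True)] L [(m, True)])"

lemma morse_m: "morse [(0, True)] L [(m, True)]"
proof -
  have "\<exists>m. morse [(0, True)] L [(m, True)]" using long unfolding long_form_def by (elim conjE)
  then show ?thesis unfolding m_def by (rule someI_ex)
qed

definition "extrema = filter (\<lambda>s. \<not> is_crossing s) L"
definition "crossing_slices = filter is_crossing L"
definition "turning_at t = (if t \<in> slice_time ` set extrema
  then turning (inv_into (set extrema) slice_time t) else 0)"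

lemma length_crossing_slices: "length crossing_slices = n"
  using long by (simp add: long_form_def crossing_slices_def is_crossing_def[abs_def])

lemma card_crossing_times: "card (crossing_times L) = l"
  using crossing_times_long(2)[OF morse_m] long by (simp add: long_form_def l_eq)

lemma extrema_times: "distinct (map slice_time extrema)"
  "slice_time ` set extrema = {..<m} - crossing_times L"
proof -
  have eq: "mset (map slice_time extrema) = mset [0..<m] - cross_times L"
    unfolding extrema_def mset_extremum_times long_times(1)[OF morse_m, symmetric] by simp
  have "mset (map slice_time extrema) \<subseteq># mset [0..<m]" unfolding eq by (rule diff_subset_eq_self)
  then show "distinct (map slice_time extrema)" by (rule distinct_of_subset_mset) simp
  have "mset (map slice_time extrema) = mset_set ({0..<m} - crossing_times L)"
    using eq crossing_times_long(1,3)[OF morse_m]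
    by (subst mset_set_Diff) (auto simp: atLeast0LessThan)
  then have "set_mset (mset (map slice_time extrema)) = set_mset (mset_set ({0..<m} - crossing_times L))"
    by (rule arg_cong)
  then show "slice_time ` set extrema = {..<m} - crossing_times L"
    by (simp add: atLeast0LessThan)
qed

lemma turning_at_time: "s \<in> set extrema \<Longrightarrow> turning_at (slice_time s) = turning s"
  using extrema_times(1) by (auto simp: turning_at_def distinct_map)

lemma turning_at_range: "turning_at t \<in> {- 1, 0, 1}"
proof -
  have "turning s \<in> {- 1, 0, 1}" for s by (cases s) (auto simp: turning_def)
  then show ?thesis by (simp add: turning_at_def)
qed

sublocale tl: timeline T m "crossing_times L" turning_at
  by unfold_locales (use rt crossing_times_long(3)[OF morse_m] turning_at_range in auto)

lemma l_timeline: "tl.l = l"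
  by (simp add: tl.l_def card_crossing_times)

lemma arc_eq_rank: "tl.arc = rank L"
  by (simp add: fun_eq_iff tl.arc_def rank_def)

lemma rotation_eq_rot: "tl.rotation j = rot L j"
proof -
  have "rot L j = (\<Sum>s\<leftarrow>L. if is_crossing s then 0 else if rank L (slice_time s) = j then turning s else 0)"
    unfolding rot_def
    by (intro arg_cong[where f = sum_list] map_cong refl)
      (auto simp: is_crossing_def slice_time_def turning_def split: slice.splits)
  also have "\<dots> = (\<Sum>s\<leftarrow>extrema. if rank L (slice_time s) = j then turning s else 0)"
    unfolding extrema_def by (rule sum_list_filter_not)
  also have "\<dots> = (\<Sum>t\<in>slice_time ` set extrema. if rank L t = j then turning_at t else 0)"
    by (rule sum_list_reindex[OF extrema_times(1)]) (simp add: turning_at_time)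
  also have "\<dots> = tl.rotation j"
    unfolding tl.rotation_def arc_eq_rank extrema_times(2) by (rule sum.inter_filter[symmetric]) simp
  finally show ?thesis by simp
qed

definition crossing_weight :: "nat \<Rightarrow> (nat \<times> bool \<Rightarrow> nat) \<Rightarrow> laurent" where
  "crossing_weight c \<tau> = rmat T (positive D c) (\<tau> (left_arc c, True)) (\<tau> (right_arc c, True))
     (\<tau> (Suc (right_arc c), False)) (\<tau> (Suc (left_arc c), False))"

text \<open>The passages at lower left and lower right are found in the Gauss code at the ranks of the two
  incoming pieces, whatever the sign of the crossing.\<close>

lemma crossing_slice:
  assumes "s \<in> set crossing_slices"
  shows "\<exists>c<n. left_arc c = rank L (slice_time s) \<and> slice_time s \<in> crossing_times L \<and>
    (\<forall>\<sigma>. weight T s \<sigma> = crossing_weight c (tl.at_arcs \<sigma>))"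
proof -
  obtain p e a b where s: "s = Cross p e a b" "Cross p e a b \<in> set L"
    using assms by (auto simp: crossing_slices_def is_crossing_def split: slice.splits)
  have ab: "a \<in> crossing_times L" "b \<in> crossing_times L"
    using s(2) by (induction L rule: crossing_times.induct) auto
  have rank: "rank L a < l" "rank L b < l"
    using ab tl.arc_end_arc tl.bij_arc by (auto simp: bij_betw_def arc_eq_rank l_timeline)
  obtain c where c: "c < n" "positive D c = e"
    "code D ! ((r + rank L (if e then a else b)) mod (2 * n)) = (c, True)"
    "code D ! ((r + rank L (if e then b else a)) mod (2 * n)) = (c, False)"
  proof -
    have "\<forall>p s a b. Cross p s a b \<in> set L \<longrightarrow> (\<exists>c<n. positive D c = s \<and>
        code D ! ((r + rank L (if s then a else b)) mod (2 * n)) = (c, True) \<and>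
        code D ! ((r + rank L (if s then b else a)) mod (2 * n)) = (c, False))"
      using long unfolding long_form_def by (elim conjE)
    from this[rule_format, OF s(2)] show ?thesis by (elim exE conjE) (rule that)
  qed
  have l0: "0 < l" using r_less by simp
  have code: "code D ! ((r + rank L a) mod l) = (c, positive D c)"
    "code D ! ((r + rank L b) mod l) = (c, \<not> positive D c)"
    using c by (cases e; simp add: l_eq)+
  have pass: "left_passage D c = (r + rank L a) mod l" "right_passage D c = (r + rank L b) mod l"
    using passage_eqI[OF knot_diagram_distinct[OF knot] _ code(1)]
      passage_eqI[OF knot_diagram_distinct[OF knot] _ code(2)] l0
    by (simp_all add: l_def left_passage_def right_passage_def)
  have unshift: "((r + q) mod l + l - r) mod l = q" if "q < l" for q
  proof (cases "r + q < l")
    case True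
    then show ?thesis using that by simp
  next
    case False
    then have "(r + q) mod l = r + q - l" using that r_less by (simp add: mod_if)
    then show ?thesis using False that by simp
  qed
  have arcs: "left_arc c = rank L a" "right_arc c = rank L b"
    using unshift[OF rank(1)] unshift[OF rank(2)]
    by (simp_all add: left_arc_def right_arc_def long_passage_def pass l_def[symmetric])
  have ends: "tl.arc_end (rank L a) = a" "tl.arc_end (rank L b) = b"
    using ab tl.arc_end_arc by (simp_all add: arc_eq_rank)
  have "weight T s \<sigma> = crossing_weight c (tl.at_arcs \<sigma>)" for \<sigma>
    by (simp add: s crossing_weight_def arcs c(2) tl.at_arcs_def tl.arc_start_def ends)
  then show ?thesis using c(1) arcs ab by (auto simp: s slice_time_def)
qed

text \<open>Crossings of the diagram and crossing slices correspond to each other: distinct slices lie at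
  distinct ranks, hence belong to distinct crossings, and there are equally many of both.\<close>

lemma crossing_weights:
  "(\<Prod>s\<leftarrow>crossing_slices. weight T s \<sigma>) = (\<Prod>c<n. crossing_weight c (tl.at_arcs \<sigma>))"
proof -
  let ?P = "\<lambda>s c. c < n \<and> left_arc c = rank L (slice_time s) \<and> slice_time s \<in> crossing_times L \<and>
    (\<forall>\<sigma>. weight T s \<sigma> = crossing_weight c (tl.at_arcs \<sigma>))"
  obtain g where g: "\<And>s. s \<in> set crossing_slices \<Longrightarrow> ?P s (g s)"
    using crossing_slice by metis
  have "mset (map slice_time crossing_slices) \<subseteq># mset [0..<m]"
    using subset_mset.order_trans[OF mset_left_times[of L]] unfolding crossing_slices_def
      long_times(1)[OF morse_m, symmetric] by simp
  then have dist: "distinct (map slice_time crossing_slices)" by (rule distinct_of_subset_mset) simp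
  have "inj_on g (set crossing_slices)"
  proof (rule inj_onI)
    fix s s' assume s: "s \<in> set crossing_slices" "s' \<in> set crossing_slices" and eq: "g s = g s'"
    then have "rank L (slice_time s) = rank L (slice_time s')"
      "slice_time s \<in> crossing_times L" "slice_time s' \<in> crossing_times L"
      using g[OF s(1)] g[OF s(2)] by auto
    then have "slice_time s = slice_time s'"
      using tl.bij_arc by (auto simp: bij_betw_def arc_eq_rank dest: inj_onD)
    then show "s = s'" using s dist by (auto simp: distinct_map dest: inj_onD)
  qed
  then have dg: "distinct (map g crossing_slices)" using dist by (simp add: distinct_map)
  have "g ` set crossing_slices = {..<n}"
  proof (rule card_subset_eq)
    show "g ` set crossing_slices \<subseteq> {..<n}" using g by blast
    have "card (set (map g crossing_slices)) = n"
      using distinct_card[OF dg] length_crossing_slices by simp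
    then show "card (g ` set crossing_slices) = card {..<n}" by simp
  qed simp
  then show ?thesis
    using prod_list_reindex[OF dg, of "\<lambda>s. weight T s \<sigma>" "\<lambda>c. crossing_weight c (tl.at_arcs \<sigma>)"] g
    by simp
qed

lemma extremum_weights:
  "(\<Prod>s\<leftarrow>extrema. weight T s \<sigma>)
    = (\<Prod>t\<in>{..<m} - crossing_times L. hpow T (turning_at t) (\<sigma> t) (\<sigma> (Suc t)))"
  unfolding extrema_times(2)[symmetric]
proof (rule prod_list_reindex[OF extrema_times(1)])
  fix s assume s: "s \<in> set extrema"
  have "weight T s \<sigma> = hpow T (turning s) (\<sigma> (slice_time s)) (\<sigma> (Suc (slice_time s)))"
  proof -
    have "\<not> is_crossing s" using s by (simp add: extrema_def)
    then show ?thesis by (cases s) (simp_all add: is_crossing_def slice_time_def)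
  qed
  then show "weight T s \<sigma> = hpow T (turning_at (slice_time s)) (\<sigma> (slice_time s)) (\<sigma> (Suc (slice_time s)))"
    using s by (simp add: turning_at_time)
qed

definition "arc_ends = (0, True) # concat (map (\<lambda>j. [(j, False), (j, True)]) [1..<Suc l])"

text \<open>The unabsorbed tensor network. Every arc has an index at its start and one at its end, joined by a
  power of \<open>h\<close>, also if this is the identity; the factor at the end closes the last arc with the first basis
  vector.\<close>

definition network :: "(nat \<times> bool \<Rightarrow> nat) \<Rightarrow> laurent" where
  "network \<tau> = (\<Prod>j\<le>l. hpow T (rot L j) (\<tau> (j, False)) (\<tau> (j, True)))
     * ((\<Prod>c<n. crossing_weight c \<tau>) * of_bool (\<tau> (l, True) = 0))"

lemma rt_operator_eq_network:
  "rt_operator T L [0] [0] = sum_over d arc_ends network (\<lambda>_. 0)"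
proof -
  let ?G = "\<lambda>\<tau>. (\<Prod>c<n. crossing_weight c \<tau>) * of_bool (\<tau> (l, True) = 0)"
  have births: "{#0#} + mset (births L) = mset [0..<Suc m]" by (rule long_times(2)[OF morse_m])
  then have "mset (0 # births L) = mset [0..<Suc m]" by simp
  then have dist: "distinct (0 # births L)" using mset_eq_imp_distinct_iff distinct_upt by blast
  have "mset (births L) = mset [1..<Suc m]"
    using births by (simp add: upt_conv_Cons del: upt_Suc mset_upt)
  then have births: "distinct (births L)" "set (births L) = set [1..<Suc m]"
    using mset_eq_imp_distinct_iff distinct_upt mset_eq_setD by blast+
  have d: "(0::nat) < d" using rt by (rule rt_system_dim_pos)
  have "rt_operator T L [0] [0] = sum_over d (births L)
      (\<lambda>\<sigma>. (\<Prod>s\<leftarrow>L. weight T s \<sigma>) * of_bool (map (\<sigma> \<circ> fst) [(m, True)] = [0])) (\<lambda>_. 0)"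
    using morse_state_sum[OF morse_m, of "\<lambda>_. 0" T "[0]"] dist d by simp
  also have "\<dots> = sum_over d [1..<Suc m]
      (\<lambda>\<sigma>. (\<Prod>s\<leftarrow>L. weight T s \<sigma>) * of_bool (map (\<sigma> \<circ> fst) [(m, True)] = [0])) (\<lambda>_. 0)"
    using births by (intro sum_over_permute) auto
  also have "\<dots> = sum_over d [1..<Suc m] (\<lambda>\<sigma>.
      (\<Prod>t\<in>{..<m} - crossing_times L. hpow T (turning_at t) (\<sigma> t) (\<sigma> (Suc t))) * ?G (tl.at_arcs \<sigma>)) (\<lambda>_. 0)"
  proof (rule sum_over_cong)
    fix \<sigma>
    have "tl.at_arcs \<sigma> (l, True) = \<sigma> m"
      using tl.arc_end_l by (simp add: tl.at_arcs_def l_timeline)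
    then show "(\<Prod>s\<leftarrow>L. weight T s \<sigma>) * of_bool (map (\<sigma> \<circ> fst) [(m, True)] = [0])
      = (\<Prod>t\<in>{..<m} - crossing_times L. hpow T (turning_at t) (\<sigma> t) (\<sigma> (Suc t))) * ?G (tl.at_arcs \<sigma>)"
      unfolding prod_list_filter_split[where P = is_crossing and xs = L]
        extrema_def[symmetric] crossing_slices_def[symmetric] extremum_weights crossing_weights
      by (simp add: mult.assoc)
  qed
  also have "\<dots> = sum_over d ((0, True) # tl.later 0) network (tl.at_arcs (\<lambda>_. 0))"
    using tl.collapse[of "\<lambda>_. 0" ?G] d
    by (simp only: rotation_eq_rot l_timeline network_def[abs_def])
  finally show ?thesis
    by (simp add: arc_ends_def tl.later_def l_timeline tl.at_arcs_def case_prod_unfold del: upt_Suc sum_over.simps)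
qed

text \<open>At most one scalar is a value of the diagram, because the given long form determines it as
  an entry of its operator and the space is not trivial.\<close>

lemma RT_eq: "RT T D = rt_operator T L [0] [0]"
proof -
  have d: "(0::nat) < d" using rt by (rule rt_system_dim_pos)
  have "\<forall>D. knot_diagram D \<longrightarrow> (\<exists>c. is_rt_value T D c)"
    using rt unfolding rt_system_def Let_def by (elim conjE)
  then obtain c where c: "is_rt_value T D c" using knot by blast
  have val: "c' = rt_operator T L [0] [0]" if "is_rt_value T D c'" for c'
    using that long d unfolding is_rt_value_def by fastforce
  show ?thesis unfolding RT_def
  proof (rule the_equality)
    show "is_rt_value T D (rt_operator T L [0] [0])" using c val[OF c] by simp
  qed (rule val)
qed

end


section \<open>The tensors at the crossings\<close>

lemma sum_over_transfer:
  assumes "\<And>x \<sigma> i. x \<in> set xs \<Longrightarrow> E (\<sigma>(x := i)) = (E \<sigma>)(x := i)"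
  shows "sum_over d xs f (E \<sigma>) = sum_over d xs (\<lambda>\<sigma>. f (E \<sigma>)) \<sigma>"
  using assms
proof (induction xs arbitrary: \<sigma>)
  case (Cons x xs)
  have "(E \<sigma>)(x := i) = E (\<sigma>(x := i))" for i
    by (rule Cons.prems[symmetric]) simp
  moreover have "sum_over d xs f (E \<tau>) = sum_over d xs (\<lambda>\<sigma>. f (E \<sigma>)) \<tau>" for \<tau>
    by (rule Cons.IH, rule Cons.prems) simp
  ultimately show ?case by (simp only: sum_over.simps)
qed simp

lemma sum_over_concat_prod:
  assumes "distinct cs"
    and "\<And>c c' x. c \<in> set cs \<Longrightarrow> c' \<in> set cs \<Longrightarrow> c \<noteq> c' \<Longrightarrow> x \<in> set (V c') \<Longrightarrow> ignores (g c) x"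
  shows "sum_over d (concat (map V cs)) (\<lambda>\<tau>. \<Prod>c\<leftarrow>cs. g c \<tau>) \<tau> = (\<Prod>c\<leftarrow>cs. sum_over d (V c) (g c) \<tau>)"
  using assms
proof (induction cs arbitrary: \<tau>)
  case (Cons c cs)
  let ?R = "\<lambda>\<tau>. \<Prod>c\<leftarrow>cs. sum_over d (V c) (g c) \<tau>"
  have IH: "sum_over d (concat (map V cs)) (\<lambda>\<tau>. \<Prod>c\<leftarrow>cs. g c \<tau>) \<tau>' = ?R \<tau>'" for \<tau>'
    using Cons.prems by (intro Cons.IH) auto
  have "sum_over d (concat (map V (c # cs))) (\<lambda>\<tau>. \<Prod>c\<leftarrow>c # cs. g c \<tau>) \<tau>
      = sum_over d (V c) (\<lambda>\<tau>. sum_over d (concat (map V cs)) (\<lambda>\<tau>. g c \<tau> * (\<Prod>c\<leftarrow>cs. g c \<tau>)) \<tau>) \<tau>"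
    by (simp add: sum_over_append)
  also have "\<dots> = sum_over d (V c) (\<lambda>\<tau>. ?R \<tau> * g c \<tau>) \<tau>"
  proof (rule sum_over_cong)
    fix \<tau>
    have "sum_over d (concat (map V cs)) (\<lambda>\<tau>. g c \<tau> * (\<Prod>c\<leftarrow>cs. g c \<tau>)) \<tau>
        = g c \<tau> * sum_over d (concat (map V cs)) (\<lambda>\<tau>. \<Prod>c\<leftarrow>cs. g c \<tau>) \<tau>"
      using Cons.prems by (intro sum_over_mult_left) auto
    then show "sum_over d (concat (map V cs)) (\<lambda>\<tau>. g c \<tau> * (\<Prod>c\<leftarrow>cs. g c \<tau>)) \<tau> = ?R \<tau> * g c \<tau>"
      by (simp add: IH mult.commute)
  qed
  also have "\<dots> = ?R \<tau> * sum_over d (V c) (g c) \<tau>"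
  proof (rule sum_over_mult_left)
    fix x assume x: "x \<in> set (V c)"
    show "ignores ?R x"
      by (rule ignores_prod_list, rule ignores_sum_over) (use Cons.prems x in auto)
  qed
  finally show ?case by (simp add: mult.commute)
qed simp

text \<open>The data of a computation. The constants \<open>C\<close> and \<open>b0\<close> bound the time of the integer operations and
  the size of the matrix entries, so they can be chosen before the diagram.\<close>

locale knot_network = long_knot +
  fixes tadd tmul :: "int \<Rightarrow> int \<Rightarrow> nat" and C :: real and b0 :: nat
  assumes rots: "\<And>j. j \<le> l \<Longrightarrow> rot L j \<in> {- 1, 0, 1}"
    and ops: "op_bound C tadd" "op_bound C tmul"
    and entries: "\<And>s i j. i < d \<Longrightarrow> j < d \<Longrightarrow> fits (nvars T) b0 (encode (nvars T) (hmat T s i j))"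
      "\<And>s i j p q. i < d \<Longrightarrow> j < d \<Longrightarrow> p < d \<Longrightarrow> q < d \<Longrightarrow>
        fits (nvars T) b0 (encode (nvars T) (rmat T s i j p q))"
begin

abbreviation "k \<equiv> nvars T"
abbreviation "\<rho> \<equiv> rot L"

definition "F = free_legs D \<rho>"

text \<open>The arcs whose degree-2 vertex belongs to the crossing \<open>c\<close>: the two that end there, and the last arc at
  the crossing where it starts.\<close>

definition "ends c = [left_arc c, right_arc c]
  @ (if left_arc c + 1 = l \<or> right_arc c + 1 = l then [l] else [])"

text \<open>The edge-end at which an arc meets the crossing that absorbs it: its end, but the start of the last arc.\<close>

definition "joint j = (j, j < l)"
definition "h_factor j \<tau> = hpow T (\<rho> j) (\<tau> (j, False)) (\<tau> (j, True))"
definition "base c = fst (crossing_tensor T D r \<rho> c)"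
definition "arc_t j = fst (arc_tensor T D \<rho> j)"

lemma d_pos: "0 < d" using rt by (rule rt_system_dim_pos)

lemma entries_laurent:
  assumes "i < d" "j < d"
  shows "laurent_in k (hmat T s i j)" "p < d \<Longrightarrow> q < d \<Longrightarrow> laurent_in k (rmat T s i j p q)"
proof -
  have "\<forall>s. \<forall>i<d. \<forall>j<d. laurent_in k (hmat T s i j) \<and>
      (\<forall>p<d. \<forall>q<d. laurent_in k (rmat T s i j p q))"
    using rt unfolding rt_system_def Let_def by (elim conjE)
  then show "laurent_in k (hmat T s i j)" "p < d \<Longrightarrow> q < d \<Longrightarrow> laurent_in k (rmat T s i j p q)"
    using assms by blast+
qed

lemma F_eq: "F = {(0, False), (l, \<rho> l \<noteq> 0)}"
  by (simp add: F_def free_legs_def l_def)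

lemma absorbed_eq: "absorbed_arcs D r \<rho> c = filter (\<lambda>j. \<rho> j \<noteq> 0) (ends c)"
  by (simp add: absorbed_arcs_def ends_def left_arc_def right_arc_def l_def Let_def)

lemma arcs_of_crossing:
  assumes "c < n"
  shows "left_arc c < l" "right_arc c < l" "left_arc c \<noteq> right_arc c"
proof -
  let ?p = "left_passage D c" and ?q = "right_passage D c"
  have pq: "?p < l" "?q < l" "code D ! ?p = (c, positive D c)" "code D ! ?q = (c, \<not> positive D c)"
    using code_passage[OF knot assms] by (simp_all add: left_passage_def right_passage_def l_eq)
  then have ne: "?p \<noteq> ?q" by auto
  show "left_arc c < l" "right_arc c < l"
    using pq(1) by (auto simp: left_arc_def right_arc_def long_passage_def l_def[symmetric] intro!: mod_less_divisor)
  show "left_arc c \<noteq> right_arc c"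
  proof
    assume "left_arc c = right_arc c"
    then have "(?p + l - r) mod l = (?q + l - r) mod l"
      by (simp add: left_arc_def right_arc_def long_passage_def l_def)
    then show False using pq(1,2) ne r_less by (auto simp: mod_if split: if_splits)
  qed
qed

text \<open>Each arc but the last one ends at exactly one passage, and each passage belongs to one crossing.\<close>

lemma arc_unique:
  assumes "j < l"
  shows "\<exists>!c. c < n \<and> (j = left_arc c \<or> j = right_arc c)"
proof -
  have shift: "long_passage D r i = j \<longleftrightarrow> i = (j + r) mod l" if "i < l" for i
    using that assms r_less by (auto simp: long_passage_def l_def[symmetric] mod_if split: if_splits)
  have l0: "(j + r) mod l < l" using assms by simp
  let ?i = "(j + r) mod l"
  obtain c b where cb: "code D ! ?i = (c, b)" by (cases "code D ! ?i")
  note c = passage_owner[OF l0 cb]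
  have iff: "j = left_arc c' \<or> j = right_arc c' \<longleftrightarrow> c' = c" if "c' < n" for c'
  proof -
    have p: "passage D (c', b') < l" "code D ! passage D (c', b') = (c', b')" for b'
      using code_passage[OF knot that] by (simp_all add: l_eq)
    have e: "passage D (c', b') = ?i \<longleftrightarrow> c' = c \<and> b' = b" for b'
      using p[of b'] cb c(2) by auto
    have "j = left_arc c' \<longleftrightarrow> passage D (c', positive D c') = ?i"
      "j = right_arc c' \<longleftrightarrow> passage D (c', \<not> positive D c') = ?i"
      unfolding left_arc_def right_arc_def left_passage_def right_passage_def
      by (metis shift[OF p(1)])+
    then show ?thesis unfolding e by blast
  qed
  show ?thesis using c(1) iff by blast
qed

lemma ends_le: "c < n \<Longrightarrow> j \<in> set (ends c) \<Longrightarrow> j \<le> l"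
  using arcs_of_crossing[of c] by (auto simp: ends_def split: if_splits)

lemma distinct_ends: "c < n \<Longrightarrow> distinct (ends c)"
  using arcs_of_crossing[of c] by (auto simp: ends_def)

lemma ends_disjoint:
  assumes "c < n" "c' < n" "j \<in> set (ends c)" "j \<in> set (ends c')"
  shows "c = c'"
proof (cases "j = l")
  case True
  then have "l - 1 = left_arc c \<or> l - 1 = right_arc c" "l - 1 = left_arc c' \<or> l - 1 = right_arc c'"
    using assms arcs_of_crossing[of c] arcs_of_crossing[of c'] by (auto simp: ends_def split: if_splits)
  moreover have "l - 1 < l" using r_less by simp
  ultimately show ?thesis using arc_unique[of "l - 1"] assms by blast
next
  case False
  then have "j < l" using ends_le[OF assms(1,3)] by simp
  moreover have "j = left_arc c \<or> j = right_arc c" "j = left_arc c' \<or> j = right_arc c'"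
    using False assms by (auto simp: ends_def split: if_splits)
  ultimately show ?thesis using arc_unique[of j] assms by blast
qed

lemma ends_cover:
  assumes "j \<le> l"
  shows "\<exists>c<n. j \<in> set (ends c)"
proof (cases "j = l")
  case True
  have "l - 1 < l" using r_less by simp
  then obtain c where "c < n" "l - 1 = left_arc c \<or> l - 1 = right_arc c" using arc_unique by blast
  then show ?thesis using True r_less by (auto simp: ends_def)
next
  case False
  then obtain c where "c < n" "j = left_arc c \<or> j = right_arc c" using arc_unique[of j] assms by auto
  then show ?thesis by (auto simp: ends_def)
qed

definition "write_cost i = d ^ i * ((b0 + 2) * (2 * b0 + 1) ^ k + i * (nbits (int d) + 1))"

lemma time_write_le:
  assumes "\<And>is. length is = length legs \<Longrightarrow> set is \<subseteq> {..<d} \<Longrightarrow> fits k b0 (f is)" "length legs = i"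
  shows "snd (write_tensor d k legs f) \<le> write_cost i"
  unfolding write_cost_def assms(2)[symmetric] using assms(1) by (rule time_write)

lemma time_close_le:
  assumes "tensor_ok d k b0 t" "length (fst t) = i"
  shows "snd (close_legs d k A t) \<le> write_cost i"
  unfolding write_cost_def assms(2)[symmetric] using assms(1) d_pos by (rule time_close)

lemma legs_base: "fst (base c) = filter (\<lambda>e. e \<notin> F)
    [(left_arc c, \<rho> (left_arc c) \<noteq> 0), (right_arc c, \<rho> (right_arc c) \<noteq> 0),
     (right_arc c + 1, False), (left_arc c + 1, False)]"
  by (simp add: base_def crossing_tensor_def Let_def legs_close fst_write_tensor F_def
      left_arc_def right_arc_def)

lemma four_indices_less: "length is = 4 \<Longrightarrow> set is \<subseteq> {..<d} \<Longrightarrow> is ! 0 < d \<and> is ! 1 < d \<and> is ! 2 < d \<and> is ! 3 < d"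
  by (auto simp: numeral_eq_Suc length_Suc_conv)

lemma base_ok: "tensor_ok d k b0 (base c)"
  and time_base: "snd (crossing_tensor T D r \<rho> c) \<le> 2 * write_cost 4"
proof -
  let ?legs = "[(left_arc c, \<rho> (left_arc c) \<noteq> 0), (right_arc c, \<rho> (right_arc c) \<noteq> 0),
     (right_arc c + 1, False), (left_arc c + 1, False)]"
  let ?f = "\<lambda>is. encode k (rmat T (positive D c) (is ! 0) (is ! 1) (is ! 2) (is ! 3))"
  have f: "fits k b0 (?f is)" if "length is = length ?legs" "set is \<subseteq> {..<d}" for "is"
    using that four_indices_less[of "is"] by (intro entries) auto
  have ok: "tensor_ok d k b0 (fst (write_tensor d k ?legs ?f))" using f by (rule tensor_ok_write)
  show "tensor_ok d k b0 (base c)"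
    using tensor_ok_close[OF ok d_pos, of F]
    by (simp add: base_def crossing_tensor_def Let_def F_def left_arc_def right_arc_def)
  have "snd (write_tensor d k ?legs ?f) \<le> write_cost 4"
    using f by (rule time_write_le) simp_all
  moreover have "snd (close_legs d k F (fst (write_tensor d k ?legs ?f))) \<le> write_cost 4"
    using ok by (rule time_close_le) (simp add: fst_write_tensor)
  ultimately show "snd (crossing_tensor T D r \<rho> c) \<le> 2 * write_cost 4"
    by (simp add: crossing_tensor_def Let_def F_def left_arc_def right_arc_def)
qed

lemma value_base:
  assumes "\<And>e. \<sigma> e < d"
  shows "tensor_value d k (base c) \<sigma> = rmat T (positive D c)
    (zero_on F \<sigma> (left_arc c, \<rho> (left_arc c) \<noteq> 0)) (zero_on F \<sigma> (right_arc c, \<rho> (right_arc c) \<noteq> 0))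
    (zero_on F \<sigma> (Suc (right_arc c), False)) (zero_on F \<sigma> (Suc (left_arc c), False))"
proof -
  have z: "zero_on F \<sigma> e < d" for e using assms d_pos by (simp add: zero_on_def)
  show ?thesis
    unfolding base_def crossing_tensor_def Let_def
    by (simp add: value_close[OF assms] value_write[OF z] F_def[symmetric]
        left_arc_def[symmetric] right_arc_def[symmetric] decode_encode entries_laurent z)
qed

lemma legs_arc: "fst (arc_t j) = filter (\<lambda>e. e \<notin> F) [(j, False), (j, True)]"
  by (simp add: arc_t_def arc_tensor_def legs_close fst_write_tensor F_def)

lemma arc_ok: "tensor_ok d k b0 (arc_t j)"
  and time_arc: "snd (arc_tensor T D \<rho> j) \<le> 2 * write_cost 2"
proof -
  let ?legs = "[(j, False), (j, True)]"
  let ?f = "\<lambda>is. encode k (hmat T (\<rho> j = 1) (is ! 0) (is ! 1))"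
  have f: "fits k b0 (?f is)" if "length is = length ?legs" "set is \<subseteq> {..<d}" for "is"
    using that by (intro entries) (auto simp: length_Suc_conv numeral_eq_Suc)
  have ok: "tensor_ok d k b0 (fst (write_tensor d k ?legs ?f))" using f by (rule tensor_ok_write)
  show "tensor_ok d k b0 (arc_t j)"
    using tensor_ok_close[OF ok d_pos, of F] by (simp add: arc_t_def arc_tensor_def F_def)
  have "snd (write_tensor d k ?legs ?f) \<le> write_cost 2"
    using f by (rule time_write_le) simp_all
  moreover have "snd (close_legs d k F (fst (write_tensor d k ?legs ?f))) \<le> write_cost 2"
    using ok by (rule time_close_le) (simp add: fst_write_tensor)
  ultimately show "snd (arc_tensor T D \<rho> j) \<le> 2 * write_cost 2"
    by (simp add: arc_tensor_def F_def)
qed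

lemma value_arc:
  assumes "\<And>e. \<sigma> e < d" "j \<le> l" "\<rho> j \<noteq> 0"
  shows "tensor_value d k (arc_t j) \<sigma> = h_factor j (zero_on F \<sigma>)"
proof -
  have z: "zero_on F \<sigma> e < d" for e using assms d_pos by (simp add: zero_on_def)
  have "tensor_value d k (arc_t j) \<sigma> = hmat T (\<rho> j = 1) (zero_on F \<sigma> (j, False)) (zero_on F \<sigma> (j, True))"
    unfolding arc_t_def arc_tensor_def
    by (simp add: value_close[OF assms(1)] value_write[OF z] F_def[symmetric] decode_encode entries_laurent z)
  then show ?thesis using rots[OF assms(2)] assms(3) z
    by (auto simp: h_factor_def hpow_1 hpow_minus_1)
qed

end

context knot_network
begin

definition "absorb t j = do {
  a \<leftarrow> arc_tensor T D \<rho> j; merge tadd tmul k d [(j, j < length (code D))] [a, t] }"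

definition "vertex_bound = 4 * b0 + 3 * d"

definition "absorb_cost = 2 * write_cost 2
  + d ^ 11 * (14 * (nbits (int d) + 1) + 3 * op_cost k C vertex_bound)"

lemma fst_absorb: "fst (absorb t j) = fst (merge tadd tmul k d [joint j] [arc_t j, t])"
  by (simp add: absorb_def arc_t_def joint_def l_def)

lemma absorb_legs: "fst (fst (absorb t j)) = filter (\<lambda>e. e \<noteq> joint j) (fst (arc_t j) @ fst t)"
  by (simp add: fst_absorb fst_fst_merge)

lemma absorb:
  assumes "tensor_ok d k b t"
  shows "tensor_ok d k (b + (b0 + d)) (fst (absorb t j))"
    and "(\<And>e. \<sigma> e < d) \<Longrightarrow> tensor_value d k (fst (absorb t j)) \<sigma>
      = sum_over d [joint j] (\<lambda>\<sigma>. tensor_value d k (arc_t j) \<sigma> * tensor_value d k t \<sigma>) \<sigma>"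
    and "length (fst t) \<le> 8 \<Longrightarrow> b + (b0 + d) \<le> vertex_bound \<Longrightarrow> snd (absorb t j) \<le> absorb_cost"
proof -
  interpret M: merging tadd tmul k d C "[joint j]" "[arc_t j, t]" "[b0, b]"
    using ops assms arc_ok by unfold_locales auto
  have sb: "M.size_bound = b + (b0 + d)" by (simp add: M.size_bound_def)
  show "tensor_ok d k (b + (b0 + d)) (fst (absorb t j))"
    using M.tensor_ok_merge unfolding sb fst_absorb .
  show "tensor_value d k (fst (absorb t j)) \<sigma>
      = sum_over d [joint j] (\<lambda>\<sigma>. tensor_value d k (arc_t j) \<sigma> * tensor_value d k t \<sigma>) \<sigma>"
    if "\<And>e. \<sigma> e < d"
    using M.value_merge[of \<sigma>] that unfolding fst_absorb by simp
  assume len: "length (fst t) \<le> 8" and b: "b + (b0 + d) \<le> vertex_bound"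
  have legs: "length (concat M.legs) \<le> 10"
    using len length_filter_le[of "\<lambda>e. e \<notin> F" "[(j, False), (j, True)]"]
    by (simp add: M.legs_def legs_arc)
  then have free: "length M.free \<le> 10"
    unfolding M.free_def using length_filter_le order_trans by blast
  have "snd (merge tadd tmul k d [joint j] [arc_t j, t])
      \<le> d ^ (length M.free + length [joint j])
        * (M.address_cost + (length [arc_t j, t] + 1) * op_cost k C M.size_bound)"
    by (rule M.time_merge)
  also have "\<dots> \<le> d ^ 11 * (14 * (nbits (int d) + 1) + 3 * op_cost k C vertex_bound)"
  proof (intro mult_le_mono add_le_mono power_increasing)
    show "length M.free + length [joint j] \<le> 11" using free by simp
    show "1 \<le> d" using d_pos by simp
    show "M.address_cost \<le> 14 * (nbits (int d) + 1)"
      unfolding M.address_cost_def using legs by (intro mult_le_mono1) simp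
    show "op_cost k C M.size_bound \<le> op_cost k C vertex_bound"
      unfolding sb using b ops by (intro op_cost_mono) (auto simp: op_bound_def)
  qed simp
  finally have "snd (merge tadd tmul k d [joint j] [arc_t j, t])
    \<le> d ^ 11 * (14 * (nbits (int d) + 1) + 3 * op_cost k C vertex_bound)" .
  moreover have "snd (absorb t j) = snd (arc_tensor T D \<rho> j) + snd (merge tadd tmul k d [joint j] [arc_t j, t])"
    by (simp add: absorb_def arc_t_def joint_def l_def)
  ultimately show "snd (absorb t j) \<le> absorb_cost"
    using time_arc[of j] unfolding absorb_cost_def by linarith
qed

lemma ignores_arc_value: "i \<noteq> j \<Longrightarrow> ignores (tensor_value d k (arc_t i)) (joint j)"
  by (rule ignores_tensor_value) (auto simp: legs_arc joint_def)

text \<open>Absorbing an arc adds at most two legs and \<open>b0 + d\<close> bits. The sums over the joints may be collected because the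
  tensors of the other arcs do not involve the joint of an arc.\<close>

lemma foldT_absorb:
  assumes "tensor_ok d k b t" "distinct js" "length (fst t) + 2 * length js \<le> 10"
    "b + length js * (b0 + d) \<le> vertex_bound"
  shows "tensor_ok d k (b + length js * (b0 + d)) (fst (foldT absorb t js)) \<and>
    (\<forall>\<sigma>. (\<forall>e. \<sigma> e < d) \<longrightarrow> tensor_value d k (fst (foldT absorb t js)) \<sigma>
      = sum_over d (rev (map joint js))
          (\<lambda>\<sigma>. (\<Prod>j\<leftarrow>js. tensor_value d k (arc_t j) \<sigma>) * tensor_value d k t \<sigma>) \<sigma>) \<and>
    mset (fst (fst (foldT absorb t js))) = filter_mset (\<lambda>e. e \<notin> joint ` set js)
      (mset (concat (map (\<lambda>j. fst (arc_t j)) js) @ fst t)) \<and>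
    snd (foldT absorb t js) \<le> length js * absorb_cost"
  using assms
proof (induction js arbitrary: t b)
  case Nil
  then show ?case by simp
next
  case (Cons j js)
  let ?t = "fst (absorb t j)"
  let ?A = "\<lambda>\<sigma>. \<Prod>j\<leftarrow>js. tensor_value d k (arc_t j) \<sigma>"
  let ?R = "fst (foldT absorb ?t js)"
  have "length (fst ?t) \<le> length (fst (arc_t j) @ fst t)" unfolding absorb_legs by (rule length_filter_le)
  also have "\<dots> \<le> 2 + length (fst t)"
    using length_filter_le[of "\<lambda>e. e \<notin> F" "[(j, False), (j, True)]"] by (simp add: legs_arc)
  finally have len: "length (fst ?t) + 2 * length js \<le> 10" using Cons.prems(3) by simp
  have bnd: "b + (b0 + d) + length js * (b0 + d) \<le> vertex_bound" using Cons.prems(4) by simp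
  have IH: "tensor_ok d k (b + (b0 + d) + length js * (b0 + d)) ?R"
    "\<And>\<sigma>. (\<And>e. \<sigma> e < d) \<Longrightarrow> tensor_value d k ?R \<sigma>
      = sum_over d (rev (map joint js)) (\<lambda>\<sigma>. ?A \<sigma> * tensor_value d k ?t \<sigma>) \<sigma>"
    "mset (fst ?R) = filter_mset (\<lambda>e. e \<notin> joint ` set js)
      (mset (concat (map (\<lambda>j. fst (arc_t j)) js) @ fst ?t))"
    "snd (foldT absorb ?t js) \<le> length js * absorb_cost"
    using Cons.IH[OF absorb(1)[OF Cons.prems(1)] _ len bnd] Cons.prems(2) by simp_all
  have "\<forall>\<sigma>. (\<forall>e. \<sigma> e < d) \<longrightarrow> tensor_value d k ?R \<sigma> = sum_over d (rev (map joint (j # js)))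
      (\<lambda>\<sigma>. (\<Prod>j\<leftarrow>j # js. tensor_value d k (arc_t j) \<sigma>) * tensor_value d k t \<sigma>) \<sigma>"
  proof (intro allI impI)
    fix \<sigma> :: "nat \<times> bool \<Rightarrow> nat"
    assume "\<forall>e. \<sigma> e < d"
    then have lt: "\<And>e. \<sigma> e < d" by blast
    have "tensor_value d k ?R \<sigma>
        = sum_over d (rev (map joint js)) (\<lambda>\<sigma>. ?A \<sigma> * tensor_value d k ?t \<sigma>) \<sigma>"
      using lt by (rule IH(2))
    also have "\<dots> = sum_over d (rev (map joint js)) (\<lambda>\<sigma>. sum_over d [joint j]
        (\<lambda>\<sigma>. ?A \<sigma> * (tensor_value d k (arc_t j) \<sigma> * tensor_value d k t \<sigma>)) \<sigma>) \<sigma>"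
    proof (rule sum_over_cong)
      fix \<tau>
      assume a: "\<And>x. x \<notin> set (rev (map joint js)) \<Longrightarrow> \<tau> x = \<sigma> x" "\<And>x. x \<in> set (rev (map joint js)) \<Longrightarrow> \<tau> x < d"
      have lt': "\<tau> e < d" for e using a lt by metis
      have ign: "ignores ?A x" if "x \<in> set [joint j]" for x
        by (rule ignores_prod_list) (use that Cons.prems(2) in \<open>auto intro!: ignores_arc_value\<close>)
      have "sum_over d [joint j] (\<lambda>\<sigma>. ?A \<sigma> * (tensor_value d k (arc_t j) \<sigma> * tensor_value d k t \<sigma>)) \<tau>
          = ?A \<tau> * sum_over d [joint j] (\<lambda>\<sigma>. tensor_value d k (arc_t j) \<sigma> * tensor_value d k t \<sigma>) \<tau>"
        using ign by (rule sum_over_mult_left)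
      then show "?A \<tau> * tensor_value d k ?t \<tau> = sum_over d [joint j]
          (\<lambda>\<sigma>. ?A \<sigma> * (tensor_value d k (arc_t j) \<sigma> * tensor_value d k t \<sigma>)) \<tau>"
        by (simp only: absorb(2)[OF Cons.prems(1) lt'])
    qed
    also have "\<dots> = sum_over d (rev (map joint (j # js)))
        (\<lambda>\<sigma>. ?A \<sigma> * (tensor_value d k (arc_t j) \<sigma> * tensor_value d k t \<sigma>)) \<sigma>"
      by (simp only: list.map rev.simps sum_over_append)
    finally show "tensor_value d k ?R \<sigma> = sum_over d (rev (map joint (j # js)))
      (\<lambda>\<sigma>. (\<Prod>j\<leftarrow>j # js. tensor_value d k (arc_t j) \<sigma>) * tensor_value d k t \<sigma>) \<sigma>"
      by (simp only: list.map prod_list.Cons mult_ac)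
  qed
  moreover have "mset (fst ?R) = filter_mset (\<lambda>e. e \<notin> joint ` set (j # js))
      (mset (concat (map (\<lambda>j. fst (arc_t j)) (j # js)) @ fst t))"
  proof -
    have new: "joint j \<notin> set (concat (map (\<lambda>j. fst (arc_t j)) js))"
      using Cons.prems(2) by (auto simp: legs_arc joint_def)
    then have "filter (\<lambda>e. e \<noteq> joint j) (concat (map (\<lambda>j. fst (arc_t j)) js)) = concat (map (\<lambda>j. fst (arc_t j)) js)"
      by (intro filter_True) auto
    then have "mset (concat (map (\<lambda>j. fst (arc_t j)) js) @ fst ?t)
        = filter_mset (\<lambda>e. e \<noteq> joint j) (mset (concat (map (\<lambda>j. fst (arc_t j)) js) @ fst (arc_t j) @ fst t))"
      unfolding absorb_legs by (simp only: mset_filter[symmetric] filter_append)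
    then show ?thesis unfolding IH(3) by (simp add: filter_filter_mset conj_commute ac_simps)
  qed
  moreover have "snd (absorb t j) \<le> absorb_cost"
    using Cons.prems bnd by (intro absorb(3)[OF Cons.prems(1)]) auto
  ultimately show ?case using IH(1,4) by (simp add: add.assoc)
qed

definition "absorbed c = fst (foldT absorb (base c) (filter (\<lambda>j. \<rho> j \<noteq> 0) (ends c)))"
definition "vertex_tensor c = fst (crossing_with_arcs tadd tmul T D r \<rho> c)"

lemma vertex_tensor_eq: "vertex_tensor c = (map fst (fst (absorbed c)), snd (absorbed c))"
  by (simp add: vertex_tensor_def crossing_with_arcs_def absorbed_def base_def absorbed_eq absorb_def[abs_def])

lemma length_nonzero_ends: "length (filter (\<lambda>j. \<rho> j \<noteq> 0) (ends c)) \<le> 3"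
  by (rule order_trans[OF length_filter_le]) (simp add: ends_def)

lemma length_legs_base: "length (fst (base c)) \<le> 4"
  unfolding legs_base by (rule order_trans[OF length_filter_le]) simp

lemma absorb_all:
  assumes "c < n"
  defines "js \<equiv> filter (\<lambda>j. \<rho> j \<noteq> 0) (ends c)"
  shows "tensor_ok d k vertex_bound (absorbed c)"
    and "(\<And>e. \<sigma> e < d) \<Longrightarrow> tensor_value d k (absorbed c) \<sigma>
      = sum_over d (rev (map joint js))
          (\<lambda>\<sigma>. (\<Prod>j\<leftarrow>js. tensor_value d k (arc_t j) \<sigma>) * tensor_value d k (base c) \<sigma>) \<sigma>"
    and "mset (fst (absorbed c)) = filter_mset (\<lambda>e. e \<notin> joint ` set js)
      (mset (concat (map (\<lambda>j. fst (arc_t j)) js) @ fst (base c)))"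
    and "snd (crossing_with_arcs tadd tmul T D r \<rho> c)
      \<le> 4 * nbits (int l) + (2 * write_cost 4 + 3 * absorb_cost)"
proof -
  have js: "distinct js" "length js \<le> 3"
    using distinct_ends[OF assms(1)] length_nonzero_ends by (simp_all add: js_def)
  have "length js * (b0 + d) \<le> 3 * (b0 + d)" using js(2) by (rule mult_le_mono1)
  then have b: "b0 + length js * (b0 + d) \<le> vertex_bound" by (simp add: vertex_bound_def)
  have len: "length (fst (base c)) + 2 * length js \<le> 10" using js(2) length_legs_base[of c] by linarith
  note fold = foldT_absorb[OF base_ok js(1) len b, THEN conjunct1]
    foldT_absorb[OF base_ok js(1) len b, THEN conjunct2, THEN conjunct1, rule_format]
    foldT_absorb[OF base_ok js(1) len b, THEN conjunct2, THEN conjunct2, THEN conjunct1]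
    foldT_absorb[OF base_ok js(1) len b, THEN conjunct2, THEN conjunct2, THEN conjunct2]
  show "tensor_ok d k vertex_bound (absorbed c)"
    using fold(1) b unfolding absorbed_def js_def[symmetric] tensor_ok_def by (auto intro: fits_mono)
  show "(\<And>e. \<sigma> e < d) \<Longrightarrow> tensor_value d k (absorbed c) \<sigma>
      = sum_over d (rev (map joint js))
          (\<lambda>\<sigma>. (\<Prod>j\<leftarrow>js. tensor_value d k (arc_t j) \<sigma>) * tensor_value d k (base c) \<sigma>) \<sigma>"
    unfolding absorbed_def js_def[symmetric] by (rule fold(2))
  show "mset (fst (absorbed c)) = filter_mset (\<lambda>e. e \<notin> joint ` set js)
      (mset (concat (map (\<lambda>j. fst (arc_t j)) js) @ fst (base c)))"
    unfolding absorbed_def js_def[symmetric] by (rule fold(3))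
  have "snd (foldT absorb (base c) js) \<le> 3 * absorb_cost"
    using fold(4) js(2) mult_le_mono1[OF js(2), of absorb_cost] by linarith
  moreover have "snd (crossing_with_arcs tadd tmul T D r \<rho> c)
      = 4 * nbits (int l) + (snd (crossing_tensor T D r \<rho> c) + snd (foldT absorb (base c) js))"
    by (simp add: crossing_with_arcs_def base_def absorbed_eq absorb_def[abs_def] js_def l_def)
  ultimately show "snd (crossing_with_arcs tadd tmul T D r \<rho> c)
      \<le> 4 * nbits (int l) + (2 * write_cost 4 + 3 * absorb_cost)"
    using time_base[of c] by linarith
qed

text \<open>Absorbing an arc that ends at the crossing replaces its end by its start. The start of arc \<open>0\<close> and the end
  of the last arc are the free legs, so these two arcs leave no leg.\<close>

lemma legs_absorbed:
  assumes c: "c < n"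
  shows "mset (fst (absorbed c)) = image_mset (\<lambda>j. (j, False)) (filter_mset (\<lambda>j. j \<noteq> 0 \<and> j \<noteq> l)
    {#left_arc c, right_arc c, right_arc c + 1, left_arc c + 1#})"
proof -
  let ?u = "left_arc c" and ?v = "right_arc c"
  let ?js = "filter (\<lambda>j. \<rho> j \<noteq> 0) (ends c)"
  let ?keep = "\<lambda>e. e \<notin> joint ` set ?js \<and> e \<notin> F"
  let ?\<Phi> = "\<lambda>M. filter_mset ?keep M"
  let ?A = "\<lambda>j. if \<rho> j \<noteq> 0 then {#(j, False), (j, True)#} else {#}"
  let ?last = "?u + 1 = l \<or> ?v + 1 = l"
  note uv = arcs_of_crossing[OF c]
  have keep: "?keep (j, False) \<longleftrightarrow> j \<noteq> 0" "\<rho> j \<noteq> 0 \<Longrightarrow> \<not> ?keep (j, True)" if "j \<in> {?u, ?v}" for j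
    using that uv by (auto simp: ends_def joint_def F_eq)
  have keep_out: "?keep (j, False) \<longleftrightarrow> j \<noteq> l" if "j \<in> {?u + 1, ?v + 1}" for j
    using that uv by (auto simp: ends_def joint_def F_eq)
  have split_arc: "filter_mset P (?A j) + filter_mset P {#(j, \<rho> j \<noteq> 0)#} = (if j \<noteq> 0 then {#(j, False)#} else {#})"
    if "P (j, False) \<longleftrightarrow> j \<noteq> 0" "\<rho> j \<noteq> 0 \<Longrightarrow> \<not> P (j, True)" for P j
    using that by (cases "\<rho> j = 0"; cases "j = 0") simp_all
  have in_arc: "?\<Phi> (?A j) + ?\<Phi> {#(j, \<rho> j \<noteq> 0)#} = (if j \<noteq> 0 then {#(j, False)#} else {#})"
    if "j \<in> {?u, ?v}" for j
    by (rule split_arc) (use keep[OF that] in blast)+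
  have out_arc: "?\<Phi> {#(j, False)#} = (if j \<noteq> l then {#(j, False)#} else {#})"
    if "j \<in> {?u + 1, ?v + 1}" for j
    using keep_out[OF that] by simp
  have last_arc: "?\<Phi> (if ?last then ?A l else {#}) = {#}"
    by (auto simp: ends_def joint_def F_eq)
  have arcs: "mset (concat (map (\<lambda>j. fst (arc_t j)) (filter (\<lambda>j. \<rho> j \<noteq> 0) is)))
      = filter_mset (\<lambda>e. e \<notin> F) (\<Sum>j\<leftarrow>is. ?A j)" for "is"
    by (induction "is") (auto simp: legs_arc)
  have "mset (fst (absorbed c)) = ?\<Phi> ((\<Sum>j\<leftarrow>ends c. ?A j) +
      {#(?u, \<rho> ?u \<noteq> 0), (?v, \<rho> ?v \<noteq> 0), (?v + 1, False), (?u + 1, False)#})"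
    unfolding absorb_all(3)[OF c] mset_append arcs legs_base mset_filter
    by (simp only: filter_union_mset[symmetric] filter_filter_mset conj_commute mset.simps add_0_right)
  also have "\<dots> = (?\<Phi> (?A ?u) + ?\<Phi> {#(?u, \<rho> ?u \<noteq> 0)#}) + (?\<Phi> (?A ?v) + ?\<Phi> {#(?v, \<rho> ?v \<noteq> 0)#})
      + ?\<Phi> {#(?v + 1, False)#} + ?\<Phi> {#(?u + 1, False)#} + ?\<Phi> (if ?last then ?A l else {#})"
  proof -
    have "(\<Sum>j\<leftarrow>ends c. ?A j) = ?A ?u + ?A ?v + (if ?last then ?A l else {#})"
      by (simp only: ends_def map_append sum_list.append list.map sum_list_simps) (simp add: add.assoc)
    moreover have "{#a, b, e, f#} = {#a#} + {#b#} + {#e#} + {#f#}" for a b e f :: "nat \<times> bool"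
      by simp
    ultimately show ?thesis by (simp only: filter_union_mset ac_simps)
  qed
  also have "\<dots> = (if ?u \<noteq> 0 then {#(?u, False)#} else {#}) + (if ?v \<noteq> 0 then {#(?v, False)#} else {#})
      + (if ?v + 1 \<noteq> l then {#(?v + 1, False)#} else {#}) + (if ?u + 1 \<noteq> l then {#(?u + 1, False)#} else {#})"
    unfolding last_arc add_0_right by (intro arg_cong2[where f = "(+)"] in_arc out_arc) simp_all
  also have "\<dots> = image_mset (\<lambda>j. (j, False)) (filter_mset (\<lambda>j. j \<noteq> 0 \<and> j \<noteq> l) {#?u, ?v, ?v + 1, ?u + 1#})"
    using uv by auto
  finally show ?thesis .
qed

end

context knot_network
begin

text \<open>An arc of rotation number \<open>0\<close> has no vertex in the tensor network: its start and its end carry the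
  same index.\<close>

definition identify :: "nat set \<Rightarrow> (nat \<times> bool \<Rightarrow> nat) \<Rightarrow> nat \<times> bool \<Rightarrow> nat" where
  "identify J \<tau> = (\<lambda>(j, b). if j \<in> J \<and> b = (j < l) then \<tau> (j, \<not> b) else \<tau> (j, b))"

lemma inj_joint: "inj joint"
  by (rule injI) (simp add: joint_def)

lemma ignores_joint:
  assumes "\<And>\<tau> \<tau>'. (\<And>b. \<tau> (j, b) = \<tau>' (j, b)) \<Longrightarrow> f \<tau> = f \<tau>'" "j \<noteq> i"
  shows "ignores f (joint i)"
  unfolding ignores_def by (intro allI assms(1)) (simp add: joint_def assms(2))

lemma sum_over_identify:
  fixes K :: "(nat \<times> bool \<Rightarrow> nat) \<Rightarrow> laurent"
  assumes "distinct js" "\<And>e. \<sigma> e < d"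
  shows "sum_over d (map joint js)
      (\<lambda>\<tau>. (\<Prod>j\<leftarrow>js. of_bool (\<tau> (j, False) = \<tau> (j, True))) * K \<tau>) \<sigma> = K (identify (set js) \<sigma>)"
  using assms
proof (induction js arbitrary: \<sigma>)
  case Nil
  then show ?case by (simp add: identify_def)
next
  case (Cons j js)
  let ?y = "(j, \<not> j < l)"
  let ?\<delta> = "\<lambda>j \<tau>. of_bool (\<tau> (j, False) = \<tau> (j, True)) :: laurent"
  let ?R = "\<lambda>\<tau>. (\<Prod>j\<leftarrow>js. ?\<delta> j \<tau>) * K \<tau>"
  have ign: "ignores (?\<delta> j) x" if x: "x \<in> set (map joint js)" for x
  proof -
    obtain i where "x = joint i" "i \<in> set js" using x by auto
    then show ?thesis using Cons.prems(1) by (auto intro!: ignores_joint[of j])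
  qed
  have "sum_over d (map joint (j # js)) (\<lambda>\<tau>. (\<Prod>j\<leftarrow>j # js. ?\<delta> j \<tau>) * K \<tau>) \<sigma>
      = (\<Sum>i<d. sum_over d (map joint js) (\<lambda>\<tau>. ?\<delta> j \<tau> * ?R \<tau>) (\<sigma>(joint j := i)))"
    by (simp only: list.map sum_over.simps prod_list.Cons mult.assoc)
  also have "\<dots> = (\<Sum>i<d. of_bool (\<sigma> ?y = i) * sum_over d (map joint js) ?R (\<sigma>(joint j := i)))"
  proof (rule sum.cong[OF refl])
    fix i
    have "?\<delta> j (\<sigma>(joint j := i)) = of_bool (\<sigma> ?y = i)" by (auto simp: joint_def)
    then show "sum_over d (map joint js) (\<lambda>\<tau>. ?\<delta> j \<tau> * ?R \<tau>) (\<sigma>(joint j := i))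
        = of_bool (\<sigma> ?y = i) * sum_over d (map joint js) ?R (\<sigma>(joint j := i))"
      using sum_over_mult_left[of "map joint js" "?\<delta> j" d ?R "\<sigma>(joint j := i)"] ign by simp
  qed
  also have "\<dots> = sum_over d (map joint js) ?R (\<sigma>(joint j := \<sigma> ?y))"
    by (rule sum_of_bool_left) (rule Cons.prems(2))
  also have "\<dots> = K (identify (set js) (\<sigma>(joint j := \<sigma> ?y)))"
    using Cons.prems by (intro Cons.IH) auto
  also have "identify (set js) (\<sigma>(joint j := \<sigma> ?y)) = identify (set (j # js)) \<sigma>"
    using Cons.prems(1) by (auto simp: fun_eq_iff identify_def joint_def)
  finally show ?case .
qed

text \<open>Both ends of the arcs of rotation number \<open>0\<close> are identified, which removes their joints from the sum; for the
  other arcs the sum over the joint is what absorbing computes. The closed legs agree because arc \<open>0\<close>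
  starts and the last arc ends with index \<open>0\<close>.\<close>

lemma value_absorbed:
  assumes c: "c < n" and \<tau>: "\<And>e. \<tau> e < d" "\<tau> (0, False) = 0" "\<tau> (l, True) = 0"
  shows "sum_over d (map joint (ends c)) (\<lambda>\<tau>. (\<Prod>j\<leftarrow>ends c. h_factor j \<tau>) * crossing_weight c \<tau>) \<tau>
    = tensor_value d k (absorbed c) \<tau>"
proof -
  define js0 js1 where "js0 = filter (\<lambda>j. \<rho> j = 0) (ends c)" and "js1 = filter (\<lambda>j. \<rho> j \<noteq> 0) (ends c)"
  let ?\<delta> = "\<lambda>\<tau>. \<Prod>j\<leftarrow>js0. of_bool (\<tau> (j, False) = \<tau> (j, True)) :: laurent"
  let ?H = "\<lambda>\<tau>. \<Prod>j\<leftarrow>js1. h_factor j \<tau>"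
  let ?W = "crossing_weight c"
  let ?xs = "rev (map joint js1)"
  let ?E = "identify (set js0)"
  have l0: "0 < l" using r_less by simp
  note uv = arcs_of_crossing[OF c]
  have dist: "distinct (map joint (ends c))"
    using distinct_ends[OF c] inj_joint by (simp add: distinct_map inj_on_def)
  have sub: "distinct (map joint js0 @ ?xs)" "set (map joint js0 @ ?xs) = set (map joint (ends c))"
    using dist by (auto simp: js0_def js1_def distinct_map inj_on_def)
  have factors: "(\<Prod>j\<leftarrow>ends c. h_factor j \<tau>) * ?W \<tau> = ?\<delta> \<tau> * (?H \<tau> * ?W \<tau>)" for \<tau>
  proof -
    have "(\<Prod>j\<leftarrow>js0. h_factor j \<tau>) = ?\<delta> \<tau>"
      by (intro arg_cong[where f = prod_list] map_cong refl) (auto simp: js0_def h_factor_def hpow_0)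
    then show ?thesis
      using prod_list_filter_split[of "\<lambda>j. h_factor j \<tau>" "ends c" "\<lambda>j. \<rho> j \<noteq> 0"]
      by (simp add: js0_def js1_def mult.assoc)
  qed
  have "sum_over d (map joint (ends c)) (\<lambda>\<tau>. (\<Prod>j\<leftarrow>ends c. h_factor j \<tau>) * ?W \<tau>) \<tau>
      = sum_over d (map joint js0 @ ?xs) (\<lambda>\<tau>. ?\<delta> \<tau> * (?H \<tau> * ?W \<tau>)) \<tau>"
    unfolding factors using dist sub by (intro sum_over_permute) simp_all
  also have "\<dots> = sum_over d (map joint js0) (\<lambda>\<tau>. ?\<delta> \<tau> * sum_over d ?xs (\<lambda>\<tau>. ?H \<tau> * ?W \<tau>) \<tau>) \<tau>"
    unfolding sum_over_append
  proof (intro sum_over_cong sum_over_mult_left ignores_prod_list)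
    fix x j assume "x \<in> set ?xs" "j \<in> set js0"
    then obtain i where "x = joint i" "j \<noteq> i" by (auto simp: js0_def js1_def)
    then show "ignores (\<lambda>\<tau>. of_bool (\<tau> (j, False) = \<tau> (j, True)) :: laurent) x"
      by (auto intro!: ignores_joint[of j])
  qed
  also have "\<dots> = sum_over d ?xs (\<lambda>\<tau>. ?H \<tau> * ?W \<tau>) (?E \<tau>)"
    using distinct_ends[OF c] \<tau>(1) by (intro sum_over_identify) (simp_all add: js0_def)
  also have "\<dots> = sum_over d ?xs (\<lambda>\<tau>. ?H (?E \<tau>) * ?W (?E \<tau>)) \<tau>"
  proof (rule sum_over_transfer)
    fix x \<sigma> i assume "x \<in> set ?xs"
    then obtain j where "x = joint j" "j \<notin> set js0" by (auto simp: js0_def js1_def)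
    then show "?E (\<sigma>(x := i)) = (?E \<sigma>)(x := i)" by (auto simp: fun_eq_iff identify_def joint_def)
  qed
  also have "\<dots> = sum_over d ?xs (\<lambda>\<sigma>. (\<Prod>j\<leftarrow>js1. tensor_value d k (arc_t j) \<sigma>) * tensor_value d k (base c) \<sigma>) \<tau>"
  proof (rule sum_over_cong)
    fix \<sigma>
    assume a: "\<And>x. x \<notin> set ?xs \<Longrightarrow> \<sigma> x = \<tau> x" "\<And>x. x \<in> set ?xs \<Longrightarrow> \<sigma> x < d"
    have lt: "\<sigma> e < d" for e using a \<tau>(1) by metis
    have "(0, False) \<notin> set ?xs" "(l, True) \<notin> set ?xs" using l0 by (auto simp: joint_def)
    then have z: "\<sigma> (0, False) = 0" "\<sigma> (l, True) = 0" using a(1) \<tau>(2,3) by simp_all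
    have "h_factor j (?E \<sigma>) = tensor_value d k (arc_t j) \<sigma>" if j: "j \<in> set js1" for j
    proof -
      have j': "j \<le> l" "\<rho> j \<noteq> 0" using j ends_le[OF c] by (simp_all add: js1_def)
      then have "?E \<sigma> (j, b) = zero_on F \<sigma> (j, b)" for b
        using j z by (auto simp: identify_def zero_on_def F_eq js0_def js1_def)
      then show ?thesis using value_arc[OF lt j'] by (simp add: h_factor_def)
    qed
    then have "?H (?E \<sigma>) = (\<Prod>j\<leftarrow>js1. tensor_value d k (arc_t j) \<sigma>)"
      by (intro arg_cong[where f = prod_list] map_cong refl)
    moreover have "?E \<sigma> (j, True) = zero_on F \<sigma> (j, \<rho> j \<noteq> 0)" if "j \<in> {left_arc c, right_arc c}" for j
      using that uv z by (auto simp: identify_def zero_on_def F_eq js0_def ends_def)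
    moreover have "?E \<sigma> (Suc j, False) = zero_on F \<sigma> (Suc j, False)" if "j \<in> {left_arc c, right_arc c}" for j
      using that uv z by (auto simp: identify_def zero_on_def F_eq js0_def ends_def)
    ultimately show "?H (?E \<sigma>) * ?W (?E \<sigma>)
        = (\<Prod>j\<leftarrow>js1. tensor_value d k (arc_t j) \<sigma>) * tensor_value d k (base c) \<sigma>"
      by (simp add: crossing_weight_def value_base[OF lt])
  qed
  also have "\<dots> = tensor_value d k (absorbed c) \<tau>"
    using absorb_all(2)[OF c \<tau>(1)] by (simp add: js1_def)
  finally show ?thesis .
qed

lemma value_vertex_tensor: "tensor_value d k (vertex_tensor c) \<alpha> = tensor_value d k (absorbed c) (\<alpha> \<circ> fst)"
  by (simp add: vertex_tensor_eq tensor_value_def entry_def)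

lemma value_absorbed_inner:
  assumes "c < n"
  shows "tensor_value d k (absorbed c) \<tau> = tensor_value d k (vertex_tensor c) (\<tau> \<circ> (\<lambda>j. (j, False)))"
proof -
  have "map \<tau> (fst (absorbed c)) = map ((\<tau> \<circ> (\<lambda>j. (j, False))) \<circ> fst) (fst (absorbed c))"
  proof (rule map_cong[OF refl])
    fix e assume "e \<in> set (fst (absorbed c))"
    then have "e \<in># mset (fst (absorbed c))" by simp
    then obtain j where "e = (j, False)" unfolding legs_absorbed[OF assms] by auto
    then show "\<tau> e = ((\<tau> \<circ> (\<lambda>j. (j, False))) \<circ> fst) e" by simp
  qed
  then show ?thesis unfolding value_vertex_tensor by (simp only: tensor_value_def)
qed

lemma concat_ends: "distinct (concat (map ends [0..<n]))" "set (concat (map ends [0..<n])) = {..l}"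
proof -
  have "distinct (concat (map ends xs))" if "distinct xs" "set xs \<subseteq> {..<n}" for xs
    using that
  proof (induction xs)
    case (Cons c xs)
    then show ?case using distinct_ends[of c] ends_disjoint[of c] by fastforce
  qed simp
  from this[of "[0..<n]"] show "distinct (concat (map ends [0..<n]))"
    by (simp add: atLeast0LessThan)
  show "set (concat (map ends [0..<n])) = {..l}"
    using ends_le ends_cover by fastforce
qed

text \<open>Every joint is involved at a single crossing only. Therefore the sum over all joints
  factors over the crossings, and the remaining sum is over the starts of the arcs other than the first and the last.\<close>

lemma RT_eq_vertex_sum:
  "RT T D = sum_over d [1..<l] (\<lambda>\<alpha>. \<Prod>c\<leftarrow>[0..<n]. tensor_value d k (vertex_tensor c) \<alpha>) (\<lambda>_. 0)"
proof -
  let ?out = "map (\<lambda>j. (j, False)) [1..<l]"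
  let ?V = "\<lambda>c. map joint (ends c)"
  let ?g = "\<lambda>c \<tau>. (\<Prod>j\<leftarrow>ends c. h_factor j \<tau>) * crossing_weight c \<tau>"
  let ?P = "\<lambda>\<tau>. \<Prod>c\<leftarrow>[0..<n]. ?g c \<tau>"
  have l0: "0 < l" using r_less by simp
  have inner: "concat (map ?V [0..<n]) = map joint (concat (map ends [0..<n]))" by (simp add: map_concat o_def)
  have perm: "distinct arc_ends" "distinct ((l, True) # ?out @ concat (map ?V [0..<n]))"
    "set arc_ends = set ((l, True) # ?out @ concat (map ?V [0..<n]))"
  proof -
    have ae: "arc_ends = (0, True) # concat (map (\<lambda>j. map (Pair j) [False, True]) [1..<Suc l])"
      by (simp add: arc_ends_def)
    have "distinct (concat (map (\<lambda>j. map (Pair j) [False, True]) xs))" if "distinct xs" for xs :: "nat list"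
      using that by (induction xs) auto
    then have "distinct (concat (map (\<lambda>j. map (Pair j) [False, True]) [1..<Suc l]))" by (simp del: upt_Suc)
    then show "distinct arc_ends" unfolding ae by (auto simp del: upt_Suc)
    show "distinct ((l, True) # ?out @ concat (map ?V [0..<n]))"
      unfolding inner using concat_ends inj_joint
      by (auto simp: distinct_map inj_on_def joint_def simp del: set_concat)
    have "set ((l, True) # ?out @ concat (map ?V [0..<n]))
        = insert (l, True) ((\<lambda>j. (j, False)) ` {1..<l} \<union> joint ` {..l})"
      unfolding inner by (simp del: set_concat add: concat_ends)
    also have "\<dots> = {e. snd e \<and> fst e \<le> l \<or> \<not> snd e \<and> 1 \<le> fst e \<and> fst e \<le> l}"
      using l0 by (auto simp: joint_def image_iff)
    also have "\<dots> = set arc_ends"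
    proof (rule set_eqI)
      fix e :: "nat \<times> bool"
      have "e \<in> set arc_ends \<longleftrightarrow> e = (0, True) \<or> (\<exists>j. j \<in> {1..<Suc l} \<and> (e = (j, False) \<or> e = (j, True)))"
        by (auto simp: arc_ends_def simp del: upt_Suc)
      then show "e \<in> {e. snd e \<and> fst e \<le> l \<or> \<not> snd e \<and> 1 \<le> fst e \<and> fst e \<le> l} \<longleftrightarrow> e \<in> set arc_ends"
        by (cases e; cases "snd e") auto
    qed
    finally show "set arc_ends = set ((l, True) # ?out @ concat (map ?V [0..<n]))" by simp
  qed
  have network: "network \<tau> = of_bool (\<tau> (l, True) = 0) * ?P \<tau>" for \<tau>
  proof -
    have "(\<Prod>c\<leftarrow>cs. ?g c \<tau>) = (\<Prod>j\<leftarrow>concat (map ends cs). h_factor j \<tau>) * (\<Prod>c\<leftarrow>cs. crossing_weight c \<tau>)" for cs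
      by (induction cs) (auto simp: ac_simps)
    moreover have "(\<Prod>j\<leftarrow>concat (map ends [0..<n]). h_factor j \<tau>) = (\<Prod>j\<le>l. h_factor j \<tau>)"
      using prod.distinct_set_conv_list[OF concat_ends(1), of "\<lambda>j. h_factor j \<tau>"] concat_ends(2) by simp
    moreover have "(\<Prod>c\<leftarrow>[0..<n]. crossing_weight c \<tau>) = (\<Prod>c<n. crossing_weight c \<tau>)"
      using prod.distinct_set_conv_list[OF distinct_upt[of 0 n], of "\<lambda>c. crossing_weight c \<tau>"]
      by (simp add: atLeast0LessThan)
    ultimately show ?thesis by (simp add: network_def h_factor_def mult_ac)
  qed
  then have network_fun: "network = (\<lambda>\<tau>. of_bool (\<tau> (l, True) = 0) * ?P \<tau>)" by (rule ext)
  have "RT T D = sum_over d arc_ends network (\<lambda>_. 0)" by (simp add: RT_eq rt_operator_eq_network)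
  also have "\<dots> = sum_over d ((l, True) # ?out @ concat (map ?V [0..<n])) network (\<lambda>_. 0)"
    using perm by (rule sum_over_permute)
  \<comment> \<open>the end of the last arc is summed first, as its index must be \<open>0\<close>\<close>
  also have "\<dots> = (\<Sum>i<d. of_bool (0 = i) * sum_over d (?out @ concat (map ?V [0..<n])) ?P ((\<lambda>_. 0)((l, True) := i)))"
    unfolding sum_over.simps
  proof (rule sum.cong[OF refl])
    fix i
    have "sum_over d (?out @ concat (map ?V [0..<n])) (\<lambda>\<tau>. of_bool (\<tau> (l, True) = 0) * ?P \<tau>) ((\<lambda>_. 0)((l, True) := i))
        = of_bool (((\<lambda>_. 0)((l, True) := i)) (l, True) = 0)
          * sum_over d (?out @ concat (map ?V [0..<n])) ?P ((\<lambda>_. 0)((l, True) := i))"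
      by (rule sum_over_mult_left) (use perm(2) in \<open>auto simp: ignores_def\<close>)
    then show "sum_over d (?out @ concat (map ?V [0..<n])) network ((\<lambda>_. 0)((l, True) := i))
        = of_bool (0 = i) * sum_over d (?out @ concat (map ?V [0..<n])) ?P ((\<lambda>_. 0)((l, True) := i))"
      by (simp only: network_fun fun_upd_same eq_commute[of i 0])
  qed
  also have "\<dots> = sum_over d (?out @ concat (map ?V [0..<n])) ?P ((\<lambda>_. 0)((l, True) := 0))"
    by (rule sum_of_bool_left[OF d_pos])
  also have "\<dots> = sum_over d ?out (\<lambda>\<tau>. sum_over d (concat (map ?V [0..<n])) ?P \<tau>) (\<lambda>_. 0)"
    by (simp add: sum_over_append fun_upd_idem)
  also have "\<dots> = sum_over d ?out
      (\<lambda>\<tau>. (\<lambda>\<alpha>. \<Prod>c\<leftarrow>[0..<n]. tensor_value d k (vertex_tensor c) \<alpha>) (\<tau> \<circ> (\<lambda>j. (j, False)))) (\<lambda>_. 0)"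
  proof (rule sum_over_cong)
    fix \<tau> :: "nat \<times> bool \<Rightarrow> nat"
    assume a: "\<And>x. x \<notin> set ?out \<Longrightarrow> \<tau> x = 0" "\<And>x. x \<in> set ?out \<Longrightarrow> \<tau> x < d"
    have lt: "\<tau> e < d" for e using a d_pos by metis
    have z: "\<tau> (0, False) = 0" "\<tau> (l, True) = 0" by (rule a(1); auto)+
    have "sum_over d (concat (map ?V [0..<n])) ?P \<tau> = (\<Prod>c\<leftarrow>[0..<n]. sum_over d (?V c) (?g c) \<tau>)"
    proof (rule sum_over_concat_prod)
      fix c c' x assume c: "c \<in> set [0..<n]" "c' \<in> set [0..<n]" "c \<noteq> c'" "x \<in> set (?V c')"
      then obtain j where j: "j \<in> set (ends c')" "x = joint j" by auto
      then have nj: "j \<notin> set (ends c)" using ends_disjoint[of c c' j] c by auto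
      have "ignores (\<lambda>\<tau>. \<Prod>j\<leftarrow>ends c. h_factor j \<tau>) x"
        unfolding j(2) by (rule ignores_prod_list, rule ignores_joint) (use nj in \<open>auto simp: h_factor_def\<close>)
      moreover have "ignores (crossing_weight c) x"
      proof -
        have "x \<noteq> (left_arc c, True)" "x \<noteq> (right_arc c, True)"
          using nj j(2) by (auto simp: joint_def ends_def)
        moreover have out: "x \<noteq> (Suc i, False)" if i: "i \<in> {left_arc c, right_arc c}" for i
        proof
          assume "x = (Suc i, False)"
          moreover have "i < l" using i arcs_of_crossing[of c] c by auto
          ultimately have "j = l" "Suc i = l" using j(2) by (auto simp: joint_def)
          then show False using nj i by (auto simp: ends_def)
        qed
        ultimately show ?thesis using out[of "left_arc c"] out[of "right_arc c"]
          by (auto simp: ignores_def crossing_weight_def)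
      qed
      ultimately show "ignores (?g c) x" by (simp add: ignores_def)
    qed simp
    also have "\<dots> = (\<Prod>c\<leftarrow>[0..<n]. tensor_value d k (vertex_tensor c) (\<tau> \<circ> (\<lambda>j. (j, False))))"
      by (intro arg_cong[where f = prod_list] map_cong refl)
        (simp add: value_absorbed[OF _ lt z] value_absorbed_inner)
    finally show "sum_over d (concat (map ?V [0..<n])) ?P \<tau>
      = (\<lambda>\<alpha>. \<Prod>c\<leftarrow>[0..<n]. tensor_value d k (vertex_tensor c) \<alpha>) (\<tau> \<circ> (\<lambda>j. (j, False)))" .
  qed
  also have "\<dots> = sum_over d [1..<l] (\<lambda>\<alpha>. \<Prod>c\<leftarrow>[0..<n]. tensor_value d k (vertex_tensor c) \<alpha>) (\<lambda>_. 0)"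
    by (subst sum_over_map) (auto intro: injI simp: o_def)
  finally show ?thesis .
qed

end


section \<open>Contraction of multigraphs\<close>

definition each_edge_twice :: "multigraph \<Rightarrow> bool" where
  "each_edge_twice G \<longleftrightarrow> (\<forall>e\<in>set (concat G). count (mset (concat G)) e = 2)"

text \<open>Connectedness is expressed by splittings of the multiset of vertices, so that vertices with the same list of
  edges need not be told apart.\<close>

definition connected_graph :: "multigraph \<Rightarrow> bool" where
  "connected_graph G \<longleftrightarrow> G \<noteq> [] \<and> (\<forall>A B. mset G = A + B \<longrightarrow> A \<noteq> {#} \<longrightarrow> B \<noteq> {#} \<longrightarrow>
     (\<exists>a\<in>#A. \<exists>b\<in>#B. set a \<inter> set b \<noteq> {}))"

lemma mset_concat_split:
  "mset (concat G) = mset (concat (filter P G)) + mset (concat (filter (\<lambda>v. \<not> P v) G))"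
  by (induction G) (auto simp: ac_simps)

lemma not_incident_filter: "filter (\<lambda>e. e \<notin> set X) (concat (filter (\<lambda>v. \<not> incident X v) G)) = concat (filter (\<lambda>v. \<not> incident X v) G)"
  by (rule filter_True) (auto simp: incident_def)

lemma mset_concat_contract: "mset (concat (contract X G)) = filter_mset (\<lambda>e. e \<notin> set X) (mset (concat G))"
proof -
  have "mset (concat (contract X G)) = mset (filter (\<lambda>e. e \<notin> set X) (concat (filter (incident X) G)))
      + mset (filter (\<lambda>e. e \<notin> set X) (concat (filter (\<lambda>v. \<not> incident X v) G)))"
    unfolding not_incident_filter by (simp add: contract_def)
  then show ?thesis unfolding mset_concat_split[of G "incident X"] by (simp only: mset_filter filter_union_mset)
qed

lemma each_edge_twice_contract:
  assumes "each_edge_twice G"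
  shows "each_edge_twice (contract X G)"
  unfolding each_edge_twice_def
proof
  fix e assume "e \<in> set (concat (contract X G))"
  then have "e \<in># filter_mset (\<lambda>e. e \<notin> set X) (mset (concat G))"
    unfolding mset_concat_contract[symmetric] by simp
  then have "e \<in> set (concat G)" "e \<notin> set X" by auto
  then show "count (mset (concat (contract X G))) e = 2"
    using assms unfolding mset_concat_contract each_edge_twice_def by (simp del: set_concat)
qed

lemma size_filter_count:
  assumes "finite A" "\<And>x. x \<in> A \<Longrightarrow> count M x = c"
  shows "size (filter_mset (\<lambda>x. x \<in> A) M) = card A * c"
proof -
  have "set_mset (filter_mset (\<lambda>x. x \<in> A) M) \<subseteq> A" by auto
  then have "size (filter_mset (\<lambda>x. x \<in> A) M) = (\<Sum>x\<in>A. count (filter_mset (\<lambda>x. x \<in> A) M) x)"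
    unfolding size_multiset_overloaded_eq using assms(1)
    by (intro sum.mono_neutral_left) (auto simp: not_in_iff)
  also have "\<dots> = (\<Sum>x\<in>A. c)" using assms(2) by (intro sum.cong) auto
  finally show ?thesis by simp
qed

text \<open>Both ends of a chosen edge are at touched vertices. Hence the local width of a step is the number of legs of
  the new tensor plus the number of chosen edges, the exponent in the number of operations.\<close>

lemma touched_edges:
  assumes "each_edge_twice G" "distinct X" "set X \<subseteq> set (concat G)"
  shows "length (concat (filter (incident X) G))
    = length (filter (\<lambda>e. e \<notin> set X) (concat (filter (incident X) G))) + 2 * length X"
proof -
  let ?M = "mset (concat (filter (incident X) G))"
  have "count ?M x = 2" if "x \<in> set X" for x
  proof -
    have "x \<notin> set (concat (filter (\<lambda>v. \<not> incident X v) G))" using that by (auto simp: incident_def)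
    then have "count (mset (concat (filter (\<lambda>v. \<not> incident X v) G))) x = 0"
      by (simp only: count_eq_zero_iff set_mset_mset not_False_eq_True)
    moreover have "count (mset (concat G)) x = 2" using assms that by (auto simp: each_edge_twice_def)
    ultimately show ?thesis unfolding mset_concat_split[of G "incident X"] count_union by linarith
  qed
  then have "size (filter_mset (\<lambda>x. x \<in> set X) ?M) = card (set X) * 2" by (intro size_filter_count) auto
  then have "length (filter (\<lambda>x. x \<in> set X) (concat (filter (incident X) G))) = 2 * length X"
    using distinct_card[OF assms(2)] by (simp only: mset_filter[symmetric] size_mset mult.commute)
  then show ?thesis
    using sum_length_filter_compl[of "\<lambda>x. x \<in> set X" "concat (filter (incident X) G)"] by simp
qed

text \<open>In a splitting of the contracted graph, replace the new vertex by the vertices merged into it. An edge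
  between the two parts of the original graph is not contracted, as one of its ends is at an untouched vertex.\<close>

lemma connected_graph_contract:
  assumes conn: "connected_graph G" and X: "X \<noteq> []" "set X \<subseteq> set (concat G)"
  shows "connected_graph (contract X G)"
proof -
  let ?m = "filter (\<lambda>e. e \<notin> set X) (concat (filter (incident X) G))"
  let ?R = "mset (filter (\<lambda>v. \<not> incident X v) G)" and ?T = "mset (filter (incident X) G)"
  have G: "mset G = ?T + ?R" by (simp add: multiset_partition[symmetric])
  obtain x v where "x \<in> set X" "v \<in> set G" "x \<in> set v" using X by (cases X) auto
  then have T: "?T \<noteq> {#}" by (auto simp: incident_def filter_empty_conv)
  have key: "\<exists>a\<in>#A. \<exists>b\<in>#B. set a \<inter> set b \<noteq> {}" if AB: "add_mset ?m ?R = A + B" "?m \<in># A" "B \<noteq> {#}" for A B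
  proof -
    obtain A' where A: "A = add_mset ?m A'" using AB(2) by (blast dest: multi_member_split)
    then have R: "?R = A' + B" using AB(1) by simp
    then have "mset G = (?T + A') + B" unfolding G by (simp add: ac_simps)
    then obtain a b where ab: "a \<in># ?T + A'" "b \<in># B" "set a \<inter> set b \<noteq> {}"
      using conn T AB(3) unfolding connected_graph_def by (metis union_eq_empty)
    show ?thesis
    proof (cases "a \<in># A'")
      case True
      then show ?thesis using ab A by auto
    next
      case False
      then have a: "a \<in> set (filter (incident X) G)" using ab(1) by simp
      have "b \<in># ?R" unfolding R using ab(2) by simp
      then have "set b \<inter> set X = {}" by (simp add: incident_def)
      then have "set ?m \<inter> set b \<noteq> {}" using ab(3) a by auto
      moreover have "?m \<in># A" by (simp add: A)
      ultimately show ?thesis using ab(2) by blast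
    qed
  qed
  have "\<exists>a\<in>#A. \<exists>b\<in>#B. set a \<inter> set b \<noteq> {}"
    if AB: "mset (contract X G) = A + B" "A \<noteq> {#}" "B \<noteq> {#}" for A B
  proof -
    have AB': "add_mset ?m ?R = A + B" using AB(1) by (simp add: contract_def)
    have "?m \<in># add_mset ?m ?R" by simp
    then have "?m \<in># A \<or> ?m \<in># B" unfolding AB' by simp
    then show ?thesis
    proof
      assume "?m \<in># A"
      then show ?thesis using key AB' AB(3) by blast
    next
      assume "?m \<in># B"
      moreover have "add_mset ?m ?R = B + A" using AB' by (simp add: add.commute)
      ultimately show ?thesis using key[of B A] AB(2) by (metis inf_commute)
    qed
  qed
  then show ?thesis unfolding connected_graph_def by (simp add: contract_def)
qed

lemma connected_edgeless:
  assumes "connected_graph G" "set (concat G) = {}"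
  shows "\<exists>v. G = [v]"
proof (cases G)
  case Nil
  then show ?thesis using assms by (simp add: connected_graph_def)
next
  case (Cons v H)
  have "H = []"
  proof (rule ccontr)
    assume "H \<noteq> []"
    moreover have "mset G = {#v#} + mset H" by (simp add: Cons)
    ultimately obtain b where "b \<in> set H" "set v \<inter> set b \<noteq> {}"
      using assms(1) unfolding connected_graph_def by fastforce
    then show False using assms(2) by (auto simp: Cons)
  qed
  then show ?thesis using Cons by simp
qed

context knot_network
begin

lemma in_edge_less: "i < l \<Longrightarrow> in_edge D i < l"
  by (auto simp: in_edge_def l_def intro!: mod_less_divisor)

lemma in_edge_eq: "i < l \<Longrightarrow> in_edge D i = (case i of 0 \<Rightarrow> l - 1 | Suc j \<Rightarrow> j)"
  by (cases i) (simp_all add: in_edge_def l_def)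

lemma passages: "mset (concat (map (\<lambda>c. [left_passage D c, right_passage D c]) [0..<n])) = mset_set {..<l}"
proof -
  let ?P = "concat (map (\<lambda>c. [left_passage D c, right_passage D c]) [0..<n])"
  have "length (concat (map (\<lambda>c. [left_passage D c, right_passage D c]) cs)) = 2 * length cs" for cs
    by (induction cs) auto
  then have "length ?P = l" by (simp add: l_eq)
  moreover have set: "set ?P = {..<l}"
  proof (intro equalityI subsetI)
    fix i assume "i \<in> set ?P"
    then show "i \<in> {..<l}"
      using passages_less by auto
  next
    fix i assume i: "i \<in> {..<l}"
    obtain c b where "code D ! i = (c, b)" by (cases "code D ! i")
    then show "i \<in> set ?P" using passage_owner[of i c b] i by auto
  qed
  ultimately have "distinct ?P" by (intro card_distinct) simp
  then show ?thesis using set by (metis mset_set_set)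
qed

lemma mset_concat_diagram_graph:
  "mset (concat (diagram_graph D)) = mset_set {..<l} + mset_set {..<l}"
proof -
  have "mset (concat (map (\<lambda>c. [in_edge D (left_passage D c), in_edge D (right_passage D c),
      out_edge D (right_passage D c), out_edge D (left_passage D c)]) cs))
    = image_mset (in_edge D) (mset (concat (map (\<lambda>c. [left_passage D c, right_passage D c]) cs)))
      + mset (concat (map (\<lambda>c. [left_passage D c, right_passage D c]) cs))" for cs
    by (induction cs) (auto simp: out_edge_def)
  then have "mset (concat (diagram_graph D)) = image_mset (in_edge D) (mset_set {..<l}) + mset_set {..<l}"
    unfolding diagram_graph_def passages[symmetric] by blast
  moreover have inj: "inj_on (in_edge D) {..<l}"
  proof (rule inj_onI)
    fix i j assume "i \<in> {..<l}" "j \<in> {..<l}" "in_edge D i = in_edge D j"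
    then show "i = j" by (cases i; cases j) (simp_all add: in_edge_eq)
  qed
  moreover have "in_edge D ` {..<l} = {..<l}"
    using inj in_edge_less by (intro endo_inj_surj) auto
  ultimately show ?thesis by (simp add: image_mset_mset_set)
qed

lemma diagram_graph_edges: "each_edge_twice (diagram_graph D)" "set (concat (diagram_graph D)) = {..<l}"
  "length (concat (diagram_graph D)) = 2 * l"
proof -
  have "set_mset (mset (concat (diagram_graph D))) = {..<l}" unfolding mset_concat_diagram_graph by simp
  then show set: "set (concat (diagram_graph D)) = {..<l}" by simp
  show "each_edge_twice (diagram_graph D)"
    unfolding each_edge_twice_def set mset_concat_diagram_graph by simp
  have "size (mset (concat (diagram_graph D))) = 2 * l" unfolding mset_concat_diagram_graph by simp
  then show "length (concat (diagram_graph D)) = 2 * l" by (simp only: size_mset)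
qed

definition "vertex c = [in_edge D (left_passage D c), in_edge D (right_passage D c),
  out_edge D (right_passage D c), out_edge D (left_passage D c)]"

lemma diagram_graph_eq: "diagram_graph D = map vertex [0..<n]"
  by (simp add: diagram_graph_def vertex_def)

text \<open>Consecutive passages along the knot are joined by an edge, so if no edge joins the two parts, then all crossings
  lie in the same part as the first one.\<close>

lemma connected_diagram_graph: "connected_graph (diagram_graph D)"
proof -
  let ?own = "\<lambda>i. fst (code D ! i)"
  have own: "?own i < n \<and> i \<in> set (vertex (?own i)) \<and> in_edge D i \<in> set (vertex (?own i))" if i: "i < l" for i
  proof -
    obtain c b where cb: "code D ! i = (c, b)" by (cases "code D ! i")
    show ?thesis using passage_owner[OF i cb] cb by (auto simp: vertex_def out_edge_def)
  qed
  have "\<exists>a\<in>#A. \<exists>b\<in>#B. set a \<inter> set b \<noteq> {}"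
    if AB: "mset (diagram_graph D) = A + B" "A \<noteq> {#}" "B \<noteq> {#}" for A B
  proof (rule ccontr)
    assume no: "\<not> (\<exists>a\<in>#A. \<exists>b\<in>#B. set a \<inter> set b \<noteq> {})"
    have in_AB: "vertex c \<in># A + B" if "c < n" for c
    proof -
      have "vertex c \<in> set (diagram_graph D)" using that by (simp add: diagram_graph_eq)
      then have "vertex c \<in># mset (diagram_graph D)" by simp
      then show ?thesis unfolding AB(1) .
    qed
    have same: "vertex (?own i) \<in># M \<longleftrightarrow> vertex (?own 0) \<in># M" if "i < l" "M = A \<or> M = B" for i M
      using that(1)
    proof (induction i)
      case (Suc i)
      then have i: "i < l" "Suc i < l" by simp_all
      have "in_edge D (Suc i) = i" using i by (simp add: in_edge_def l_def)
      then have "i \<in> set (vertex (?own i)) \<inter> set (vertex (?own (Suc i)))"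
        using own[OF i(1)] own[OF i(2)] by auto
      then have ne: "set (vertex (?own i)) \<inter> set (vertex (?own (Suc i))) \<noteq> {}" by blast
      have "\<not> (vertex (?own i) \<in># A \<and> vertex (?own (Suc i)) \<in># B)"
        "\<not> (vertex (?own (Suc i)) \<in># A \<and> vertex (?own i) \<in># B)"
        using no ne by (blast, metis inf_commute)
      moreover have "vertex (?own i) \<in># A + B" "vertex (?own (Suc i)) \<in># A + B"
        using own i in_AB by blast+
      moreover have "\<not> (vertex (?own i) \<in># A \<and> vertex (?own i) \<in># B)"
        "\<not> (vertex (?own (Suc i)) \<in># A \<and> vertex (?own (Suc i)) \<in># B)"
        using no own i by blast+
      ultimately have "vertex (?own (Suc i)) \<in># M \<longleftrightarrow> vertex (?own i) \<in># M" using that(2) by auto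
      then show ?case using Suc by simp
    qed simp
    have all: "vertex c \<in># M \<longleftrightarrow> vertex (?own 0) \<in># M" if "c < n" "M = A \<or> M = B" for c M
    proof -
      have p: "left_passage D c < l" "?own (left_passage D c) = c"
        using passages_less[OF that(1)] code_passage[OF knot that(1)] by (simp_all add: left_passage_def)
      show ?thesis using same[OF p(1) that(2)] unfolding p(2) .
    qed
    have ex: "\<exists>c<n. vertex c \<in># M" if ne: "M \<noteq> {#}" and M: "M = A \<or> M = B" for M
    proof -
      obtain v where "v \<in># M" using ne by blast
      then have "v \<in># mset (diagram_graph D)" using M unfolding AB(1) by auto
      then show ?thesis using \<open>v \<in># M\<close> by (auto simp: diagram_graph_eq)
    qed
    obtain a b where "a < n" "vertex a \<in># A" "b < n" "vertex b \<in># B"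
      using ex[of A] ex[of B] AB by blast
    then have A: "vertex (?own 0) \<in># A" "vertex (?own 0) \<in># B" using all by blast+
    have "0 < l" using r_less by simp
    from own[OF this] have "set (vertex (?own 0)) \<inter> set (vertex (?own 0)) \<noteq> {}" by auto
    then show False using no A by blast
  qed
  moreover have "diagram_graph D \<noteq> []" using r_less by (auto simp: diagram_graph_eq l_eq)
  ultimately show ?thesis unfolding connected_graph_def by blast
qed

end


section \<open>Contraction of the network\<close>

lemma size_image_filter_le:
  assumes "\<And>x. x \<in># M \<Longrightarrow> P (f x) \<Longrightarrow> Q x"
  shows "size (filter_mset P (image_mset f M)) \<le> size (filter_mset Q M)"
  using assms by (induction M) (auto simp: le_SucI)

lemma sum_list_filter_split:
  fixes f :: "'a \<Rightarrow> nat"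
  shows "(\<Sum>x\<leftarrow>xs. f x) = (\<Sum>x\<leftarrow>filter P xs. f x) + (\<Sum>x\<leftarrow>filter (\<lambda>x. \<not> P x) xs. f x)"
  by (induction xs) auto

lemma filter_zip_map_fst:
  "map fst (filter (\<lambda>(v, t). P v) net) = filter P (map fst net)"
  by (induction net) auto

context knot_network
begin

abbreviation "edge_arc e \<equiv> arc_of_edge D r e"

lemma edge_arc_eq: "edge_arc e = (e + l + 1 - r) mod l"
  by (simp add: arc_of_edge_def l_def)

lemma edge_arc_less: "edge_arc e < l"
  unfolding edge_arc_eq using r_less by (intro mod_less_divisor) simp

lemma inj_edge_arc: "inj_on (arc_of_edge D r) {..<l}"
proof (rule inj_onI)
  have eq: "edge_arc e = (if e + 1 < r then e + l + 1 - r else if e + 1 - r = l then 0 else e + 1 - r)"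
    if "e < l" for e
  proof (cases "e + 1 < r")
    case True
    then show ?thesis using r_less by (simp add: edge_arc_eq)
  next
    case False
    then have "e + l + 1 - r = (e + 1 - r) + l" by simp
    then have "edge_arc e = (e + 1 - r) mod l" unfolding edge_arc_eq by simp
    moreover have "e + 1 - r \<le> l" using that by simp
    ultimately show ?thesis using False by (auto simp: le_less)
  qed
  fix e e' assume "e \<in> {..<l}" "e' \<in> {..<l}" "edge_arc e = edge_arc e'"
  then show "e = e'" using r_less by (auto simp: eq split: if_splits)
qed

text \<open>The cut edge has the number \<open>0\<close> and is not a leg of any tensor.\<close>

definition matches :: "nat list \<Rightarrow> nat tensor \<Rightarrow> bool" where
  "matches v t \<longleftrightarrow> mset (fst t) = filter_mset (\<lambda>j. j \<noteq> 0) (image_mset (arc_of_edge D r) (mset v))"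

text \<open>The least bound is taken so that the total size is a function of the network and can serve as a
  potential.\<close>

definition bits :: "nat tensor \<Rightarrow> nat" where
  "bits t = (LEAST b. tensor_ok d k b t)"

definition net_ok :: "(nat list \<times> nat tensor) list \<Rightarrow> bool" where
  "net_ok net \<longleftrightarrow> (\<forall>(v, t)\<in>set net. matches v t \<and> (\<exists>b. tensor_ok d k b t)) \<and>
    each_edge_twice (map fst net) \<and> set (concat (map fst net)) \<subseteq> {..<l}"

definition total_bits :: "(nat list \<times> nat tensor) list \<Rightarrow> nat" where
  "total_bits net = (\<Sum>(v, t)\<leftarrow>net. bits t)"

definition net_arcs :: "(nat list \<times> nat tensor) list \<Rightarrow> nat set" where
  "net_arcs net = (\<Union>(v, t)\<in>set net. set (fst t))"

definition net_value :: "(nat list \<times> nat tensor) list \<Rightarrow> laurent" where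
  "net_value net = sum_over d (sorted_list_of_set (net_arcs net))
     (\<lambda>\<alpha>. \<Prod>(v, t)\<leftarrow>net. tensor_value d k t \<alpha>) (\<lambda>_. 0)"

lemma finite_net_arcs [simp]: "finite (net_arcs net)"
  by (auto simp: net_arcs_def)

lemma net_valueI:
  assumes "distinct xs" "set xs = net_arcs net"
  shows "net_value net = sum_over d xs (\<lambda>\<alpha>. \<Prod>(v, t)\<leftarrow>net. tensor_value d k t \<alpha>) (\<lambda>_. 0)"
  unfolding net_value_def using assms by (intro sum_over_permute) auto

lemma tensor_ok_bits: "tensor_ok d k b t \<Longrightarrow> tensor_ok d k (bits t) t"
  unfolding bits_def by (rule LeastI)

lemma bits_le: "tensor_ok d k b t \<Longrightarrow> bits t \<le> b"
  unfolding bits_def by (rule Least_le)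

lemma matches_set: "matches v t \<Longrightarrow> set (fst t) = arc_of_edge D r ` set v - {0}"
  unfolding matches_def by (drule arg_cong[where f = set_mset]) auto

abbreviation "step net X \<equiv> contract_step tadd tmul T D r net X"

text \<open>The chosen arcs are involved in the touched tensors only. So the sum over their indices may be carried
  out first, on the product of these tensors, and this is the merged tensor. For the time, the exponent
  is at most the local width, since a vertex has at least as many edge-ends as its tensor has legs.\<close>

lemma contract_step:
  assumes net: "net_ok net" and X: "X \<noteq> []" "distinct X" "set X \<subseteq> set (concat (map fst net))"
  defines "G \<equiv> map fst net" and "net' \<equiv> fst (step net X)"
  shows "map fst net' = contract X G" "net_ok net'" "net_value net' = net_value net"
    "total_bits net' \<le> total_bits net + d * length X"
    "length (filter (incident X) G) \<ge> 1"
    "snd (step net X) \<le> (length net + length X + length (concat G) * length X) * nbits (int l)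
      + d ^ local_width X G * ((length net + length X + length (concat G) + 1) * (nbits (int d) + 1)
          + (length (filter (incident X) G) + 1) * op_cost k C (total_bits net + d * length X))"
proof -
  define touched rest where "touched = filter (\<lambda>(v, t). incident X v) net"
    and "rest = filter (\<lambda>(v, t). \<not> incident X v) net"
  define X' where "X' = filter (\<lambda>j. j \<noteq> 0) (map (arc_of_edge D r) X)"
  define ts where "ts = map snd touched"
  define new where "new = fst (merge tadd tmul k d X' ts)"
  define m where "m = filter (\<lambda>e. e \<notin> set X) (concat (map fst touched))"
  have net': "net' = (m, new) # rest"
    by (simp add: net'_def contract_step_def Let_def touched_def rest_def X'_def ts_def new_def m_def case_prod_unfold)
  have sub: "set touched \<subseteq> set net" "set rest \<subseteq> set net" by (auto simp: touched_def rest_def)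
  have ok: "matches v t" "tensor_ok d k (bits t) t" if "(v, t) \<in> set net" for v t
    using net that tensor_ok_bits unfolding net_ok_def by blast+
  have Xl: "set X \<subseteq> {..<l}" using X(3) net unfolding net_ok_def by blast
  have fst_touched: "map fst touched = filter (incident X) G" "map fst rest = filter (\<lambda>v. \<not> incident X v) G"
    unfolding touched_def rest_def G_def by (rule filter_zip_map_fst)+
  have twice: "each_edge_twice G" using net by (simp add: net_ok_def G_def)
  show map_fst: "map fst net' = contract X G"
    by (simp add: net' contract_def m_def fst_touched)
  have distX': "distinct X'"
    using X(2) inj_on_subset[OF inj_edge_arc Xl] by (simp add: X'_def distinct_map)
  have setX': "set X' = arc_of_edge D r ` set X - {0}" by (auto simp: X'_def)
  have lenX': "length X' \<le> length X" unfolding X'_def by (rule order_trans[OF length_filter_le]) simp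
  interpret M: merging tadd tmul k d C X' ts "map bits ts"
    using ops distX' ok sub by unfold_locales (auto simp: ts_def list_all2_map1 list_all2_map2 list_all2_same)
  have legs_eq: "M.legs = map fst (map snd touched)" unfolding M.legs_def by (simp add: ts_def)
  have legs: "mset (concat M.legs) = filter_mset (\<lambda>j. j \<noteq> 0) (image_mset (arc_of_edge D r) (mset (concat (map fst touched))))"
  proof -
    have "mset (concat (map fst (map snd xs))) = filter_mset (\<lambda>j. j \<noteq> 0)
        (image_mset (arc_of_edge D r) (mset (concat (map fst xs))))" if "set xs \<subseteq> set net" for xs
      using that
    proof (induction xs)
      case (Cons x xs)
      then have "matches (fst x) (snd x)" using ok(1)[of "fst x" "snd x"] by simp
      then show ?case using Cons by (simp add: matches_def)
    qed simp
    then show ?thesis using sub(1) unfolding legs_eq .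
  qed
  have arc_in_X': "edge_arc e \<in> set X' \<longleftrightarrow> edge_arc e \<noteq> 0 \<and> e \<in> set X" if "e < l" for e
    using inj_on_image_mem_iff[OF inj_edge_arc _ Xl, of e] that unfolding setX' by auto
  have edges_l: "e < l" if "e \<in> set v" "(v, t) \<in> set net" for e v t
    using net that unfolding net_ok_def by fastforce
  have fst_new: "fst new = M.free" unfolding new_def fst_fst_merge M.free_def M.legs_def ..
  have matches_new: "matches m new"
  proof -
    have "mset (fst new) = filter_mset (\<lambda>e. e \<notin> set X') (mset (concat M.legs))"
      by (simp add: fst_new M.free_def)
    also have "\<dots> = filter_mset (\<lambda>j. j \<notin> set X' \<and> j \<noteq> 0) (image_mset (arc_of_edge D r) (mset (concat (map fst touched))))"
      unfolding legs by (simp add: filter_filter_mset conj_commute)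
    also have "\<dots> = image_mset (arc_of_edge D r) (filter_mset (\<lambda>e. edge_arc e \<notin> set X' \<and> edge_arc e \<noteq> 0) (mset (concat (map fst touched))))"
      by (simp add: filter_mset_image_mset)
    also have "filter_mset (\<lambda>e. edge_arc e \<notin> set X' \<and> edge_arc e \<noteq> 0) (mset (concat (map fst touched)))
        = filter_mset (\<lambda>e. edge_arc e \<noteq> 0 \<and> e \<notin> set X) (mset (concat (map fst touched)))"
    proof (rule filter_mset_cong[OF refl])
      fix e assume "e \<in># mset (concat (map fst touched))"
      then have "e < l" using sub(1) edges_l by fastforce
      then show "(edge_arc e \<notin> set X' \<and> edge_arc e \<noteq> 0) = (edge_arc e \<noteq> 0 \<and> e \<notin> set X)"
        using arc_in_X' by blast
    qed
    also have "image_mset (arc_of_edge D r) \<dots> = filter_mset (\<lambda>j. j \<noteq> 0) (image_mset (arc_of_edge D r) (mset m))"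
      by (simp add: m_def filter_mset_image_mset filter_filter_mset conj_commute)
    finally show ?thesis by (simp add: matches_def)
  qed
  have ok_new: "tensor_ok d k M.size_bound new" unfolding new_def by (rule M.tensor_ok_merge)
  have size: "M.size_bound \<le> (\<Sum>(v, t)\<leftarrow>touched. bits t) + d * length X"
    unfolding M.size_bound_def using mult_le_mono2[OF lenX', of d]
    by (simp add: ts_def case_prod_unfold o_def)
  have split_bits: "total_bits net = (\<Sum>(v, t)\<leftarrow>touched. bits t) + (\<Sum>(v, t)\<leftarrow>rest. bits t)"
    unfolding total_bits_def touched_def rest_def case_prod_unfold by (rule sum_list_filter_split)
  have "bits new \<le> (\<Sum>(v, t)\<leftarrow>touched. bits t) + d * length X"
    using bits_le[OF ok_new] size by linarith
  then show "total_bits net' \<le> total_bits net + d * length X"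
    unfolding split_bits by (simp add: net' total_bits_def)
  show "net_ok net'"
    unfolding net_ok_def
  proof (intro conjI)
    show "\<forall>(v, t)\<in>set net'. matches v t \<and> (\<exists>b. tensor_ok d k b t)"
    proof
      fix vt assume "vt \<in> set net'"
      then consider "vt = (m, new)" | "(fst vt, snd vt) \<in> set net" using sub(2) by (auto simp: net')
      then show "case vt of (v, t) \<Rightarrow> matches v t \<and> (\<exists>b. tensor_ok d k b t)"
      proof cases
        case 1
        then show ?thesis using matches_new ok_new by auto
      next
        case 2
        then show ?thesis using ok[OF 2] by (auto simp: case_prod_unfold)
      qed
    qed
    show "each_edge_twice (map fst net')" unfolding map_fst using twice by (rule each_edge_twice_contract)
    have "set_mset (mset (concat (map fst net'))) \<subseteq> set_mset (mset (concat G))"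
      unfolding map_fst mset_concat_contract by auto
    then have "set (concat (map fst net')) \<subseteq> set (concat (map fst net))" by (simp only: set_mset_mset G_def)
    then show "set (concat (map fst net')) \<subseteq> {..<l}" using net unfolding net_ok_def by blast
  qed
  obtain x v where "x \<in> set X" "v \<in> set G" "x \<in> set v" using X(1,3) by (cases X) (auto simp: G_def)
  then have "filter (incident X) G \<noteq> []" by (auto simp: filter_empty_conv incident_def)
  then show "length (filter (incident X) G) \<ge> 1" by (simp add: Suc_le_eq)
  have touched_arcs: "set X' \<subseteq> set (concat M.legs)"
  proof
    fix j assume "j \<in> set X'"
    then obtain e where e: "e \<in> set X" "j = edge_arc e" "j \<noteq> 0" by (auto simp: setX')
    then obtain v t where v: "(v, t) \<in> set net" "e \<in> set v" using X(3) by auto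
    then have "(v, t) \<in> set touched" using e(1) by (auto simp: touched_def incident_def)
    moreover have "j \<in> set (fst t)" using matches_set[OF ok(1)[OF v(1)]] e v(2) by auto
    ultimately show "j \<in> set (concat M.legs)" by (force simp: legs_eq)
  qed
  have rest_arcs: "set X' \<inter> set (fst t) = {}" if "(v, t) \<in> set rest" for v t
  proof -
    have v: "(v, t) \<in> set net" "set v \<inter> set X = {}" using that by (auto simp: rest_def incident_def)
    have "edge_arc e \<notin> set X'" if "e \<in> set v" for e
      using arc_in_X'[of e] edges_l[OF that v(1)] v(2) that by blast
    then show ?thesis unfolding matches_set[OF ok(1)[OF v(1)]] by auto
  qed
  have arcs': "net_arcs net' = (set (concat M.legs) - set X') \<union> net_arcs rest"
    by (auto simp: net' net_arcs_def fst_new M.free_def)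
  have arcs: "net_arcs net = set (concat M.legs) \<union> net_arcs rest"
  proof -
    have "set net = set touched \<union> set rest" by (auto simp: touched_def rest_def)
    then show ?thesis by (simp add: net_arcs_def legs_eq UN_Un case_prod_unfold)
  qed
  have rest_disj: "net_arcs rest \<inter> set X' = {}" using rest_arcs by (fastforce simp: net_arcs_def)
  let ?E = "sorted_list_of_set (net_arcs net')"
  let ?R = "\<lambda>\<alpha>. \<Prod>(v, t)\<leftarrow>rest. tensor_value d k t \<alpha>"
  let ?Q = "\<lambda>\<alpha>. \<Prod>t\<leftarrow>ts. tensor_value d k t \<alpha>"
  have E: "distinct (?E @ X')" "set (?E @ X') = net_arcs net"
    using distX' rest_disj touched_arcs by (auto simp: arcs' arcs)
  have prods: "(\<Prod>(v, t)\<leftarrow>net. tensor_value d k t \<alpha>) = ?R \<alpha> * ?Q \<alpha>" for \<alpha>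
    using prod_list_filter_split[of "\<lambda>(v, t). tensor_value d k t \<alpha>" net "\<lambda>(v, t). incident X v"]
    by (simp add: touched_def rest_def ts_def case_prod_unfold o_def)
  have "net_value net = sum_over d ?E (\<lambda>\<alpha>. sum_over d X' (\<lambda>\<alpha>. ?R \<alpha> * ?Q \<alpha>) \<alpha>) (\<lambda>_. 0)"
    unfolding net_valueI[OF E] prods sum_over_append ..
  also have "\<dots> = sum_over d ?E (\<lambda>\<alpha>. \<Prod>(v, t)\<leftarrow>net'. tensor_value d k t \<alpha>) (\<lambda>_. 0)"
  proof (rule sum_over_cong)
    fix \<alpha> :: "nat \<Rightarrow> nat"
    assume a: "\<And>x. x \<notin> set ?E \<Longrightarrow> \<alpha> x = 0" "\<And>x. x \<in> set ?E \<Longrightarrow> \<alpha> x < d"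
    have lt: "\<alpha> e < d" for e using a d_pos by (cases "e \<in> set ?E") simp_all
    have "sum_over d X' (\<lambda>\<alpha>. ?R \<alpha> * ?Q \<alpha>) \<alpha> = ?R \<alpha> * sum_over d X' ?Q \<alpha>"
    proof (rule sum_over_mult_left)
      fix x assume "x \<in> set X'"
      then show "ignores ?R x"
        by (intro ignores_prod_list) (use rest_arcs in \<open>auto intro!: ignores_tensor_value\<close>)
    qed
    also have "sum_over d X' ?Q \<alpha> = tensor_value d k new \<alpha>"
      unfolding new_def using M.value_merge[of \<alpha>] lt by simp
    finally show "sum_over d X' (\<lambda>\<alpha>. ?R \<alpha> * ?Q \<alpha>) \<alpha> = (\<Prod>(v, t)\<leftarrow>net'. tensor_value d k t \<alpha>)"
      by (simp add: net' mult.commute)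
  qed
  finally show "net_value net' = net_value net" by (simp add: net_value_def)
  have len_touched: "length ts = length (filter (incident X) G)"
    unfolding fst_touched(1)[symmetric] by (simp add: ts_def)
  have len_m: "length (concat (filter (incident X) G)) = length m + 2 * length X"
    using touched_edges[OF twice X(2)] X(3) unfolding m_def fst_touched G_def by blast
  have width: "local_width X G = length m + length X"
    using len_m by (simp add: local_width_def length_concat)
  have "size (filter_mset (\<lambda>e. e \<notin> set X' \<and> e \<noteq> 0) (image_mset (arc_of_edge D r) (mset (concat (map fst touched)))))
      \<le> size (filter_mset (\<lambda>e. e \<notin> set X) (mset (concat (map fst touched))))"
    by (rule size_image_filter_le) (auto simp: setX')
  then have "length M.free \<le> length m"
    using legs by (simp add: M.free_def m_def filter_filter_mset conj_commute flip: size_mset)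
  then have exponent: "length M.free + length X' \<le> local_width X G" unfolding width using lenX' by linarith
  have "size (mset (concat M.legs)) \<le> size (mset (concat (map fst touched)))"
    unfolding legs by (rule order_trans[OF size_filter_mset_lesseq]) simp
  moreover have "length (concat (map fst touched)) \<le> length (concat G)"
    using arg_cong[OF mset_concat_split[of G "incident X"], of size] unfolding fst_touched by simp
  ultimately have len_legs: "length (concat M.legs) \<le> length (concat G)" by (simp only: size_mset)
  have len_ts: "length ts \<le> length net" by (simp add: ts_def touched_def)
  have cost: "op_cost k C M.size_bound \<le> op_cost k C (total_bits net + d * length X)"
    using size split_bits ops by (intro op_cost_mono) (auto simp: op_bound_def)
  have "snd (merge tadd tmul k d X' ts)
      \<le> d ^ (length M.free + length X') * (M.address_cost + (length ts + 1) * op_cost k C M.size_bound)"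
    by (rule M.time_merge)
  also have "\<dots> \<le> d ^ local_width X G * ((length net + length X + length (concat G) + 1) * (nbits (int d) + 1)
          + (length (filter (incident X) G) + 1) * op_cost k C (total_bits net + d * length X))"
    unfolding M.address_cost_def len_touched[symmetric]
    using exponent d_pos len_legs len_ts lenX' cost
    by (intro mult_le_mono add_le_mono power_increasing) auto
  finally have time: "snd (merge tadd tmul k d X' ts) \<le> \<dots>" .
  have sumlen: "(\<Sum>(v, t)\<leftarrow>net. length v) = length (concat G)"
    by (simp add: G_def length_concat case_prod_unfold o_def)
  have "snd (step net X) = (length net + length X + length (concat G) * length X) * nbits (int l)
      + snd (merge tadd tmul k d X' ts)"
    unfolding sumlen[symmetric]
    by (simp add: contract_step_def Let_def touched_def X'_def ts_def l_def)
  then show "snd (step net X) \<le> (length net + length X + length (concat G) * length X) * nbits (int l)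
      + d ^ local_width X G * ((length net + length X + length (concat G) + 1) * (nbits (int d) + 1)
          + (length (filter (incident X) G) + 1) * op_cost k C (total_bits net + d * length X))"
    using time by linarith
qed

end

context knot_network
begin

lemma length_contract: "length (contract X G) + length (filter (incident X) G) = length G + 1"
  using sum_length_filter_compl[of "incident X" G] by (simp add: contract_def)

definition "loop_cost w B = d ^ w * ((7 * n + 1) * (nbits (int d) + 1) + op_cost k C B) + 6 * n * nbits (int l)"

text \<open>A step with \<open>c\<close> touched vertices and \<open>x \<ge> 1\<close> chosen edges lowers the number of vertices and edge-ends by
  \<open>c - 1 + 2 x\<close>, which is at least \<open>c + 1\<close> and at least \<open>x\<close>. This pays for its \<open>c + 1\<close> rounds of operations and for
  the search for incident vertices, whose cost is proportional to \<open>x\<close>. The bound \<open>B\<close> on the bits is kept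
  because each chosen edge releases \<open>2 d\<close> and adds at most \<open>d\<close>.\<close>

lemma contract_all:
  assumes "net_ok net" "contraction_sequence (map fst net) S"
    "contraction_width (map fst net) S \<le> w"
    "length net \<le> n" "length (concat (map fst net)) \<le> 4 * n"
    "total_bits net + d * length (concat (map fst net)) \<le> B"
    "connected_graph (map fst net)"
  shows "(\<exists>v t. fst (foldT (contract_step tadd tmul T D r) net S) = [(v, t)] \<and> v = [] \<and>
      net_ok [(v, t)] \<and> net_value [(v, t)] = net_value net) \<and>
    snd (foldT (contract_step tadd tmul T D r) net S)
      \<le> (length net + length (concat (map fst net))) * loop_cost w B"
  using assms
proof (induction S arbitrary: net)
  case Nil
  then obtain v where v: "map fst net = [v]" using connected_edgeless[of "map fst net"] by auto
  then obtain t where "net = [(v, t)]" by (cases net) auto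
  moreover have "v = []" using Nil.prems(2) v by simp
  ultimately show ?case using Nil.prems(1) by simp
next
  case (Cons X S)
  let ?G = "map fst net"
  let ?net = "fst (step net X)"
  have X: "X \<noteq> []" "distinct X" "set X \<subseteq> set (concat ?G)" and seq: "contraction_sequence (contract X ?G) S"
    using Cons.prems(2) by simp_all
  note st = contract_step[OF Cons.prems(1) X]
  define x E c where "x = length X" and "E = length (concat ?G)" and "c = length (filter (incident X) ?G)"
  have twice: "each_edge_twice ?G" using Cons.prems(1) by (simp add: net_ok_def)
  have len': "length ?net + c = length net + 1"
    using length_contract[of X ?G] arg_cong[OF st(1), of length] by (simp add: c_def)
  have "length (concat ?G) = length (concat (contract X ?G)) + 2 * length X"
  proof -
    have "length (concat ?G) = length (concat (filter (incident X) ?G)) + length (concat (filter (\<lambda>v. \<not> incident X v) ?G))"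
      using arg_cong[OF mset_concat_split[of ?G "incident X"], of size] by simp
    then show ?thesis using touched_edges[OF twice X(2,3)] by (simp add: contract_def)
  qed
  then have E': "E = length (concat (map fst ?net)) + 2 * x" unfolding st(1) by (simp add: E_def x_def)
  have x1: "1 \<le> x" using X(1) by (simp add: x_def Suc_le_eq)
  have c1: "1 \<le> c" using st(5) by (simp add: c_def)
  have bits: "total_bits net + d * x \<le> B"
  proof -
    have "d * x \<le> d * E" using E' by (intro mult_le_mono2) simp
    then show ?thesis using Cons.prems(6) unfolding E_def by linarith
  qed
  have IH: "(\<exists>v t. fst (foldT (contract_step tadd tmul T D r) ?net S) = [(v, t)] \<and> v = [] \<and>
      net_ok [(v, t)] \<and> net_value [(v, t)] = net_value ?net) \<and>
    snd (foldT (contract_step tadd tmul T D r) ?net S)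
      \<le> (length ?net + length (concat (map fst ?net))) * loop_cost w B"
  proof (rule Cons.IH)
    show "net_ok ?net" by (rule st(2))
    show "contraction_sequence (map fst ?net) S" unfolding st(1) by (rule seq)
    show "contraction_width (map fst ?net) S \<le> w" using Cons.prems(3) unfolding st(1) by simp
    show "length ?net \<le> n" using len' c1 Cons.prems(4) by linarith
    show "length (concat (map fst ?net)) \<le> 4 * n" using E' Cons.prems(5) unfolding E_def by linarith
    show "connected_graph (map fst ?net)"
      unfolding st(1) using Cons.prems(7) X(1,3) by (rule connected_graph_contract)
    have "d * E = d * length (concat (map fst ?net)) + 2 * (d * x)" unfolding E' by (simp add: distrib_left)
    then show "total_bits ?net + d * length (concat (map fst ?net)) \<le> B"
      using st(4) Cons.prems(6) unfolding E_def x_def by linarith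
  qed
  let ?nb = "nbits (int l)" and ?nd = "nbits (int d) + 1"
  let ?W = "(7 * n + 1) * ?nd + op_cost k C B"
  have bounds: "length net \<le> n" "E \<le> 4 * n" "x \<le> 2 * n"
    using Cons.prems(4,5) E' unfolding E_def by linarith+
  have tick: "(length net + x + E * x) * ?nb \<le> (c - 1 + 2 * x) * (6 * n * ?nb)"
  proof -
    have "length net \<le> n * x" using bounds(1) x1 by (metis le_trans mult_le_mono2 mult.right_neutral)
    moreover have "x \<le> n * x" using bounds(3) x1 by (cases n) auto
    moreover have "E * x \<le> 4 * (n * x)" using mult_le_mono1[OF bounds(2), of x] by (simp only: mult.assoc)
    ultimately have "length net + x + E * x \<le> 6 * (n * x)" by linarith
    also have "\<dots> = x * (6 * n)" by simp
    also have "\<dots> \<le> (c - 1 + 2 * x) * (6 * n)" by (rule mult_le_mono1) simp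
    finally have "(length net + x + E * x) * ?nb \<le> (c - 1 + 2 * x) * (6 * n) * ?nb" by (rule mult_le_mono1)
    then show ?thesis by (simp only: mult.assoc)
  qed
  have work: "d ^ local_width X ?G * ((length net + x + E + 1) * ?nd + (c + 1) * op_cost k C (total_bits net + d * x))
      \<le> (c - 1 + 2 * x) * (d ^ w * ?W)"
  proof -
    have "op_cost k C (total_bits net + d * x) \<le> op_cost k C B"
      using bits ops by (intro op_cost_mono) (auto simp: op_bound_def)
    moreover have "length net + x + E + 1 \<le> 7 * n + 1" using bounds by linarith
    ultimately have "(length net + x + E + 1) * ?nd + (c + 1) * op_cost k C (total_bits net + d * x)
        \<le> (7 * n + 1) * ?nd + (c + 1) * op_cost k C B"
      by (intro add_le_mono mult_le_mono) auto
    also have "\<dots> \<le> (c + 1) * ?W" by (simp add: add_mult_distrib2)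
    also have "\<dots> \<le> (c - 1 + 2 * x) * ?W" using c1 x1 by (intro mult_le_mono1) linarith
    finally have inner: "(length net + x + E + 1) * ?nd + (c + 1) * op_cost k C (total_bits net + d * x)
        \<le> (c - 1 + 2 * x) * ?W" .
    have "d ^ local_width X ?G \<le> d ^ w"
      using Cons.prems(3) d_pos by (intro power_increasing) auto
    from mult_le_mono[OF this inner] show ?thesis by (simp only: mult.left_commute)
  qed
  have "snd (step net X) \<le> (c - 1 + 2 * x) * loop_cost w B"
    using st(6) tick work unfolding loop_cost_def add_mult_distrib2 x_def E_def c_def by linarith
  moreover have sum: "length net + E = length ?net + length (concat (map fst ?net)) + (c - 1 + 2 * x)"
    using len' E' c1 by linarith
  have "(length net + E) * loop_cost w B
      = (length ?net + length (concat (map fst ?net))) * loop_cost w B + (c - 1 + 2 * x) * loop_cost w B"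
    unfolding sum by (rule add_mult_distrib)
  ultimately have "snd (step net X) + (length ?net + length (concat (map fst ?net))) * loop_cost w B
      \<le> (length net + E) * loop_cost w B" by linarith
  then show ?case using IH st(3) unfolding E_def by (auto simp only: fst_foldT_Cons snd_foldT_Cons)
qed

definition "initial_net = zip (diagram_graph D) (map vertex_tensor [0..<n])"

lemma initial_net_eq: "initial_net = map (\<lambda>c. (vertex c, vertex_tensor c)) [0..<n]"
  by (simp add: initial_net_def diagram_graph_eq zip_map_map zip_same_conv_map)

text \<open>The wrap-around identifies the first and the last arc with the cut edge.\<close>

lemma edge_arc_out:
  assumes "i < l"
  shows "edge_arc (out_edge D i) = (long_passage D r i + 1) mod l"
    and "edge_arc (in_edge D i) = long_passage D r i"
proof -
  have "(long_passage D r i + 1) mod l = (i + l - r + 1) mod l"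
    by (simp add: long_passage_def l_def[symmetric] mod_Suc_eq)
  then show "edge_arc (out_edge D i) = (long_passage D r i + 1) mod l"
    using r_less by (simp add: edge_arc_eq out_edge_def Suc_diff_le)
  show "edge_arc (in_edge D i) = long_passage D r i"
  proof (cases i)
    case 0
    have "in_edge D i = l - 1" using in_edge_eq[OF assms] 0 by simp
    then have "edge_arc (in_edge D i) = ((l - r) + l) mod l" using r_less by (simp add: edge_arc_eq)
    then show ?thesis using 0 by (simp add: long_passage_def l_def)
  next
    case (Suc j)
    then show ?thesis using assms by (simp add: edge_arc_eq in_edge_eq long_passage_def l_def[symmetric])
  qed
qed

lemma matches_vertex:
  assumes "c < n"
  shows "matches (vertex c) (vertex_tensor c)"
proof -
  note uv = arcs_of_crossing[OF assms]
  note p = passages_less[OF assms]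
  have arcs: "edge_arc (in_edge D (left_passage D c)) = left_arc c"
    "edge_arc (in_edge D (right_passage D c)) = right_arc c"
    "edge_arc (out_edge D (left_passage D c)) = (left_arc c + 1) mod l"
    "edge_arc (out_edge D (right_passage D c)) = (right_arc c + 1) mod l"
    using edge_arc_out p by (simp_all add: left_arc_def right_arc_def)
  have out: "filter_mset (\<lambda>j. j \<noteq> 0) {#(i + 1) mod l#} = filter_mset (\<lambda>j. j \<noteq> 0 \<and> j \<noteq> l) {#i + 1#}"
    if "i < l" for i
    using that by (cases "i + 1 = l") auto
  have inc: "filter_mset (\<lambda>j. j \<noteq> 0) {#i#} = filter_mset (\<lambda>j. j \<noteq> 0 \<and> j \<noteq> l) {#i#}" if "i < l" for i
    using that by auto
  have four: "{#a, b, e, f#} = {#a#} + {#b#} + {#e#} + {#f#}" for a b e f :: nat by simp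
  have "mset (fst (vertex_tensor c)) = image_mset fst (mset (fst (absorbed c)))"
    by (simp add: vertex_tensor_eq)
  also have "\<dots> = filter_mset (\<lambda>j. j \<noteq> 0 \<and> j \<noteq> l) {#left_arc c, right_arc c, right_arc c + 1, left_arc c + 1#}"
    unfolding legs_absorbed[OF assms] by (simp only: multiset.map_comp o_def fst_conv multiset.map_ident)
  also have "\<dots> = filter_mset (\<lambda>j. j \<noteq> 0) {#left_arc c, right_arc c, (right_arc c + 1) mod l, (left_arc c + 1) mod l#}"
    unfolding four filter_union_mset using uv by (simp only: out inc)
  also have "\<dots> = filter_mset (\<lambda>j. j \<noteq> 0) (image_mset (arc_of_edge D r) (mset (vertex c)))"
    by (simp only: vertex_def mset.simps image_mset_add_mset image_mset_empty arcs)
  finally show ?thesis by (simp add: matches_def)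
qed

lemma vertex_tensor_ok: "c < n \<Longrightarrow> tensor_ok d k vertex_bound (vertex_tensor c)"
  using absorb_all(1) by (simp add: vertex_tensor_eq tensor_ok_def)

lemma map_fst_initial: "map fst initial_net = diagram_graph D"
  by (simp add: initial_net_eq diagram_graph_eq o_def)

lemma initial_net_ok: "net_ok initial_net"
proof -
  have "matches (vertex c) (vertex_tensor c) \<and> (\<exists>b. tensor_ok d k b (vertex_tensor c))" if "c < n" for c
    using matches_vertex[OF that] vertex_tensor_ok[OF that] by blast
  then have "\<forall>(v, t)\<in>set initial_net. matches v t \<and> (\<exists>b. tensor_ok d k b t)"
    unfolding initial_net_eq by simp
  then show ?thesis unfolding net_ok_def map_fst_initial using diagram_graph_edges(1,2) by blast
qed

lemma initial_bits: "total_bits initial_net \<le> n * vertex_bound"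
proof -
  have "(\<Sum>c\<leftarrow>cs. bits (vertex_tensor c)) \<le> length cs * vertex_bound" if "set cs \<subseteq> {..<n}" for cs
    using that
  proof (induction cs)
    case (Cons c cs)
    then have "bits (vertex_tensor c) \<le> vertex_bound" by (intro bits_le vertex_tensor_ok) auto
    then show ?case using Cons by simp
  qed simp
  from this[of "[0..<n]"] show ?thesis
    by (simp add: total_bits_def initial_net_eq o_def atLeast0LessThan)
qed

lemma net_value_initial: "net_value initial_net = RT T D"
proof -
  have "net_arcs initial_net = {1..<l}"
  proof (intro equalityI subsetI)
    fix j assume "j \<in> net_arcs initial_net"
    then obtain c where c: "c < n" "j \<in> set (fst (vertex_tensor c))"
      by (auto simp: net_arcs_def initial_net_eq)
    then have "j \<in> arc_of_edge D r ` set (vertex c) - {0}"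
      using matches_set[OF matches_vertex[OF c(1)]] by simp
    then show "j \<in> {1..<l}" using edge_arc_less by auto
  next
    fix j assume j: "j \<in> {1..<l}"
    then obtain c where c: "c < n" "j = left_arc c \<or> j = right_arc c" using arc_unique[of j] by auto
    have "j \<in> arc_of_edge D r ` set (vertex c)"
      using c(2) passages_less[OF c(1)] edge_arc_out(2) by (auto simp: vertex_def left_arc_def right_arc_def)
    then have "j \<in> set (fst (vertex_tensor c))"
      unfolding matches_set[OF matches_vertex[OF c(1)]] using j by simp
    then show "j \<in> net_arcs initial_net" using c(1) by (force simp: net_arcs_def initial_net_eq)
  qed
  then have "net_value initial_net = sum_over d [1..<l]
      (\<lambda>\<alpha>. \<Prod>(v, t)\<leftarrow>initial_net. tensor_value d k t \<alpha>) (\<lambda>_. 0)"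
    by (intro net_valueI) auto
  then show ?thesis by (simp add: RT_eq_vertex_sum initial_net_eq o_def)
qed

lemma contract_network:
  assumes "contraction_sequence (diagram_graph D) S" "contraction_width (diagram_graph D) S = w"
  shows "decode k (fst (contract_network tadd tmul T D r \<rho> S)) = RT T D"
    and "snd (contract_network tadd tmul T D r \<rho> S)
      \<le> n * (4 * nbits (int (2 * n)) + (2 * write_cost 4 + 3 * absorb_cost))
        + 5 * n * (d ^ w * ((7 * n + 1) * (nbits (int d) + 1) + op_cost k C (n * (vertex_bound + 4 * d)))
            + 6 * n * nbits (int (2 * n)))"
proof -
  let ?ts = "mapT (crossing_with_arcs tadd tmul T D r \<rho>) [0..<n]"
  let ?fold = "foldT (contract_step tadd tmul T D r) initial_net S"
  let ?B = "n * (vertex_bound + 4 * d)"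
  have run: "contract_network tadd tmul T D r \<rho> S = (entry d (snd (hd (fst ?fold))) [], snd ?ts + snd ?fold)"
  proof -
    have "zip (diagram_graph D) (fst ?ts) = initial_net"
      by (simp only: initial_net_def vertex_tensor_def[abs_def] fst_mapT)
    then show ?thesis by (simp add: contract_network_def prod_eq_iff)
  qed
  have len: "length initial_net = n" "length (concat (map fst initial_net)) = 4 * n"
    unfolding map_fst_initial diagram_graph_edges(3) by (simp_all add: initial_net_eq l_eq)
  have "(\<exists>v t. fst ?fold = [(v, t)] \<and> v = [] \<and> net_ok [(v, t)] \<and> net_value [(v, t)] = net_value initial_net) \<and>
    snd ?fold \<le> (length initial_net + length (concat (map fst initial_net))) * loop_cost w ?B"
  proof (rule contract_all)
    show "net_ok initial_net" by (rule initial_net_ok)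
    show "contraction_sequence (map fst initial_net) S" "contraction_width (map fst initial_net) S \<le> w"
      using assms by (simp_all add: map_fst_initial)
    show "connected_graph (map fst initial_net)" unfolding map_fst_initial by (rule connected_diagram_graph)
    show "total_bits initial_net + d * length (concat (map fst initial_net)) \<le> ?B"
      using initial_bits unfolding len by (simp add: algebra_simps)
  qed (simp_all add: len)
  then obtain t where t: "fst ?fold = [([], t)]" "net_ok [([], t)]" "net_value [([], t)] = RT T D"
    and time: "snd ?fold \<le> 5 * n * loop_cost w ?B"
    unfolding len net_value_initial by auto
  have "matches [] t" using t(2) by (simp add: net_ok_def)
  then have legs: "fst t = []" by (simp add: matches_def)
  then have "net_value [([], t)] = tensor_value d k t (\<lambda>_. 0)"
    by (simp add: net_value_def net_arcs_def)
  then show "decode k (fst (contract_network tadd tmul T D r \<rho> S)) = RT T D"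
    using t(1,3) legs by (simp add: run tensor_value_def)
  have "snd ?ts \<le> length [0..<n] * (4 * nbits (int l) + (2 * write_cost 4 + 3 * absorb_cost))"
    by (rule snd_mapT_le) (rule absorb_all(4), simp)
  then show "snd (contract_network tadd tmul T D r \<rho> S)
      \<le> n * (4 * nbits (int (2 * n)) + (2 * write_cost 4 + 3 * absorb_cost))
        + 5 * n * (d ^ w * ((7 * n + 1) * (nbits (int d) + 1) + op_cost k C ?B) + 6 * n * nbits (int (2 * n)))"
    using time unfolding run snd_conv loop_cost_def l_eq by simp
qed

end


section \<open>The total cost\<close>

lemma fits_encode_ex: "\<exists>b. fits k b (encode k p)"
proof -
  let ?x = "norm1 (encode k p)"
  have "?x \<le> int (nat ?x)" by simp
  also have "\<dots> \<le> int (2 ^ nat ?x)" using less_exp[of "nat ?x"] by (simp only: of_nat_le_iff less_imp_le)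
  also have "\<dots> \<le> 2 ^ (fst (encode k p) + nat ?x)" by (simp add: power_increasing)
  finally have "fits k (fst (encode k p) + nat ?x) (encode k p)"
    by (simp add: fits_def well_formed_encode)
  then show ?thesis ..
qed

lemma fits_encode_uniform:
  assumes "finite P"
  shows "\<exists>b. \<forall>p\<in>P. fits k b (encode k p)"
  using assms
proof (induction P)
  case (insert p P)
  then obtain b where b: "\<forall>p\<in>P. fits k b (encode k p)" by blast
  obtain b' where "fits k b' (encode k p)" using fits_encode_ex by blast
  then have "\<forall>q\<in>insert p P. fits k (max b b') (encode k q)"
    using b by (auto intro: fits_mono)
  then show ?case ..
qed simp

text \<open>The two matrices and their inverses have finitely many entries, so one constant bounds them all.\<close>

lemma entries_bound:
  obtains b where
    "\<And>s i j. i < dim T \<Longrightarrow> j < dim T \<Longrightarrow> fits (nvars T) b (encode (nvars T) (hmat T s i j))"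
    "\<And>s i j p q. i < dim T \<Longrightarrow> j < dim T \<Longrightarrow> p < dim T \<Longrightarrow> q < dim T \<Longrightarrow>
      fits (nvars T) b (encode (nvars T) (rmat T s i j p q))"
proof -
  let ?I = "{..<dim T}"
  let ?H = "(\<lambda>(s, i, j). hmat T s i j) ` (UNIV \<times> ?I \<times> ?I)"
  let ?R = "(\<lambda>(s, i, j, p, q). rmat T s i j p q) ` (UNIV \<times> ?I \<times> ?I \<times> ?I \<times> ?I)"
  obtain b where b: "\<forall>p\<in>?H \<union> ?R. fits (nvars T) b (encode (nvars T) p)"
    using fits_encode_uniform[of "?H \<union> ?R" "nvars T"] by auto
  show ?thesis
  proof (rule that)
    fix s i j assume "i < dim T" "j < dim T"
    then have "hmat T s i j \<in> ?H" by (intro image_eqI[of _ _ "(s, i, j)"]) auto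
    then show "fits (nvars T) b (encode (nvars T) (hmat T s i j))" using b by blast
  next
    fix s i j p q assume "i < dim T" "j < dim T" "p < dim T" "q < dim T"
    then have "rmat T s i j p q \<in> ?R" by (intro image_eqI[of _ _ "(s, i, j, p, q)"]) auto
    then show "fits (nvars T) b (encode (nvars T) (rmat T s i j p q))" using b by blast
  qed
qed

lemma half_le_ln: "2 \<le> n \<Longrightarrow> 1 / 2 \<le> ln (real n)"
proof -
  assume "2 \<le> n"
  then have "ln 2 \<le> ln (real n)" by simp
  moreover have "ln (1 / 2 :: real) \<le> 1 / 2 - 1" by (rule ln_le_minus_one) simp
  ultimately show ?thesis by (simp add: ln_div)
qed

lemma log2_le: "2 \<le> n \<Longrightarrow> log 2 (real n) \<le> 2 * ln (real n)"
proof -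
  assume n: "2 \<le> n"
  have "1 / 2 \<le> ln (2 :: real)" using half_le_ln[of 2] by simp
  then have "ln (real n) \<le> 2 * ln (real n) * ln 2"
    using half_le_ln[OF n] mult_left_mono[of "1 / 2" "ln 2" "2 * ln (real n)"] by simp
  then show ?thesis by (simp add: log_def divide_le_eq)
qed

lemma nbits_double_le:
  assumes "2 \<le> n"
  shows "real (nbits (int (2 * n))) \<le> 6 * ln (real n)"
proof -
  have "real (nbits (int (2 * n))) = of_int (\<lfloor>log 2 (real (2 * n))\<rfloor> + 1)"
    using assms by (simp add: nbits_def bitlen_alt_def)
  also have "\<dots> \<le> log 2 (real (2 * n)) + 1" by linarith
  also have "\<dots> = log 2 (real n) + 2" using assms by (simp add: log_mult)
  finally show ?thesis using log2_le[OF assms] half_le_ln[OF assms] by linarith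
qed

text \<open>For sizes linear in \<open>n\<close> there are \<open>O(n ^ (k + 1))\<close> packed bits, whose number has a logarithm of order \<open>log n\<close>.
  Constants are absorbed by the logarithm, as \<open>1 \<le> 2 ln n\<close> for \<open>n \<ge> 2\<close>.\<close>

lemma op_cost_linear_le:
  assumes "0 \<le> C"
  obtains K where "0 \<le> K" "\<And>n. 2 \<le> n \<Longrightarrow> real (op_cost k C (n * c)) \<le> K * real n ^ (k + 1) * ln (real n)"
proof -
  \<comment> \<open>\<open>a * n ^ (k + 1)\<close> bounds the number of packed bits and \<open>A * ln n\<close> its logarithm\<close>
  define a where "a = real ((k + 5) * (2 * c + 1) ^ (k + 1))"
  define A where "A = 2 * log 2 a + 2 * real (k + 1)"
  have a5: "5 \<le> a"
  proof -
    have "5 * 1 \<le> (k + 5) * (2 * c + 1) ^ (k + 1)" by (intro mult_le_mono one_le_power) auto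
    then show ?thesis unfolding a_def by linarith
  qed
  then have A0: "0 \<le> A" by (simp add: A_def)
  show ?thesis
  proof (rule that)
    show "0 \<le> a * (10 + C * A) + 2" using a5 A0 assms by simp
    fix n :: nat assume n: "2 \<le> n"
    let ?Y = "real (packed_bits k (n * c))" and ?l = "ln (real n)"
    note l = half_le_ln[OF n]
    have "2 * (n * c) + 1 \<le> (2 * c + 1) * n" using n by (simp add: algebra_simps)
    then have "(2 * (n * c) + 1) ^ (k + 1) \<le> ((2 * c + 1) * n) ^ (k + 1)" by (rule power_mono) simp
    then have "packed_bits k (n * c) \<le> (k + 5) * ((2 * c + 1) * n) ^ (k + 1)"
      unfolding packed_bits_def by (rule mult_le_mono2)
    then have "?Y \<le> real ((k + 5) * ((2 * c + 1) * n) ^ (k + 1))" by (simp only: of_nat_le_iff)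
    also have "\<dots> = a * real n ^ (k + 1)" by (simp only: a_def of_nat_mult of_nat_power power_mult_distrib mult.assoc)
    finally have Y: "?Y \<le> a * real n ^ (k + 1)" .
    have Y5: "5 \<le> ?Y" using packed_bits_ge_5[of k "n * c"] by simp
    have "log 2 ?Y \<le> log 2 (a * real n ^ (k + 1))" using Y Y5 by simp
    also have "\<dots> = log 2 a + real (k + 1) * log 2 (real n)"
      using a5 n by (simp add: log_mult log_nat_power algebra_simps)
    also have "\<dots> \<le> log 2 a * (2 * ?l) + real (k + 1) * (2 * ?l)"
    proof (rule add_mono)
      show "log 2 a \<le> log 2 a * (2 * ?l)" using mult_left_mono[of 1 "2 * ?l" "log 2 a"] l a5 by simp
      show "real (k + 1) * log 2 (real n) \<le> real (k + 1) * (2 * ?l)"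
        using log2_le[OF n] by (intro mult_left_mono) auto
    qed
    also have "\<dots> = A * ?l" by (simp add: A_def algebra_simps)
    finally have logY: "log 2 ?Y \<le> A * ?l" .
    have "5 + C * log 2 ?Y \<le> 10 * ?l + C * (A * ?l)"
      using mult_left_mono[OF logY assms] l by linarith
    then have "?Y * (5 + C * log 2 ?Y) \<le> (a * real n ^ (k + 1)) * (10 * ?l + C * (A * ?l))"
      using Y Y5 assms l A0 a5 by (intro mult_mono) auto
    moreover have "1 \<le> 2 * (real n ^ (k + 1) * ?l)"
    proof -
      have "1 \<le> real n ^ (k + 1)" using n by (intro one_le_power) simp
      then have "1 * (1 / 2) \<le> real n ^ (k + 1) * ?l" using l by (intro mult_mono) auto
      then show ?thesis by simp
    qed
    moreover have "real (op_cost k C (n * c)) \<le> ?Y * (5 + C * log 2 ?Y) + 1"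
    proof -
      have "0 \<le> ?Y * (5 + C * log 2 ?Y)" using Y5 assms by simp
      then show ?thesis unfolding op_cost_def by linarith
    qed
    ultimately have "real (op_cost k C (n * c))
        \<le> (a * real n ^ (k + 1)) * (10 * ?l + C * (A * ?l)) + 2 * (real n ^ (k + 1) * ?l)" by linarith
    then show "real (op_cost k C (n * c)) \<le> (a * (10 + C * A) + 2) * real n ^ (k + 1) * ?l"
      by (simp add: algebra_simps)
  qed
qed

text \<open>All terms are \<open>O(d ^ w n ^ (k + 2) ln n)\<close>, and \<open>ln n \<le> 4 (ln n) ^ 3\<close> because \<open>ln n \<ge> 1 / 2\<close>. The constant is
  chosen before \<open>n\<close> and \<open>w\<close>.\<close>

lemma total_cost_le:
  assumes "0 \<le> C" "0 < d"
  obtains K where "0 < K" "\<And>n w. 2 \<le> n \<Longrightarrow>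
    real (n * (4 * nbits (int (2 * n)) + V) + 5 * n * (d ^ w * ((7 * n + 1) * e + op_cost k C (n * c))
        + 6 * n * nbits (int (2 * n))))
      \<le> K * real d ^ w * real n ^ (k + 2) * ln (real n) ^ 3"
proof -
  obtain Q where Q: "0 \<le> Q" "\<And>n. 2 \<le> n \<Longrightarrow> real (op_cost k C (n * c)) \<le> Q * real n ^ (k + 1) * ln (real n)"
    using op_cost_linear_le[OF assms(1)] by blast
  define K where "K = 24 + 2 * real V + 80 * real e + 5 * Q + 180"
  have K0: "0 < K" using Q(1) by (simp add: K_def add_pos_nonneg)
  show ?thesis
  proof (rule that)
    show "0 < 4 * K" using K0 by simp
    fix n w :: nat assume n: "2 \<le> n"
    let ?l = "ln (real n)" and ?N = "real n ^ (k + 2)" and ?D = "real d ^ w"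
    let ?U = "?D * (?N * ?l)"
    note l = half_le_ln[OF n]
    have D1: "1 \<le> ?D" using assms(2) by (intro one_le_power) simp
    have N2: "real n ^ 2 \<le> ?N" using n by (intro power_increasing) auto
    have N1: "real n \<le> ?N" using n power_increasing[of 1 "k + 2" "real n"] by simp
    have U: "x * ?l \<le> ?U" if "x \<le> ?N" for x
    proof -
      have "x * ?l \<le> ?N * ?l" using that l by (intro mult_right_mono) auto
      also have "\<dots> \<le> ?D * (?N * ?l)" using mult_right_mono[OF D1, of "?N * ?l"] l by simp
      finally show ?thesis .
    qed
    have nb: "real (nbits (int (2 * n))) \<le> 6 * ?l" by (rule nbits_double_le[OF n])
    have t1: "real n * (4 * real (nbits (int (2 * n))) + real V) \<le> (24 + 2 * real V) * ?U"
    proof -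
      have "real V \<le> 2 * real V * ?l" using mult_left_mono[of 1 "2 * ?l" "real V"] l by simp
      then have "4 * real (nbits (int (2 * n))) + real V \<le> (24 + 2 * real V) * ?l" using nb by (simp add: algebra_simps)
      then have "real n * (4 * real (nbits (int (2 * n))) + real V) \<le> real n * ((24 + 2 * real V) * ?l)"
        by (intro mult_left_mono) auto
      also have "\<dots> = (24 + 2 * real V) * (real n * ?l)" by (simp add: mult_ac)
      also have "\<dots> \<le> (24 + 2 * real V) * ?U" by (rule mult_left_mono[OF U[OF N1]]) simp
      finally show ?thesis .
    qed
    have t2: "5 * real n * (?D * ((7 * real n + 1) * real e)) \<le> 80 * real e * ?U"
    proof -
      have "1 \<le> real n" using n by simp
      then have "(7 * real n + 1) * 1 \<le> 8 * real n * (2 * ?l)" using l by (intro mult_mono) auto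
      then have "5 * real n * ?D * real e * ((7 * real n + 1) * 1) \<le> 5 * real n * ?D * real e * (8 * real n * (2 * ?l))"
        by (intro mult_left_mono) auto
      also have "\<dots> = 80 * real e * (?D * (real n ^ 2 * ?l))" by (simp add: power2_eq_square)
      also have "\<dots> \<le> 80 * real e * ?U" using N2 l by (intro mult_left_mono mult_right_mono) auto
      finally have "5 * real n * ?D * real e * ((7 * real n + 1) * 1) \<le> 80 * real e * ?U" .
      moreover have "5 * real n * (?D * ((7 * real n + 1) * real e)) = 5 * real n * ?D * real e * ((7 * real n + 1) * 1)"
        by (simp only: mult_ac mult_1_right)
      ultimately show ?thesis by simp
    qed
    have t3: "5 * real n * (?D * real (op_cost k C (n * c))) \<le> 5 * Q * ?U"
    proof -
      have "5 * real n * (?D * real (op_cost k C (n * c))) \<le> 5 * real n * (?D * (Q * real n ^ (k + 1) * ?l))"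
        using Q(2)[OF n] by (intro mult_left_mono) auto
      then show ?thesis by (simp add: mult_ac)
    qed
    have t4: "5 * real n * (6 * real n * real (nbits (int (2 * n)))) \<le> 180 * ?U"
    proof -
      have "5 * real n * (6 * real n * real (nbits (int (2 * n)))) \<le> 5 * real n * (6 * real n * (6 * ?l))"
        using nb by (intro mult_left_mono) auto
      also have "\<dots> = 180 * (real n ^ 2 * ?l)" by (simp add: power2_eq_square)
      also have "\<dots> \<le> 180 * ?U" using U[OF N2] by simp
      finally show ?thesis .
    qed
    have "real (n * (4 * nbits (int (2 * n)) + V) + 5 * n * (d ^ w * ((7 * n + 1) * e + op_cost k C (n * c))
        + 6 * n * nbits (int (2 * n)))) =
      real n * (4 * real (nbits (int (2 * n))) + real V) + (5 * real n * (?D * ((7 * real n + 1) * real e))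
        + (5 * real n * (?D * real (op_cost k C (n * c))) + 5 * real n * (6 * real n * real (nbits (int (2 * n))))))"
      by (simp add: algebra_simps)
    also have "\<dots> \<le> (24 + 2 * real V) * ?U + (80 * real e * ?U + (5 * Q * ?U + 180 * ?U))"
      by (intro add_mono t1 t2 t3 t4)
    also have "\<dots> = K * ?U" by (simp only: K_def distrib_right add.assoc)
    also have "\<dots> \<le> K * (?D * (?N * (4 * ?l ^ 3)))"
    proof -
      have "(1 / 2) ^ 2 \<le> ?l ^ 2" using l by (intro power_mono) auto
      then have "1 * ?l \<le> (4 * ?l ^ 2) * ?l" using l by (intro mult_right_mono) (auto simp: power2_eq_square)
      then have "?l \<le> 4 * ?l ^ 3" by (simp add: power2_eq_square power3_eq_cube)
      then show ?thesis using K0 by (intro mult_left_mono) auto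
    qed
    finally show "real (n * (4 * nbits (int (2 * n)) + V) + 5 * n * (d ^ w * ((7 * n + 1) * e + op_cost k C (n * c))
        + 6 * n * nbits (int (2 * n)))) \<le> 4 * K * ?D * ?N * ?l ^ 3"
      by (simp add: mult_ac)
  qed
qed

theorem theorem1p2:
  fixes T :: rt_data and tadd tmul :: "int \<Rightarrow> int \<Rightarrow> nat"
  assumes "rt_system T"
    and "fast_int_op tadd"
    and "fast_int_op tmul"
  shows "\<exists>C>0. \<forall>(D :: diagram) (n :: nat) (r :: nat) (L :: slice list) (S :: nat list list) (w :: nat).
    knot_diagram D \<and> n = crossings D \<and> n \<ge> 2 \<and>
    long_form D r L \<and> (\<forall>j\<le>2 * n. rot L j \<in> {-1, 0, 1}) \<and>
    contraction_sequence (diagram_graph D) S \<and> w = contraction_width (diagram_graph D) S \<longrightarrow>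
    (case contract_network tadd tmul T D r (rot L) S of (result, time) \<Rightarrow>
       decode (nvars T) result = RT T D \<and>
       real time \<le> C * real (dim T) ^ w * real n ^ (nvars T + 2) * (ln (real n)) ^ 3)"
proof -
  obtain C where C: "op_bound C tadd" "op_bound C tmul" using fast_int_ops_bound assms(2,3) .
  then have C0: "0 \<le> C" by (simp add: op_bound_def)
  obtain b0 where b0:
    "\<And>s i j. i < dim T \<Longrightarrow> j < dim T \<Longrightarrow> fits (nvars T) b0 (encode (nvars T) (hmat T s i j))"
    "\<And>s i j p q. i < dim T \<Longrightarrow> j < dim T \<Longrightarrow> p < dim T \<Longrightarrow> q < dim T \<Longrightarrow>
      fits (nvars T) b0 (encode (nvars T) (rmat T s i j p q))"
    using entries_bound by blast
  let ?V = "2 * knot_network.write_cost T b0 4 + 3 * knot_network.absorb_cost T C b0"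
  let ?c = "knot_network.vertex_bound T b0 + 4 * dim T"
  obtain K where K: "0 < K" "\<And>n w. 2 \<le> n \<Longrightarrow>
    real (n * (4 * nbits (int (2 * n)) + ?V) + 5 * n * (dim T ^ w * ((7 * n + 1) * (nbits (int (dim T)) + 1)
        + op_cost (nvars T) C (n * ?c)) + 6 * n * nbits (int (2 * n))))
      \<le> K * real (dim T) ^ w * real n ^ (nvars T + 2) * ln (real n) ^ 3"
    using total_cost_le[OF C0 rt_system_dim_pos[OF assms(1)]] by blast
  show ?thesis
  proof (intro exI[of _ K] conjI allI impI)
    fix D n r L S w
    assume h: "knot_diagram D \<and> n = crossings D \<and> n \<ge> 2 \<and>
      long_form D r L \<and> (\<forall>j\<le>2 * n. rot L j \<in> {-1, 0, 1}) \<and>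
      contraction_sequence (diagram_graph D) S \<and> w = contraction_width (diagram_graph D) S"
    interpret long_knot T D r L using assms(1) h by unfold_locales auto
    interpret knot_network T D r L tadd tmul C b0
      using h C b0 by unfold_locales (auto simp: l_eq)
    have seq: "contraction_sequence (diagram_graph D) S" "contraction_width (diagram_graph D) S = w"
      using h by auto
    have "real (snd (contract_network tadd tmul T D r (rot L) S))
        \<le> K * real (dim T) ^ w * real n ^ (nvars T + 2) * ln (real n) ^ 3"
    proof (rule order_trans[OF _ K(2)])
      show "2 \<le> n" using h by simp
    qed (use contract_network(2)[OF seq] h in \<open>simp only: of_nat_le_iff\<close>)
    then show "case contract_network tadd tmul T D r (rot L) S of (result, time) \<Rightarrow>
       decode (nvars T) result = RT T D \<and>
       real time \<le> K * real (dim T) ^ w * real n ^ (nvars T + 2) * (ln (real n)) ^ 3"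
      using contract_network(1)[OF seq] by (simp add: case_prod_unfold)
  qed (rule K(1))
qed

end
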